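(* The following integral evaluations hold: $$\int_0^{e^{-2\pi/\sqrt{10}}}\frac{E(q)^8E(q^{10})^3}{E(q^2)^7}\,dq = 1-2\sqrt{\frac{10-4\sqrt5}{5}},$$ $$\int_0^{e^{-2\pi/\sqrt{10}}}\frac{q\,E(q)^3E(q^{10})^8}{E(q^5)^7}\,dq = \frac14\left(\sqrt{10-4\sqrt5}-1\right),$$ $$\int_0^{e^{-2\pi/\sqrt{10}}}\frac{E(q^2)^8E(q^5)^3}{E(q)^7}\,dq = \frac14\left(\sqrt{\frac{10+4\sqrt5}{5}}-1\right).$$
   Context: $E(q)=\prod_{j=1}^\infty(1-q^j)$ for $|q|<1$. *)

theory Defs
  imports "HOL-Analysis.Analysis"
begin

definition euler_E :: "real \<Rightarrow> real" where
  "euler_E q = (\<Prod>j. 1 - q ^ (Suc j))"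

end

theory Submission
  imports Defs
begin

text \<open>
  Write $E_n = E(q^n)$ and let $k = q \prod_n (1 - q^n)^{\epsilon(n)}$ be Ramanujan's function, where
  $\epsilon(n) = (-1)^{n-1} (n/5)$; it uniformises $X_1(10)$. The function
  $h = 1/k - k = E_2 E_5^5 / (q E_1 E_{10}^5)$ uniformises $X_0(10)$, and $h - 4$ and $h + 1$ are eta
  quotients, too. Moreover $q k'/k = E_1 E_2^2 E_5^3 / E_{10}^2$. With $s = 1/k + k$, so that
  $s^2 = h^2 + 4$, the three integrands are therefore the derivatives of $- s / (h + 1)$, $s / (4 h)$ and
  $s / (4 (h - 4))$. The upper limit corresponds to the fixed point $i/\sqrt{10}$ of the Fricke involution
  $h - 4 \mapsto 20 / (h - 4)$, so $h = 4 + 2 \sqrt 5$ there.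

  The identities for $h$ and $h + 1$ are instances of the three-term relation of theta functions, the one for
  $h - 4$ comes from multiplication by $2 - i$ on the Gaussian integers, and the one for $q k'/k$ reduces to a
  Lambert series of level 5, i.e. a difference of values of the Weierstrass function at 5-torsion points.
\<close>

subsection \<open>The q-Pochhammer symbol and the q-binomial theorem\<close>

text \<open>Since \<open>h = 1/k - k\<close> gives \<open>dk/k = - dh/s\<close>, the three integrals
  are those of \<open>(h - 4)/(h + 1)^2\<close>, \<open>1/h^2\<close> and
  \<open>(h + 1)/(h - 4)^2\<close> against \<open>dk/k\<close>. They are elementary because the
  conic \<open>s^2 = h^2 + 4\<close> is parametrised by k; the root s also accounts for the nested
  radicals. The work is done in k rather than h: at the lower limit h has a pole, whereas k vanishes
  and the primitives, as rational functions of k, take the values -1, 1/4 and 1/4 there.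

  The level drops from 10 to 5 in the logarithmic derivative because
  \<open>k(q) = r(q) r(q^2)^2\<close> for the Rogers-Ramanujan continued fraction r. The two
  resulting terms of weight 2 recombine through \<open>(h - 4) + 4 (h + 1) = 5 h\<close>.

  No transformation law of E itself is established. Only one theta transformation is available, in
  effect exchanging \<open>E(q)^2/E(q^2)\<close> and \<open>E(p^2)^2/E(p)\<close>; at the fixed
  point two instances of it relate \<open>E(Q)\<close>, \<open>E(Q^2)\<close>, \<open>E(Q^5)\<close>
  and \<open>E(Q^10)\<close>, and eliminating the exponential prefactors leaves the sixth power of
  \<open>h - 4\<close>.\<close>

text \<open>An enumeration of the integers reduces this to dominated convergence for ordinary
  series. It carries out the limits in the triple product and in the theta transformation.\<close>

lemma tannery_int:
  fixes f :: "nat \<Rightarrow> int \<Rightarrow> 'a::{real_normed_field,banach}"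
  assumes lim: "\<And>k. (\<lambda>n. f n k) \<longlonglongrightarrow> g k"
    and bound: "eventually (\<lambda>n. \<forall>k. norm (f n k) \<le> h k) sequentially"
    and h: "h summable_on UNIV"
  shows "(\<lambda>n. infsum (f n) UNIV) \<longlonglongrightarrow> infsum g UNIV"
proof -
  have bij: "bij_betw int_decode UNIV (UNIV :: int set)"
    using bij_int_decode by simp
  have eq: "infsum F UNIV = (\<Sum>n. F (int_decode n))"
    if "summable (\<lambda>n. norm (F (int_decode n)))" for F :: "int \<Rightarrow> 'a"
  proof -
    have "((\<lambda>n. F (int_decode n)) has_sum (\<Sum>n. F (int_decode n))) UNIV"
      using that summable_sums[OF summable_norm_cancel[OF that]] by (rule norm_summable_imp_has_sum)
    then have "(F has_sum (\<Sum>n. F (int_decode n))) UNIV"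
      using has_sum_reindex_bij_betw[OF bij] by blast
    then show ?thesis by (rule infsumI)
  qed
  have "summable (\<lambda>n. h (int_decode n))"
    using h summable_on_reindex_bij_betw[OF bij, of h] summable_on_imp_summable by blast
  moreover have "eventually (\<lambda>(k, n). norm (f n (int_decode k)) \<le> h (int_decode k)) (at_top \<times>\<^sub>F sequentially)"
    using eventually_prodI[OF eventually_True bound, of sequentially]
    by (rule eventually_mono) auto
  ultimately have *: "eventually (\<lambda>n. summable (\<lambda>k. norm (f n (int_decode k)))) sequentially \<and>
      summable (\<lambda>n. norm (g (int_decode n))) \<and>
      (\<lambda>n. \<Sum>k. f n (int_decode k)) \<longlonglongrightarrow> (\<Sum>k. g (int_decode k))"
    by (intro tannerys_theorem[where M = "\<lambda>k. h (int_decode k)"] lim) auto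
  have "(\<lambda>n. \<Sum>k. f n (int_decode k)) \<longlonglongrightarrow> infsum g UNIV"
    using * eq by simp
  \<comment> \<open>The majorant holds only for large n, so ordered and unordered sums are known to
    agree only there.\<close>
  moreover have "eventually (\<lambda>n. (\<Sum>k. f n (int_decode k)) = infsum (f n) UNIV) sequentially"
    using * by (auto elim!: eventually_mono simp: eq)
  ultimately show ?thesis
    by (rule Lim_transform_eventually)
qed

text \<open>The infinite symbol \<open>(a; q)_\<infinity>\<close>. It is kept generic because the
  arguments are real for the eta quotients and complex at fifth roots of unity.\<close>

definition qpoch :: "'a::{real_normed_field,banach} \<Rightarrow> 'a \<Rightarrow> 'a" where
  "qpoch a q = (\<Prod>j. 1 - a * q ^ j)"

lemma euler_E_eq_qpoch: "euler_E q = qpoch q q"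
  by (simp add: euler_E_def qpoch_def)

lemma qpoch_convergent:
  fixes q :: "'a::{real_normed_field,banach}"
  assumes "norm q < 1"
  shows "convergent_prod (\<lambda>j. 1 - a * q ^ j)"
proof -
  have "summable (\<lambda>j. norm ((1 - a * q ^ j) - 1))"
    using assms by (auto simp: norm_mult norm_power intro!: summable_mult summable_geometric)
  then show ?thesis
    by (intro abs_convergent_prod_imp_convergent_prod summable_imp_abs_convergent_prod)
qed

lemma qpoch_LIMSEQ:
  fixes q :: "'a::{real_normed_field,banach}"
  assumes "norm q < 1"
  shows "(\<lambda>n. \<Prod>j<n. 1 - a * q ^ j) \<longlonglongrightarrow> qpoch a q"
  using convergent_prod_LIMSEQ[OF qpoch_convergent[OF assms, of a]]
  unfolding qpoch_def LIMSEQ_lessThan_iff_atMost .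

lemma qpoch_eqI:
  fixes q :: "'a::{real_normed_field,banach}"
  assumes "norm q < 1" "(\<lambda>n. \<Prod>j<n. 1 - a * q ^ j) \<longlonglongrightarrow> L"
  shows "qpoch a q = L"
  using LIMSEQ_unique[OF qpoch_LIMSEQ[OF assms(1)] assms(2)] .

lemma qpoch_rec:
  fixes q :: "'a::{real_normed_field,banach}"
  assumes "norm q < 1"
  shows "qpoch a q = (1 - a) * qpoch (a * q) q"
proof -
  have "(\<lambda>n. (1 - a) * (\<Prod>j<n. 1 - (a * q) * q ^ j)) \<longlonglongrightarrow> (1 - a) * qpoch (a * q) q"
    by (intro tendsto_mult_left qpoch_LIMSEQ assms)
  also have "(\<lambda>n. (1 - a) * (\<Prod>j<n. 1 - (a * q) * q ^ j)) = (\<lambda>n. \<Prod>j<Suc n. 1 - a * q ^ j)"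
    by (simp add: prod.lessThan_Suc_shift mult.assoc del: prod.lessThan_Suc)
  finally have "(\<lambda>n. \<Prod>j<n. 1 - a * q ^ j) \<longlonglongrightarrow> (1 - a) * qpoch (a * q) q"
    by (rule filterlim_sequentially_Suc[THEN iffD1])
  then show ?thesis
    by (rule qpoch_eqI[OF assms])
qed

lemma qpoch_nonzero:
  fixes q :: "'a::{real_normed_field,banach}"
  assumes "norm q < 1" "\<And>j. a * q ^ j \<noteq> 1"
  shows "qpoch a q \<noteq> 0"
  unfolding qpoch_def
  using assms(2) by (intro prodinf_nonzero qpoch_convergent assms(1)) (metis eq_iff_diff_eq_0)

text \<open>Sort the factors by the residue of their exponent modulo n; the partial products of
  length \<open>n * m\<close> then split exactly. This is how E at \<open>q\<close>,
  \<open>q^2\<close> and \<open>q^5\<close> is brought to the common base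
  \<open>q^10\<close>.\<close>

lemma qpoch_dissect:
  fixes q :: "'a::{real_normed_field,banach}"
  assumes "norm q < 1" "n > 0"
  shows "qpoch a q = (\<Prod>i<n. qpoch (a * q ^ i) (q ^ n))"
proof -
  have n: "norm (q ^ n) < 1"
    using assms by (simp add: norm_power power_less_one_iff)
  have "(\<Prod>j<n * m. 1 - a * q ^ j) = (\<Prod>i<n. \<Prod>j<m. 1 - (a * q ^ i) * (q ^ n) ^ j)" for m
  proof (induction m)
    case (Suc m)
    have "(\<Prod>j<n * Suc m. 1 - a * q ^ j) = (\<Prod>j\<in>{..<n * m} \<union> {n * m..<n * m + n}. 1 - a * q ^ j)"
      by (rule prod.cong) auto
    also have "\<dots> = (\<Prod>j<n * m. 1 - a * q ^ j) * (\<Prod>j=n * m..<n * m + n. 1 - a * q ^ j)"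
      by (rule prod.union_disjoint) auto
    also have "(\<Prod>j=n * m..<n * m + n. 1 - a * q ^ j) = (\<Prod>i<n. 1 - (a * q ^ i) * (q ^ n) ^ m)"
      by (rule prod.reindex_bij_witness[of _ "\<lambda>i. i + n * m" "\<lambda>i. i - n * m"])
         (auto simp: mult.assoc simp flip: power_mult power_add)
    finally show ?case
      by (simp add: Suc.IH prod.distrib)
  qed simp
  moreover have "filterlim (\<lambda>m. n * m) sequentially sequentially"
    using assms(2) by (intro filterlim_subseq strict_monoI) auto
  then have "(\<lambda>m. \<Prod>j<n * m. 1 - a * q ^ j) \<longlonglongrightarrow> qpoch a q"
    by (rule filterlim_compose[OF qpoch_LIMSEQ[OF assms(1)]])
  moreover have "(\<lambda>m. \<Prod>i<n. \<Prod>j<m. 1 - (a * q ^ i) * (q ^ n) ^ j) \<longlonglongrightarrow> (\<Prod>i<n. qpoch (a * q ^ i) (q ^ n))"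
    by (intro tendsto_prod qpoch_LIMSEQ n)
  ultimately show ?thesis
    by (simp add: LIMSEQ_unique)
qed

lemma qpoch_mult_minus:
  fixes q :: "'a::{real_normed_field,banach}"
  assumes "norm q < 1"
  shows "qpoch a q * qpoch (- a) q = qpoch (a\<^sup>2) (q\<^sup>2)"
proof -
  have "(\<lambda>n. (\<Prod>j<n. 1 - a * q ^ j) * (\<Prod>j<n. 1 - (- a) * q ^ j)) \<longlonglongrightarrow> qpoch a q * qpoch (- a) q"
    by (intro tendsto_mult qpoch_LIMSEQ assms)
  also have "(\<lambda>n. (\<Prod>j<n. 1 - a * q ^ j) * (\<Prod>j<n. 1 - (- a) * q ^ j)) = (\<lambda>n. \<Prod>j<n. 1 - a\<^sup>2 * (q\<^sup>2) ^ j)"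
    by (simp add: fun_eq_iff power2_eq_square algebra_simps power_mult_distrib flip: prod.distrib)
  finally show ?thesis
    using assms by (intro qpoch_eqI[symmetric]) (auto simp: norm_power power_less_one_iff)
qed

lemma qpoch_of_real:
  assumes "\<bar>q\<bar> < 1"
  shows "qpoch (of_real a) (of_real q :: 'a::{real_normed_field,banach}) = of_real (qpoch a q)"
proof -
  have "(\<lambda>n. of_real (\<Prod>j<n. 1 - a * q ^ j) :: 'a) \<longlonglongrightarrow> of_real (qpoch a q)"
    using assms by (intro tendsto_of_real qpoch_LIMSEQ) auto
  then show ?thesis
    using assms by (intro qpoch_eqI) auto
qed

lemma qpoch_pos:
  fixes q :: real
  assumes "0 \<le> q" "q < 1" "a < 1"
  shows "qpoch a q > 0"
proof -
  have lt: "a * q ^ j < 1" for j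
  proof (cases "a \<ge> 0")
    case True
    then have "a * q ^ j \<le> a * 1"
      using assms by (intro mult_left_mono power_le_one) auto
    then show ?thesis using assms by simp
  next
    case False
    then have "a * q ^ j \<le> 0"
      using assms by (intro mult_nonpos_nonneg) auto
    then show ?thesis by simp
  qed
  have "qpoch a q \<ge> 0"
    using lt assms less_imp_le by (intro LIMSEQ_le_const[OF qpoch_LIMSEQ] exI[of _ 0] allI impI prod_nonneg) auto
  moreover have "qpoch a q \<noteq> 0"
    using lt assms by (intro qpoch_nonzero) (auto simp: less_imp_neq)
  ultimately show ?thesis by simp
qed

section \<open>Gaussian binomial coefficients\<close>

text \<open>The finite symbol \<open>(q; q)_n\<close>, without the factors \<open>1 - q\<close> in
  the denominator that the q-factorial usually has: they cancel in q-binomials, and in this form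
  there is a limit as n grows.\<close>

definition qfact :: "nat \<Rightarrow> 'a::{real_normed_field,banach} \<Rightarrow> 'a" where
  "qfact n q = (\<Prod>j<n. 1 - q ^ Suc j)"

lemma qfact_Suc: "qfact (Suc n) q = qfact n q * (1 - q ^ Suc n)"
  by (simp add: qfact_def)

lemma qfact_0 [simp]: "qfact 0 q = 1"
  by (simp add: qfact_def)

lemma power_Suc_neq_1:
  fixes q :: "'a::real_normed_field"
  assumes "norm q < 1"
  shows "q ^ Suc j \<noteq> 1"
proof
  assume "q ^ Suc j = 1"
  then have "norm q ^ Suc j = 1"
    by (metis norm_one norm_power)
  then show False
    using assms power_less_one_iff[of "norm q" "Suc j"] by simp
qed

lemma qfact_nonzero:
  assumes "norm q < 1"
  shows "qfact n q \<noteq> 0"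
  unfolding qfact_def prod_zero_iff[OF finite_lessThan]
  using power_Suc_neq_1[OF assms] by (metis eq_iff_diff_eq_0)

lemma qfact_LIMSEQ:
  assumes "norm q < 1"
  shows "(\<lambda>n. qfact n q) \<longlonglongrightarrow> qpoch q q"
  using qpoch_LIMSEQ[OF assms, of q] by (simp add: qfact_def)

lemma qpoch_self_nonzero:
  fixes q :: "'a::{real_normed_field,banach}"
  assumes "norm q < 1"
  shows "qpoch q q \<noteq> 0"
  using power_Suc_neq_1[OF assms] by (intro qpoch_nonzero assms) simp

text \<open>The value 0 beyond n lets the Pascal rule include the case \<open>k = n\<close>.\<close>

definition qbin :: "nat \<Rightarrow> nat \<Rightarrow> 'a::{real_normed_field,banach} \<Rightarrow> 'a" where
  "qbin n k q = (if k \<le> n then qfact n q / (qfact k q * qfact (n - k) q) else 0)"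

lemma qbin_Suc_Suc:
  assumes "norm q < 1" "k \<le> n"
  shows "qbin (Suc n) (Suc k) q = qbin n (Suc k) q + q ^ (n - k) * qbin n k q"
proof (cases "k = n")
  case True
  then show ?thesis
    using qfact_nonzero[OF assms(1)] by (simp add: qbin_def)
next
  case False
  with assms(2) obtain d where d: "n = Suc (k + d)"
    by (metis le_neq_implies_less less_iff_Suc_add)
  have nz: "1 - q ^ Suc k \<noteq> 0" "1 - q ^ Suc d \<noteq> 0"
    using power_Suc_neq_1[OF assms(1)] by (metis eq_iff_diff_eq_0)+
  have nz': "qfact k q \<noteq> 0" "qfact d q \<noteq> 0"
    using qfact_nonzero[OF assms(1)] by auto
  \<comment> \<open>As \<open>X * Y = q ^ Suc n\<close>, the rule comes down to
    \<open>1 - X Y = (1 - Y) + Y (1 - X)\<close>.\<close>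
  define F A B X Y where defs: "F = qfact n q" "A = qfact k q" "B = qfact d q" "X = q ^ Suc k" "Y = q ^ Suc d"
  have "F * (1 - X * Y) / (A * (1 - X) * (B * (1 - Y))) = F / (A * (1 - X) * B) + Y * (F / (A * (B * (1 - Y))))"
    using nz nz' by (simp add: defs(2-) divide_simps) (simp add: algebra_simps)
  moreover have "qbin (Suc n) (Suc k) q = F * (1 - X * Y) / (A * (1 - X) * (B * (1 - Y)))"
    by (simp add: qbin_def defs d qfact_Suc power_add mult_ac)
  moreover have "qbin n (Suc k) q = F / (A * (1 - X) * B)"
    by (simp add: qbin_def defs d qfact_Suc)
  moreover have "qbin n k q = F / (A * (B * (1 - Y)))"
    by (simp add: qbin_def defs d qfact_Suc Suc_diff_le)
  moreover have "q ^ (n - k) = Y"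
    by (simp add: d defs Suc_diff_le)
  ultimately show ?thesis by simp
qed

lemma qbinomial_theorem:
  fixes q :: "'a::{real_normed_field,banach}"
  assumes "norm q < 1"
  shows "(\<Prod>i<n. 1 + x * q ^ i) = (\<Sum>k\<le>n. qbin n k q * q ^ (k choose 2) * x ^ k)"
proof (induction n)
  case 0
  show ?case by (simp add: qbin_def numeral_2_eq_2)
next
  case (Suc n)
  have "(\<Sum>k\<le>Suc n. qbin (Suc n) k q * q ^ (k choose 2) * x ^ k)
      = 1 + (\<Sum>k\<le>n. qbin (Suc n) (Suc k) q * q ^ (Suc k choose 2) * x ^ Suc k)"
    using qfact_nonzero[OF assms] by (subst sum.atMost_Suc_shift) (simp add: qbin_def numeral_2_eq_2)
  also have "(\<Sum>k\<le>n. qbin (Suc n) (Suc k) q * q ^ (Suc k choose 2) * x ^ Suc k)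
      = (\<Sum>k\<le>n. qbin n (Suc k) q * q ^ (Suc k choose 2) * x ^ Suc k
                 + x * q ^ n * (qbin n k q * q ^ (k choose 2) * x ^ k))"
  proof (rule sum.cong)
    fix k assume "k \<in> {..n}"
    then have k: "k \<le> n" by simp
    \<comment> \<open>The increment k of the quadratic exponent completes the factor
      \<open>q ^ (n - k)\<close> of the Pascal rule to \<open>q ^ n\<close>.\<close>
    have "Suc k choose 2 = k + (k choose 2)"
      by (simp add: numeral_2_eq_2)
    moreover have "q ^ (n - k) * q ^ k = q ^ n"
      using k by (simp flip: power_add)
    ultimately show "qbin (Suc n) (Suc k) q * q ^ (Suc k choose 2) * x ^ Suc k = qbin n (Suc k) q * q ^ (Suc k choose 2) * x ^ Suc k
                 + x * q ^ n * (qbin n k q * q ^ (k choose 2) * x ^ k)"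
      unfolding qbin_Suc_Suc[OF assms k] by (simp add: algebra_simps power_add)
  qed simp
  also have "\<dots> = (\<Sum>k\<le>n. qbin n (Suc k) q * q ^ (Suc k choose 2) * x ^ Suc k)
       + x * q ^ n * (\<Sum>k\<le>n. qbin n k q * q ^ (k choose 2) * x ^ k)"
    by (simp add: sum.distrib sum_distrib_left)
  also have "1 + ((\<Sum>k\<le>n. qbin n (Suc k) q * q ^ (Suc k choose 2) * x ^ Suc k)
       + x * q ^ n * (\<Sum>k\<le>n. qbin n k q * q ^ (k choose 2) * x ^ k))
      = (\<Sum>k\<le>Suc n. qbin n k q * q ^ (k choose 2) * x ^ k)
       + x * q ^ n * (\<Sum>k\<le>n. qbin n k q * q ^ (k choose 2) * x ^ k)"
    using qfact_nonzero[OF assms] by (subst sum.atMost_Suc_shift) (simp add: qbin_def numeral_2_eq_2)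
  also have "(\<Sum>k\<le>Suc n. qbin n k q * q ^ (k choose 2) * x ^ k) = (\<Sum>k\<le>n. qbin n k q * q ^ (k choose 2) * x ^ k)"
    by (simp add: qbin_def)
  finally show ?case
    by (simp add: Suc.IH algebra_simps)
qed

subsection \<open>The Jacobi triple product\<close>

definition triangular :: "int \<Rightarrow> int" where
  "triangular k = k * (k - 1) div 2"

lemma two_triangular: "2 * triangular k = k * (k - 1)"
  unfolding triangular_def by simp

lemma triangular_of_nat: "triangular (int n) = int (n choose 2)"
proof (cases n)
  case (Suc m)
  then show ?thesis
    by (simp add: triangular_def choose_two zdiv_int algebra_simps)
qed (simp add: triangular_def)

text \<open>The exponent \<open>k (k - 1) / 2\<close> avoids square roots of q; the series of
  \<open>q^(k^2)\<close> is the case of base \<open>q^2\<close> and \<open>w = q\<close>.\<close>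

definition jtp_term :: "'a::{real_normed_field,banach} \<Rightarrow> 'a \<Rightarrow> int \<Rightarrow> 'a" where
  "jtp_term q w k = q powi triangular k * w powi k"

lemma summable_choose_two_power:
  fixes a b :: real
  assumes "0 \<le> a" "a < 1" "b > 0"
  shows "summable (\<lambda>n. a ^ (n choose 2) * b ^ n)"
proof -
  have "(\<lambda>n. a ^ n * b) \<longlonglongrightarrow> 0"
    using assms by (intro tendsto_mult_left_zero LIMSEQ_realpow_zero) auto
  then have "eventually (\<lambda>n. a ^ n * b < 1 / 2) sequentially"
    by (rule order_tendstoD) simp
  then obtain N where N: "\<And>n. n \<ge> N \<Longrightarrow> a ^ n * b < 1 / 2"
    by (auto simp: eventually_sequentially)
  show ?thesis
  proof (rule summable_ratio_test[of "1/2" N])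
    fix n assume "n \<ge> N"
    then have "(a ^ n * b) * (a ^ (n choose 2) * b ^ n) \<le> 1 / 2 * (a ^ (n choose 2) * b ^ n)"
      using N[of n] assms by (intro mult_right_mono) auto
    moreover have "Suc n choose 2 = n + (n choose 2)"
      by (simp add: numeral_2_eq_2)
    ultimately show "norm (a ^ (Suc n choose 2) * b ^ Suc n) \<le> 1 / 2 * norm (a ^ (n choose 2) * b ^ n)"
      using assms by (simp add: power_add algebra_simps abs_mult)
  qed simp
qed

lemma jtp_term_summable:
  assumes "q \<noteq> 0" "norm q < 1" "w \<noteq> 0"
  shows "(\<lambda>k. norm (jtp_term q w k)) summable_on UNIV"
proof -
  have 1: "(\<lambda>n. norm (jtp_term q w (int n))) summable_on UNIV" if "w \<noteq> 0" for w
    using summable_choose_two_power[of "norm q" "norm w"] assms that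
    by (intro summable_nonneg_imp_summable_on)
       (auto simp: jtp_term_def triangular_of_nat norm_mult norm_power power_int_of_nat)
  have A: "(\<lambda>k. norm (jtp_term q w k)) summable_on range int"
    using 1[OF assms(3)] by (subst summable_on_reindex) (auto simp: o_def)
  \<comment> \<open>The symmetry \<open>k \<mapsto> 1 - k\<close> of the triangular numbers carries
    the negative half to the positive half with w inverted. The two halves overlap in 0 and 1, which
    is harmless for summability.\<close>
  have "jtp_term q w (1 - int n) = w * jtp_term q (1 / w) (int n)" for n
  proof -
    have "triangular (1 - int n) = triangular (int n)"
      by (simp add: triangular_def algebra_simps)
    then show ?thesis
      using assms by (simp add: jtp_term_def power_int_diff power_divide)
  qed
  moreover have "(\<lambda>n. norm w * norm (jtp_term q (1 / w) (int n))) summable_on UNIV"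
    using assms by (intro summable_on_cmult_right 1) auto
  ultimately have B: "(\<lambda>k. norm (jtp_term q w k)) summable_on range (\<lambda>n. 1 - int n)"
    by (subst summable_on_reindex) (auto simp: o_def norm_mult inj_on_def)
  have "range int \<union> range (\<lambda>n. 1 - int n) = UNIV"
  proof -
    have "x \<in> range int \<union> range (\<lambda>n. 1 - int n)" for x
    proof (cases "x \<ge> 0")
      case True
      then have "x = int (nat x)" by simp
      then show ?thesis by blast
    next
      case False
      then have "x = 1 - int (nat (1 - x))" by simp
      then show ?thesis by blast
    qed
    then show ?thesis by blast
  qed
  then show ?thesis
    using summable_on_union[OF A B] by simp
qed

text \<open>This is the q-binomial theorem with \<open>2 N\<close> factors at
  \<open>x = w / q^N\<close>, recentred at its middle term.\<close>

lemma finite_jacobi_triple_product: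
  fixes q :: "'a::{real_normed_field,banach}"
  assumes "q \<noteq> 0" "norm q < 1" "w \<noteq> 0"
  shows "(\<Prod>i<N. 1 + w * q ^ i) * (\<Prod>i<N. 1 + q / w * q ^ i)
    = (\<Sum>j\<in>{-int N..int N}. qbin (2 * N) (nat (int N + j)) q * jtp_term q w j)"
proof -
  \<comment> \<open>The first N factors carry negative powers of q; K is what
    \<open>1 + w / q^(i+1) = w / q^(i+1) * (1 + q^(i+1) / w)\<close> extracts from them.\<close>
  define K where "K = (\<Prod>i<N. w / q ^ Suc i)"
  have K: "K = w ^ N * q powi (- triangular (int N + 1))"
    unfolding K_def
  proof (induction N)
    case (Suc N)
    have "triangular (int (Suc N) + 1) = triangular (int N + 1) + int (Suc N)"
      using two_triangular[of "int (Suc N) + 1"] two_triangular[of "int N + 1"] by (simp add: algebra_simps)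
    then have *: "q powi (- triangular (int (Suc N) + 1)) = q powi (- triangular (int N + 1)) / q ^ Suc N"
      unfolding power_int_minus using assms by (simp add: power_int_add divide_inverse)
    show ?case
      unfolding prod.lessThan_Suc Suc.IH * by simp
  qed (simp add: triangular_def)
  have "K \<noteq> 0"
    using assms by (auto simp: K_def)
  have "(\<Prod>i<2 * N. 1 + w / q ^ N * q ^ i) = (\<Prod>i\<in>{..<N} \<union> {N..<2 * N}. 1 + w / q ^ N * q ^ i)"
    by (rule prod.cong) auto
  also have "\<dots> = (\<Prod>i<N. 1 + w / q ^ N * q ^ i) * (\<Prod>i=N..<2 * N. 1 + w / q ^ N * q ^ i)"
    by (rule prod.union_disjoint) auto
  also have "(\<Prod>i=N..<2 * N. 1 + w / q ^ N * q ^ i) = (\<Prod>i<N. 1 + w * q ^ i)"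
    using assms by (intro prod.reindex_bij_witness[of _ "\<lambda>i. i + N" "\<lambda>i. i - N"]) (auto simp: power_diff)
  also have "(\<Prod>i<N. 1 + w / q ^ N * q ^ i) = (\<Prod>i<N. 1 + w / q ^ N * q ^ (N - Suc i))"
    by (rule prod.nat_diff_reindex[symmetric])
  also have "\<dots> = (\<Prod>i<N. w / q ^ Suc i * (1 + q / w * q ^ i))"
    using assms by (intro prod.cong) (auto simp: power_diff field_simps)
  also have "\<dots> = K * (\<Prod>i<N. 1 + q / w * q ^ i)"
    by (simp only: prod.distrib K_def)
  finally have 1: "(\<Prod>i<2 * N. 1 + w / q ^ N * q ^ i) = K * ((\<Prod>i<N. 1 + w * q ^ i) * (\<Prod>i<N. 1 + q / w * q ^ i))"
    by simp
  have "(\<Prod>i<2 * N. 1 + w / q ^ N * q ^ i) = (\<Sum>k\<le>2 * N. qbin (2 * N) k q * q ^ (k choose 2) * (w / q ^ N) ^ k)"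
    by (rule qbinomial_theorem[OF assms(2)])
  also have "\<dots> = (\<Sum>j\<in>{-int N..int N}. K * (qbin (2 * N) (nat (int N + j)) q * jtp_term q w j))"
  proof (rule sum.reindex_bij_witness[of _ "\<lambda>j. nat (int N + j)" "\<lambda>k. int k - int N"])
    fix k assume "k \<in> {..2 * N}"
    \<comment> \<open>Completing the square: the recentring changes the quadratic exponent by the
      part linear in k, which comes from \<open>w / q^N\<close>, and by the constant in K.\<close>
    have "triangular (int k - int N) = triangular (int k) - int N * int k + triangular (int N + 1)"
      using two_triangular[of "int k - int N"] two_triangular[of "int k"] two_triangular[of "int N + 1"]
      by (simp add: algebra_simps)
    then have "q powi triangular (int k - int N) * q powi (- triangular (int N + 1)) = q powi (triangular (int k) - int N * int k)"
      using assms by (simp flip: power_int_add)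
    also have "\<dots> = q ^ (k choose 2) / q ^ (N * k)"
      unfolding triangular_of_nat of_nat_mult[symmetric] using assms by (subst power_int_diff) (simp_all del: of_nat_mult)
    finally have "K * jtp_term q w (int k - int N) = (q ^ (k choose 2) / q ^ (N * k)) * (w powi (int k - int N) * w ^ N)"
      unfolding K jtp_term_def by (simp add: mult_ac)
    also have "w powi (int k - int N) * w ^ N = w ^ k"
      using assms by (simp add: power_int_diff)
    finally have "K * jtp_term q w (int k - int N) = q ^ (k choose 2) * (w / q ^ N) ^ k"
      by (simp add: power_divide power_mult)
    then show "K * (qbin (2 * N) (nat (int N + (int k - int N))) q * jtp_term q w (int k - int N))
        = qbin (2 * N) k q * q ^ (k choose 2) * (w / q ^ N) ^ k"
      by (simp add: mult_ac)
  qed auto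
  also have "\<dots> = K * (\<Sum>j\<in>{-int N..int N}. qbin (2 * N) (nat (int N + j)) q * jtp_term q w j)"
    by (simp add: sum_distrib_left)
  finally show ?thesis
    using 1 \<open>K \<noteq> 0\<close> by simp
qed

theorem jacobi_triple_product:
  fixes q :: "'a::{real_normed_field,banach}"
  assumes "q \<noteq> 0" "norm q < 1" "w \<noteq> 0"
  shows "(jtp_term q w has_sum qpoch q q * (qpoch (- w) q * qpoch (- q / w) q)) UNIV"
proof -
  define f where "f N j = (if \<bar>j\<bar> \<le> int N then qbin (2 * N) (nat (int N + j)) q * jtp_term q w j else 0)" for N j
  obtain C where C: "\<And>n. norm (qfact n q) \<le> C"
    using convergent_imp_Bseq[OF convergentI[OF qfact_LIMSEQ[OF assms(2)]]] by (auto simp: Bseq_def)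
  have "(\<lambda>n. inverse (qfact n q)) \<longlonglongrightarrow> inverse (qpoch q q)"
    using assms by (intro tendsto_inverse qfact_LIMSEQ qpoch_self_nonzero)
  then obtain D where D: "\<And>n. norm (inverse (qfact n q)) \<le> D"
    by (meson BseqE convergent_imp_Bseq convergentI)
  have "C \<ge> 0" "D \<ge> 0"
    using C[of 0] D[of 0] order.trans[OF norm_ge_zero] by blast+
  \<comment> \<open>As \<open>qfact\<close> has a nonzero limit, it and its inverse are bounded; so
    all q-binomials obey one bound and the theta series itself serves as majorant.\<close>
  have qbin_bound: "norm (qbin n k q) \<le> C * (D * D)" for n k
  proof (cases "k \<le> n")
    case True
    have "norm (qbin n k q) = norm (qfact n q) * (norm (inverse (qfact k q)) * norm (inverse (qfact (n - k) q)))"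
      using True by (simp add: qbin_def norm_divide norm_mult norm_inverse divide_inverse)
    also have "\<dots> \<le> C * (D * D)"
      using C D \<open>C \<ge> 0\<close> \<open>D \<ge> 0\<close> by (intro mult_mono) auto
    finally show ?thesis .
  next
    case False
    then show ?thesis
      using \<open>C \<ge> 0\<close> \<open>D \<ge> 0\<close> by (simp add: qbin_def)
  qed
  have sub: "filterlim (\<lambda>N. nat (int N + j)) sequentially sequentially" for j
    unfolding filterlim_at_top eventually_sequentially
  proof (intro allI exI impI)
    fix Z N assume "nat (int Z - j) \<le> N"
    then show "Z \<le> nat (int N + j)" by linarith
  qed
  have lim: "(\<lambda>N. f N j) \<longlonglongrightarrow> qpoch q q / (qpoch q q * qpoch q q) * jtp_term q w j" for j
  proof -
    have "filterlim (\<lambda>N::nat. 2 * N) sequentially sequentially"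
      by (intro filterlim_subseq strict_monoI) auto
    then have "(\<lambda>N. qfact (2 * N) q) \<longlonglongrightarrow> qpoch q q"
      by (rule filterlim_compose[OF qfact_LIMSEQ[OF assms(2)]])
    moreover have "(\<lambda>N. qfact (nat (int N + i)) q) \<longlonglongrightarrow> qpoch q q" for i
      by (rule filterlim_compose[OF qfact_LIMSEQ[OF assms(2)] sub])
    ultimately have "(\<lambda>N. qfact (2 * N) q / (qfact (nat (int N + j)) q * qfact (nat (int N + (- j))) q) * jtp_term q w j)
        \<longlonglongrightarrow> qpoch q q / (qpoch q q * qpoch q q) * jtp_term q w j"
      using qpoch_self_nonzero[OF assms(2)] by (intro tendsto_mult_right tendsto_divide tendsto_mult) (blast | simp)+
    moreover have "eventually (\<lambda>N. qfact (2 * N) q / (qfact (nat (int N + j)) q * qfact (nat (int N + (- j))) q) * jtp_term q w j = f N j) sequentially"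
    proof -
      have "qfact (2 * N) q / (qfact (nat (int N + j)) q * qfact (nat (int N + (- j))) q) * jtp_term q w j = f N j"
        if "N \<ge> nat \<bar>j\<bar>" for N
      proof -
        have "2 * N - nat (int N + j) = nat (int N + (- j))" "nat (int N + j) \<le> 2 * N" "\<bar>j\<bar> \<le> int N"
          using that by linarith+
        then show ?thesis
          by (simp add: f_def qbin_def)
      qed
      then show ?thesis
        unfolding eventually_sequentially by blast
    qed
    ultimately show ?thesis
      by (rule Lim_transform_eventually)
  qed
  have "(\<lambda>N. infsum (f N) UNIV) \<longlonglongrightarrow> infsum (\<lambda>j. qpoch q q / (qpoch q q * qpoch q q) * jtp_term q w j) UNIV"
  proof (rule tannery_int[OF lim])
    show "eventually (\<lambda>n. \<forall>k. norm (f n k) \<le> C * (D * D) * norm (jtp_term q w k)) sequentially"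
      using qbin_bound \<open>C \<ge> 0\<close> \<open>D \<ge> 0\<close>
      by (intro always_eventually allI) (auto simp: f_def norm_mult intro!: mult_right_mono mult_nonneg_nonneg)
    show "(\<lambda>k. C * (D * D) * norm (jtp_term q w k)) summable_on UNIV"
      by (intro summable_on_cmult_right jtp_term_summable assms)
  qed
  moreover have "infsum (f N) UNIV = (\<Prod>i<N. 1 - (- w) * q ^ i) * (\<Prod>i<N. 1 - (- q / w) * q ^ i)" for N
  proof -
    have "infsum (f N) UNIV = infsum (f N) {-int N..int N}"
      by (rule infsum_cong_neutral) (auto simp: f_def)
    also have "\<dots> = (\<Sum>j\<in>{-int N..int N}. qbin (2 * N) (nat (int N + j)) q * jtp_term q w j)"
      unfolding infsum_finite[OF finite_atLeastAtMost_int] by (rule sum.cong) (auto simp: f_def)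
    finally show ?thesis
      using finite_jacobi_triple_product[OF assms, of N] by simp
  qed
  moreover have "(\<lambda>N. (\<Prod>i<N. 1 - (- w) * q ^ i) * (\<Prod>i<N. 1 - (- q / w) * q ^ i)) \<longlonglongrightarrow> qpoch (- w) q * qpoch (- q / w) q"
    by (intro tendsto_mult qpoch_LIMSEQ assms)
  ultimately have "infsum (\<lambda>j. qpoch q q / (qpoch q q * qpoch q q) * jtp_term q w j) UNIV = qpoch (- w) q * qpoch (- q / w) q"
    by (simp add: LIMSEQ_unique)
  moreover have "infsum (\<lambda>j. qpoch q q / (qpoch q q * qpoch q q) * jtp_term q w j) UNIV
     = qpoch q q / (qpoch q q * qpoch q q) * infsum (jtp_term q w) UNIV"
    by (rule infsum_cmult_right')
  ultimately have "infsum (jtp_term q w) UNIV = qpoch q q * (qpoch (- w) q * qpoch (- q / w) q)"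
    using qpoch_self_nonzero[OF assms(2)] by (simp add: field_simps)
  moreover have "jtp_term q w summable_on UNIV"
    using jtp_term_summable[OF assms] by (rule abs_summable_summable)
  ultimately show ?thesis
    by (simp add: has_sum_iff)
qed

subsection \<open>Weierstrass' three-term relation\<close>

lemma has_sum_mult_abs:
  fixes f :: "'i \<Rightarrow> 'a::{real_normed_field,banach}" and g :: "'j \<Rightarrow> 'a"
  assumes "(\<lambda>i. norm (f i)) summable_on UNIV" "(\<lambda>j. norm (g j)) summable_on UNIV"
  shows "((\<lambda>(i, j). f i * g j) has_sum infsum f UNIV * infsum g UNIV) UNIV"
proof -
  have "(\<lambda>(i, j). norm (f i) * norm (g j)) summable_on UNIV \<times> UNIV"
  proof (rule summable_on_SigmaI)
    show "((\<lambda>j. case (i, j) of (i, j) \<Rightarrow> norm (f i) * norm (g j)) has_sum norm (f i) * infsum (\<lambda>j. norm (g j)) UNIV) UNIV" for i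
      using assms by (auto intro!: has_sum_cmult_right has_sum_infsum)
    show "(\<lambda>i. norm (f i) * infsum (\<lambda>j. norm (g j)) UNIV) summable_on UNIV"
      by (intro summable_on_cmult_left assms)
  qed auto
  then have "(\<lambda>p. norm (case p of (i, j) \<Rightarrow> f i * g j)) summable_on UNIV \<times> UNIV"
    by (simp add: case_prod_unfold norm_mult)
  then have s: "(\<lambda>(i, j). f i * g j) summable_on UNIV \<times> UNIV"
    by (rule abs_summable_summable)
  have "((\<lambda>(i, j). f i * g j) has_sum infsum f UNIV * infsum g UNIV) (UNIV \<times> UNIV)"
  proof (rule has_sum_SigmaI[OF _ _ s])
    show "((\<lambda>j. case (i, j) of (i, j) \<Rightarrow> f i * g j) has_sum f i * infsum g UNIV) UNIV" for i
      using abs_summable_summable[OF assms(2)] by (auto intro!: has_sum_cmult_right has_sum_infsum)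
    show "((\<lambda>i. f i * infsum g UNIV) has_sum infsum f UNIV * infsum g UNIV) UNIV"
      by (intro has_sum_cmult_left has_sum_infsum abs_summable_summable[OF assms(1)])
  qed
  then show ?thesis by simp
qed

text \<open>Jacobi's theta function in multiplicative notation, without the factor
  \<open>qpoch q q\<close> of the triple product. Its zeros are the integer powers of q.\<close>

definition theta :: "'a::{real_normed_field,banach} \<Rightarrow> 'a \<Rightarrow> 'a" where
  "theta z q = qpoch z q * qpoch (q / z) q"

lemma infsum_jtp_term:
  fixes q :: "'a::{real_normed_field,banach}"
  assumes "q \<noteq> 0" "norm q < 1" "z \<noteq> 0"
  shows "infsum (jtp_term q (- z)) UNIV = qpoch q q * theta z q"
  using jacobi_triple_product[of q "- z"] assms by (simp add: theta_def has_sum_iff)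

lemma theta_inverse:
  fixes q :: "'a::{real_normed_field,banach}"
  assumes "norm q < 1" "z \<noteq> 0"
  shows "theta (1 / z) q = - theta z q / z"
proof -
  have h: "qpoch z q = (1 - z) * qpoch (q * z) q" "qpoch (1 / z) q = (1 - 1 / z) * qpoch (q / z) q"
    using qpoch_rec[OF assms(1), of z] qpoch_rec[OF assms(1), of "1 / z"] by (simp_all add: mult.commute)
  have "theta (1 / z) q = qpoch (1 / z) q * qpoch (q * z) q"
    by (simp add: theta_def)
  then show ?thesis
    unfolding theta_def[of z] h using assms(2) by (simp add: field_simps)
qed

lemma theta_reflect:
  fixes q :: "'a::{real_normed_field,banach}"
  assumes "q \<noteq> 0" "z \<noteq> 0"
  shows "theta (q / z) q = theta z q"
  using assms by (simp add: theta_def mult.commute)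

lemma jtp_term_Suc:
  fixes q :: "'a::{real_normed_field,banach}"
  assumes "q \<noteq> 0" "w \<noteq> 0"
  shows "jtp_term q w (k + 1) = w * jtp_term q (q * w) k"
proof -
  have "triangular (k + 1) = triangular k + k"
    using two_triangular[of "k + 1"] two_triangular[of k] by (simp add: algebra_simps)
  then show ?thesis
    using assms by (simp add: jtp_term_def power_int_add power_int_mult_distrib)
qed

lemma infsum_jtp_term_shift:
  fixes q :: "'a::{real_normed_field,banach}"
  assumes "q \<noteq> 0" "w \<noteq> 0"
  shows "infsum (jtp_term q w) UNIV = w * infsum (jtp_term q (q * w)) UNIV"
proof -
  have "infsum (jtp_term q w) UNIV = infsum (\<lambda>k. w * jtp_term q (q * w) k) UNIV"
  proof (rule infsum_reindex_bij_witness[of _ "\<lambda>k. k + 1" "\<lambda>k. k - 1"])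
    show "w * jtp_term q (q * w) (k - 1) = jtp_term q w k" for k
      using jtp_term_Suc[OF assms, of "k - 1"] by simp
  qed auto
  then show ?thesis
    by (simp add: infsum_cmult_right')
qed

text \<open>By the parallelogram law the two quadratic exponents add up to
  \<open>a^2 - a + b^2\<close>, which has no mixed term; so the product separates.\<close>

lemma jtp_term_mult_even:
  fixes q :: "'a::{real_normed_field,banach}"
  assumes "q \<noteq> 0" "u \<noteq> 0" "v \<noteq> 0"
  shows "jtp_term q u (a + b) * jtp_term q v (a - b) = jtp_term (q\<^sup>2) (u * v) a * jtp_term (q\<^sup>2) (q * (u / v)) b"
proof -
  have "triangular (a + b) + triangular (a - b) = 2 * triangular a + (2 * triangular b + b)"
    using two_triangular[of "a + b"] two_triangular[of "a - b"] two_triangular[of a] two_triangular[of b] by (simp add: algebra_simps)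
  then have "q powi triangular (a + b) * q powi triangular (a - b) = q powi (2 * triangular a) * (q powi (2 * triangular b) * q powi b)"
    using assms by (simp flip: power_int_add)
  also have "\<dots> = (q\<^sup>2) powi triangular a * ((q\<^sup>2) powi triangular b * q powi b)"
    by (simp add: power_int_mult)
  finally have "q powi triangular (a + b) * q powi triangular (a - b) = (q\<^sup>2) powi triangular a * ((q\<^sup>2) powi triangular b * q powi b)" .
  moreover have "u powi (a + b) * v powi (a - b) = (u * v) powi a * (u / v) powi b"
    using assms by (simp add: power_int_add power_int_diff power_int_mult_distrib power_int_divide_distrib)
  ultimately have "(q powi triangular (a + b) * q powi triangular (a - b)) * (u powi (a + b) * v powi (a - b))
      = ((q\<^sup>2) powi triangular a * ((q\<^sup>2) powi triangular b * q powi b)) * ((u * v) powi a * (u / v) powi b)"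
    by simp
  then show ?thesis
    unfolding jtp_term_def power_int_mult_distrib[of q] by (simp only: mult_ac)
qed

lemma jtp_term_mult_odd:
  fixes q :: "'a::{real_normed_field,banach}"
  assumes "q \<noteq> 0" "u \<noteq> 0" "v \<noteq> 0"
  shows "jtp_term q u (a + b + 1) * jtp_term q v (a - b) = u * (jtp_term (q\<^sup>2) (q * (u * v)) a * jtp_term (q\<^sup>2) (q\<^sup>2 * (u / v)) b)"
proof -
  have "jtp_term q u (a + b + 1) = u * jtp_term q (q * u) (a + b)"
    using assms(1,2) by (rule jtp_term_Suc)
  moreover have "jtp_term q (q * u) (a + b) * jtp_term q v (a - b) = jtp_term (q\<^sup>2) (q * u * v) a * jtp_term (q\<^sup>2) (q * (q * u / v)) b"
    using assms by (intro jtp_term_mult_even) auto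
  ultimately show ?thesis
    by (simp add: power2_eq_square mult_ac)
qed

lemma has_sum_int_pair_parity:
  fixes F :: "int \<times> int \<Rightarrow> 'a::topological_comm_monoid_add"
  assumes "((\<lambda>(a, b). F (a + b, a - b)) has_sum s) UNIV"
    and "((\<lambda>(a, b). F (a + b + 1, a - b)) has_sum t) UNIV"
  shows "(F has_sum s + t) UNIV"
proof -
  let ?g = "\<lambda>(n, m). ((n + m) div 2, (n - m) div 2)"
  have even: "(n + m) div 2 + (n - m) div 2 = n \<and> (n + m) div 2 - (n - m) div 2 = m" if "even (n + m)" for n m :: int
    using that by presburger
  have odd: "(n + m) div 2 + (n - m) div 2 + 1 = n \<and> (n + m) div 2 - (n - m) div 2 = m" if "odd (n + m)" for n m :: int
    using that by presburger
  have "(F has_sum s) {(n, m). even (n + m)}"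
    using assms(1)
    by (subst has_sum_reindex_bij_witness[of _ "\<lambda>(a, b). (a + b, a - b)" ?g UNIV "\<lambda>(a, b). F (a + b, a - b)"])
       (auto simp: even simp del: even_add)
  moreover have "(F has_sum t) {(n, m). odd (n + m)}"
    using assms(2)
    by (subst has_sum_reindex_bij_witness[of _ "\<lambda>(a, b). (a + b + 1, a - b)" ?g UNIV "\<lambda>(a, b). F (a + b + 1, a - b)"])
       (auto simp: odd simp del: even_add, auto)
  ultimately have "(F has_sum s + t) ({(n, m). even (n + m)} \<union> {(n, m). odd (n + m)})"
    by (rule has_sum_Un_disjoint) auto
  also have "{(n, m). even (n + m)} \<union> {(n, m). odd (n + m)} = (UNIV :: (int \<times> int) set)"
    by auto
  finally show ?thesis .
qed

text \<open>Ordering the double series by the parity of the sum of the two indices separates the variables. As the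
  result is a $2 \times 2$ determinant, the three-term relation below is just a Pluecker relation.\<close>

lemma theta_mult_theta:
  fixes q :: "'a::{real_normed_field,banach}"
  assumes "q \<noteq> 0" "norm q < 1" "x \<noteq> 0" "y \<noteq> 0"
  defines "b \<equiv> \<lambda>x. infsum (jtp_term (q\<^sup>2) (q * x\<^sup>2)) UNIV"
    and "c \<equiv> \<lambda>x. x * infsum (jtp_term (q\<^sup>2) (q\<^sup>2 * x\<^sup>2)) UNIV"
  shows "(qpoch q q)\<^sup>2 * (theta (x * y) q * theta (x / y) q) = x * (c x * b y - b x * c y)"
proof -
  have q2: "q\<^sup>2 \<noteq> 0" "norm (q\<^sup>2) < 1"
    using assms by (auto simp: norm_power power_less_one_iff)
  define F where "F = (\<lambda>(n, m). jtp_term q (- (x * y)) n * jtp_term q (- (x / y)) m)"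
  have tot: "(F has_sum (qpoch q q)\<^sup>2 * (theta (x * y) q * theta (x / y) q)) UNIV"
  proof -
    have "(F has_sum infsum (jtp_term q (- (x * y))) UNIV * infsum (jtp_term q (- (x / y))) UNIV) UNIV"
      unfolding F_def using assms by (intro has_sum_mult_abs jtp_term_summable) auto
    then show ?thesis
      using assms by (simp add: infsum_jtp_term power2_eq_square mult_ac)
  qed
  have uv: "(- (x * y)) * (- (x / y)) = x\<^sup>2" "(- (x * y)) / (- (x / y)) = y\<^sup>2"
    using assms by (auto simp: power2_eq_square)
  have "F (a + b, a - b) = jtp_term (q\<^sup>2) (x\<^sup>2) a * jtp_term (q\<^sup>2) (q * y\<^sup>2) b" for a b
    unfolding F_def prod.case using assms by (subst jtp_term_mult_even) (auto simp only: uv, auto)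
  then have "((\<lambda>(a, b). F (a + b, a - b)) has_sum infsum (jtp_term (q\<^sup>2) (x\<^sup>2)) UNIV * b y) UNIV"
    unfolding b_def using assms q2 has_sum_mult_abs[OF jtp_term_summable jtp_term_summable, of "q\<^sup>2" "x\<^sup>2" "q\<^sup>2" "q * y\<^sup>2"]
    by (simp add: case_prod_unfold)
  \<comment> \<open>Quasi-periodicity replaces the series at \<open>x^2\<close> by the one at
    \<open>q^2 x^2\<close>, so that both parities involve the same two functions b and c.\<close>
  also have "infsum (jtp_term (q\<^sup>2) (x\<^sup>2)) UNIV = x * c x"
    unfolding c_def using assms q2 by (subst infsum_jtp_term_shift) (auto simp: power2_eq_square)
  finally have 1: "((\<lambda>(a, b). F (a + b, a - b)) has_sum x * c x * b y) UNIV" .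
  have "F (a + b + 1, a - b) = - (x * y) * (jtp_term (q\<^sup>2) (q * x\<^sup>2) a * jtp_term (q\<^sup>2) (q\<^sup>2 * y\<^sup>2) b)" for a b
    unfolding F_def prod.case using assms by (subst jtp_term_mult_odd) (auto simp only: uv, auto)
  then have "((\<lambda>(a, b). F (a + b + 1, a - b)) has_sum - (x * y) * (b x * infsum (jtp_term (q\<^sup>2) (q\<^sup>2 * y\<^sup>2)) UNIV)) UNIV"
    unfolding b_def
    using assms q2 has_sum_cmult_right[OF has_sum_mult_abs[OF jtp_term_summable jtp_term_summable, of "q\<^sup>2" "q * x\<^sup>2" "q\<^sup>2" "q\<^sup>2 * y\<^sup>2"], of "- (x * y)"]
    by (simp add: case_prod_unfold)
  from has_sum_int_pair_parity[OF 1 this] have "(qpoch q q)\<^sup>2 * (theta (x * y) q * theta (x / y) q)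
      = x * c x * b y + - (x * y) * (b x * infsum (jtp_term (q\<^sup>2) (q\<^sup>2 * y\<^sup>2)) UNIV)"
    using tot by (rule has_sum_unique[rotated])
  then show ?thesis
    by (simp add: c_def algebra_simps)
qed

lemma theta_three_term:
  fixes q :: "'a::{real_normed_field,banach}"
  assumes "q \<noteq> 0" "norm q < 1" "x \<noteq> 0" "y \<noteq> 0" "u \<noteq> 0" "v \<noteq> 0"
  defines "T \<equiv> \<lambda>x y. theta (x * y) q * theta (x / y) q"
  shows "y * T x y * T u v = u * (T x u * T y v - T x v * T y u)"
proof -
  define E where "E = qpoch q q"
  define b where "b = (\<lambda>x. infsum (jtp_term (q\<^sup>2) (q * x\<^sup>2)) UNIV)"
  define c where "c = (\<lambda>x. x * infsum (jtp_term (q\<^sup>2) (q\<^sup>2 * x\<^sup>2)) UNIV)"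
  have E: "E \<noteq> 0"
    unfolding E_def by (rule qpoch_self_nonzero[OF assms(2)])
  have T: "E\<^sup>2 * T r s = r * (c r * b s - b r * c s)" if "r \<noteq> 0" "s \<noteq> 0" for r s
    unfolding T_def E_def b_def c_def using assms that by (intro theta_mult_theta)
  have "E\<^sup>2 * E\<^sup>2 * (y * T x y * T u v) = y * (E\<^sup>2 * T x y) * (E\<^sup>2 * T u v)"
    by simp
  also have "\<dots> = y * (x * (c x * b y - b x * c y)) * (u * (c u * b v - b u * c v))"
    by (simp only: T[OF assms(3,4)] T[OF assms(5,6)] T[OF assms(3,5)] T[OF assms(4,6)] T[OF assms(3,6)] T[OF assms(4,5)])
  also have "\<dots> = u * ((x * (c x * b u - b x * c u)) * (y * (c y * b v - b y * c v))
      - (x * (c x * b v - b x * c v)) * (y * (c y * b u - b y * c u)))"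
    by (simp add: algebra_simps)
  also have "\<dots> = u * ((E\<^sup>2 * T x u) * (E\<^sup>2 * T y v) - (E\<^sup>2 * T x v) * (E\<^sup>2 * T y u))"
    by (simp only: T[OF assms(3,4)] T[OF assms(5,6)] T[OF assms(3,5)] T[OF assms(4,6)] T[OF assms(3,6)] T[OF assms(4,5)])
  also have "\<dots> = E\<^sup>2 * E\<^sup>2 * (u * (T x u * T y v - T x v * T y u))"
    by (simp add: algebra_simps)
  finally show ?thesis
    using E by simp
qed

subsection \<open>Theta identities of level 10\<close>

text \<open>The first family consists of the multiples of $2 - i$ in the Gaussian integers; the other four residue classes
  modulo $2 - i$ are permuted cyclically by multiplication by $i$.\<close>

lemma has_sum_int_pair_mod5:
  fixes F :: "int \<times> int \<Rightarrow> 'a::topological_comm_monoid_add"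
  assumes rot: "\<And>x y. F (- y, x) = F (x, y)"
    and s: "((\<lambda>(m, n). F (2 * m + n, 2 * n - m)) has_sum s) UNIV"
    and t: "((\<lambda>(m, n). F (1 - 2 * m - n, m - 2 * n)) has_sum t) UNIV"
  shows "(F has_sum s + t + t + t + t) UNIV"
proof -
  \<comment> \<open>Modulo \<open>2 - i\<close> the imaginary unit is congruent to 2, so
    \<open>x + 2 y\<close> modulo 5 is the residue class of the Gaussian integer
    \<open>x + i y\<close>.\<close>
  define S where "S i = {(x, y). (x + 2 * y) mod 5 = (i::int)}" for i
  have div5: "x + 2 * y = 5 * ((x + 2 * y) div 5) + (x + 2 * y) mod 5" for x y :: int
    by simp
  have inv0: "2 * ((2 * x - y) div 5) + (x + 2 * y) div 5 = x \<and> 2 * ((x + 2 * y) div 5) - (2 * x - y) div 5 = y"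
    if "(x + 2 * y) mod 5 = 0" for x y :: int
  proof -
    define k where "k = (x + 2 * y) div 5"
    have k: "x + 2 * y = 5 * k"
      using div5[of x y] that by (simp add: k_def)
    then have "2 * x - y = 5 * (2 * k - y)" by simp
    then have "(2 * x - y) div 5 = 2 * k - y" by simp
    then show ?thesis using k by (simp add: k_def[symmetric])
  qed
  have inv1: "1 - 2 * ((2 - 2 * x + y) div 5) - (1 - x - 2 * y) div 5 = x \<and> (2 - 2 * x + y) div 5 - 2 * ((1 - x - 2 * y) div 5) = y"
    if "(x + 2 * y) mod 5 = 1" for x y :: int
  proof -
    define k where "k = (x + 2 * y) div 5"
    have k: "x + 2 * y = 5 * k + 1"
      using div5[of x y] that by (simp add: k_def)
    then have "2 - 2 * x + y = 5 * (y - 2 * k)" "1 - x - 2 * y = 5 * (- k)" by simp_all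
    then have "(2 - 2 * x + y) div 5 = y - 2 * k" "(1 - x - 2 * y) div 5 = - k"
      by (metis nonzero_mult_div_cancel_left zero_neq_numeral)+
    then show ?thesis using k by simp
  qed
  have S0: "(F has_sum s) (S 0)"
    using s
  proof (subst has_sum_reindex_bij_witness[of "S 0" "\<lambda>(m, n). (2 * m + n, 2 * n - m)"
      "\<lambda>(x, y). ((2 * x - y) div 5, (x + 2 * y) div 5)" UNIV "\<lambda>(m, n). F (2 * m + n, 2 * n - m)" F])
    have "2 * m + n + 2 * (2 * n - m) = 5 * n" for m n :: int by simp
    then show "(case b of (m, n) \<Rightarrow> (2 * m + n, 2 * n - m)) \<in> S 0" for b
      unfolding S_def case_prod_unfold mem_Collect_eq fst_conv snd_conv by simp
  qed (auto simp: S_def inv0)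
  have S1: "(F has_sum t) (S 1)"
    using t
  proof (subst has_sum_reindex_bij_witness[of "S 1" "\<lambda>(m, n). (1 - 2 * m - n, m - 2 * n)"
      "\<lambda>(x, y). ((2 - 2 * x + y) div 5, (1 - x - 2 * y) div 5)" UNIV "\<lambda>(m, n). F (1 - 2 * m - n, m - 2 * n)" F])
    have "1 - 2 * m - n + 2 * (m - 2 * n) = 1 + 5 * (- n)" for m n :: int by simp
    then show "(case b of (m, n) \<Rightarrow> (1 - 2 * m - n, m - 2 * n)) \<in> S 1" for b
      unfolding S_def case_prod_unfold mem_Collect_eq fst_conv snd_conv by (simp only: mod_mult_self2) simp
  qed (auto simp: S_def inv1)
  \<comment> \<open>Multiplication by the imaginary unit doubles the class, which yields the chain
    1, 2, 4, 3; no step starting from 3 is taken.\<close>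
  have rotS: "(F has_sum a) (S (2 * i mod 5))" if "(F has_sum a) (S i)" "i \<in> {1, 2, 4}" for a i
    using that(1)
  proof (subst has_sum_reindex_bij_witness[of "S (2 * i mod 5)" "\<lambda>(x, y). (- y, x)" "\<lambda>(x, y). (y, - x)" "S i" F F])
    have "(- y + 2 * x) mod 5 = 2 * i mod 5" if "(x + 2 * y) mod 5 = i" for x y
    proof -
      have "- y + 2 * x = 2 * (x + 2 * y) + 5 * (- y)" by simp
      then show ?thesis by (metis that mod_mult_self2 mod_mult_right_eq)
    qed
    then show "(case b of (x, y) \<Rightarrow> (- y, x)) \<in> S (2 * i mod 5)" if "b \<in> S i" for b
      using that unfolding S_def case_prod_unfold mem_Collect_eq fst_conv snd_conv by blast
    have "(y + 2 * (- x)) mod 5 = i" if "(x + 2 * y) mod 5 = 2 * i mod 5" for x y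
    proof -
      have "y + 2 * (- x) = 3 * (x + 2 * y) + 5 * (- x - y)" by simp
      then have "(y + 2 * (- x)) mod 5 = 3 * (2 * i) mod 5"
        by (metis that mod_mult_self2 mod_mult_right_eq)
      then show ?thesis using \<open>i \<in> {1, 2, 4}\<close> by auto
    qed
    then show "(case b of (x, y) \<Rightarrow> (y, - x)) \<in> S i" if "b \<in> S (2 * i mod 5)" for b
      using that unfolding S_def case_prod_unfold mem_Collect_eq fst_conv snd_conv by blast
    show "F (case b of (x, y) \<Rightarrow> (y, - x)) = F b" for b
      using rot[where x = "snd b" and y = "- fst b"] by (cases b) simp
  qed (auto simp: rot)
  have S2: "(F has_sum t) (S 2)" using rotS[OF S1] by simp
  have S4: "(F has_sum t) (S 4)" using rotS[OF S2] by simp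
  have S3: "(F has_sum t) (S 3)" using rotS[OF S4] by simp
  have "(F has_sum s + t + t + t + t) (S 0 \<union> S 1 \<union> S 2 \<union> S 3 \<union> S 4)"
    by (intro has_sum_Un_disjoint S0 S1 S2 S3 S4) (auto simp: S_def)
  also have "S 0 \<union> S 1 \<union> S 2 \<union> S 3 \<union> S 4 = UNIV"
  proof -
    have "r = 0 \<or> r = 1 \<or> r = 2 \<or> r = 3 \<or> r = 4" if "0 \<le> r" "r < 5" for r :: int
      using that by arith
    from this[OF pos_mod_sign pos_mod_bound] show ?thesis
      unfolding S_def by auto
  qed
  finally show ?thesis .
qed

lemma jtp_term_quadratic:
  fixes q :: "'a::{real_normed_field,banach}"
  assumes "q \<noteq> 0"
  shows "jtp_term (q ^ (2 * c)) (- (q ^ d)) n = (- 1) powi n * q powi (int c * (n * (n - 1)) + int d * n)"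
proof -
  have "(q ^ (2 * c)) powi triangular n = q powi (int c * (n * (n - 1)))"
    unfolding power_int_power two_triangular[symmetric] by (simp add: mult_ac)
  moreover have "(- (q ^ d)) powi n = (- 1) powi n * q powi (int d * n)"
    using power_int_mult_distrib[of "- 1" "q ^ d" n] by (simp add: power_int_power)
  ultimately show ?thesis
    using assms by (simp add: jtp_term_def power_int_add)
qed

text \<open>The left-hand side sums \<open>(- 1)^(x + y) q^(x^2 + y^2)\<close> over the Gaussian
  integers. Multiplication by the imaginary unit keeps norm and sign, multiplication by
  \<open>2 - i\<close> keeps the sign and scales the norm by 5. In Ramanujan's notation,
  \<open>f 1 1\<close> and \<open>f 5 5\<close> are phi at \<open>- q\<close> and
  \<open>- q^5\<close>.\<close>

lemma phi_square_identity:
  fixes q :: "'a::{real_normed_field,banach}"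
  assumes "q \<noteq> 0" "norm q < 1"
  defines "f \<equiv> \<lambda>c d. infsum (jtp_term (q ^ (2 * c)) (- (q ^ d))) UNIV"
  shows "(f 1 1)\<^sup>2 = (f 5 5)\<^sup>2 - 4 * q * (f 5 1 * f 5 3)"
proof -
  define F where "F = (\<lambda>(x, y). jtp_term (q ^ (2 * 1)) (- (q ^ 1)) x * jtp_term (q ^ (2 * 1)) (- (q ^ 1)) y)"
  have nz: "q ^ n \<noteq> 0" "- (q ^ n) \<noteq> 0" "norm (q ^ Suc n) < 1" for n
    using assms by (auto simp: norm_power power_less_one_iff simp del: power_Suc)
  have sm: "(\<lambda>k. norm (jtp_term (q ^ (2 * c)) (- (q ^ d)) k)) summable_on UNIV" if "c > 0" for c d
    using nz(3)[of "2 * c - 1"] that by (intro jtp_term_summable nz) auto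
  have F: "F (x, y) = (- 1) powi (x + y) * q powi (x * x + y * y)" for x y
  proof -
    have "x * x + y * y = (int 1 * (x * (x - 1)) + int 1 * x) + (int 1 * (y * (y - 1)) + int 1 * y)"
      by (simp add: algebra_simps)
    then have "q powi (x * x + y * y) = q powi (int 1 * (x * (x - 1)) + int 1 * x) * q powi (int 1 * (y * (y - 1)) + int 1 * y)"
      by (simp only: power_int_add[OF disjI1, OF assms(1)])
    then show ?thesis
      unfolding F_def prod.case jtp_term_quadratic[OF assms(1)] by (simp add: power_int_add)
  qed
  have F0: "F (2 * m + n, 2 * n - m) = jtp_term (q ^ (2 * 5)) (- (q ^ 5)) m * jtp_term (q ^ (2 * 5)) (- (q ^ 5)) n" for m n
  proof -
    have "(2 * m + n) * (2 * m + n) + (2 * n - m) * (2 * n - m) = (int 5 * (m * (m - 1)) + int 5 * m) + (int 5 * (n * (n - 1)) + int 5 * n)"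
      by (simp add: algebra_simps)
    moreover have "(- 1 :: 'a) powi ((2 * m + n) + (2 * n - m)) = (- 1) powi m * (- 1) powi n"
      by (simp add: power_int_minus_left)
    ultimately show ?thesis
      unfolding F jtp_term_quadratic[OF assms(1)] using power_int_add[OF disjI1, OF assms(1)] by (simp only: mult_ac)
  qed
  \<comment> \<open>The class of 1 is written as \<open>1 - (2 - i)(m + i n)\<close>: with a plus
    sign the linear terms would give the parameters 9 and 7 instead of their mirror images 1 and
    3.\<close>
  have F1: "F (1 - 2 * m - n, m - 2 * n) = - q * (jtp_term (q ^ (2 * 5)) (- (q ^ 1)) m * jtp_term (q ^ (2 * 5)) (- (q ^ 3)) n)" for m n
  proof -
    have "(1 - 2 * m - n) * (1 - 2 * m - n) + (m - 2 * n) * (m - 2 * n) = 1 + ((int 5 * (m * (m - 1)) + int 1 * m) + (int 5 * (n * (n - 1)) + int 3 * n))"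
      by (simp add: algebra_simps)
    moreover have "(- 1 :: 'a) powi ((1 - 2 * m - n) + (m - 2 * n)) = - ((- 1) powi m * (- 1) powi n)"
      by (simp add: power_int_minus_left)
    ultimately have "F (1 - 2 * m - n, m - 2 * n) = - ((- 1) powi m * (- 1) powi n) *
        q powi (1 + ((int 5 * (m * (m - 1)) + int 1 * m) + (int 5 * (n * (n - 1)) + int 3 * n)))"
      unfolding F by (simp only:)
    also have "q powi (1 + ((int 5 * (m * (m - 1)) + int 1 * m) + (int 5 * (n * (n - 1)) + int 3 * n)))
      = q * (q powi (int 5 * (m * (m - 1)) + int 1 * m) * q powi (int 5 * (n * (n - 1)) + int 3 * n))"
      by (simp only: power_int_add[OF disjI1, OF assms(1)]) simp
    finally show ?thesis
      unfolding jtp_term_quadratic[OF assms(1)] by simp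
  qed
  have "(F has_sum (f 1 1)\<^sup>2) UNIV"
    unfolding F_def f_def power2_eq_square by (intro has_sum_mult_abs sm) simp_all
  moreover have "(F has_sum (f 5 5)\<^sup>2 + - q * (f 5 1 * f 5 3) + - q * (f 5 1 * f 5 3) + - q * (f 5 1 * f 5 3) + - q * (f 5 1 * f 5 3)) UNIV"
  proof (rule has_sum_int_pair_mod5)
    show "F (- y, x) = F (x, y)" for x y
      unfolding F by (simp add: power_int_minus_left add.commute)
    show "((\<lambda>(m, n). F (2 * m + n, 2 * n - m)) has_sum (f 5 5)\<^sup>2) UNIV"
      unfolding F0 f_def power2_eq_square by (intro has_sum_mult_abs sm) simp_all
    have "((\<lambda>p. - q * (case p of (m, n) \<Rightarrow> jtp_term (q ^ (2 * 5)) (- (q ^ 1)) m * jtp_term (q ^ (2 * 5)) (- (q ^ 3)) n)) has_sum - q * (f 5 1 * f 5 3)) UNIV"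
      unfolding f_def by (intro has_sum_cmult_right has_sum_mult_abs sm) simp_all
    then show "((\<lambda>(m, n). F (1 - 2 * m - n, m - 2 * n)) has_sum - q * (f 5 1 * f 5 3)) UNIV"
      unfolding F1 by (simp only: case_prod_unfold)
  qed
  ultimately have "(f 1 1)\<^sup>2 = (f 5 5)\<^sup>2 + - q * (f 5 1 * f 5 3) + - q * (f 5 1 * f 5 3) + - q * (f 5 1 * f 5 3) + - q * (f 5 1 * f 5 3)"
    by (rule has_sum_unique)
  then show ?thesis by (simp add: algebra_simps)
qed

lemma theta_three_term_powi:
  fixes q :: "'a::{real_normed_field,banach}"
  assumes "q \<noteq> 0" "norm q < 1" "N > 0"
  defines "t \<equiv> \<lambda>a. theta (q powi a) (q ^ N)"
  shows "q powi y * (t (x + y) * t (x - y)) * (t (u + v) * t (u - v))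
    = q powi u * (t (x + u) * t (x - u) * (t (y + v) * t (y - v)) - t (x + v) * t (x - v) * (t (y + u) * t (y - u)))"
proof -
  have "q ^ N \<noteq> 0" "norm (q ^ N) < 1"
    using assms by (auto simp: norm_power power_less_one_iff)
  from theta_three_term[OF this, of "q powi x" "q powi y" "q powi u" "q powi v"] assms(1) show ?thesis
    unfolding t_def by (simp add: power_int_add power_int_diff)
qed

text \<open>Reflection and inversion reduce every exponent modulo 10 to one of 1 to 5, so few values
  remain. The first relation becomes \<open>h = 1/k - k\<close>, the second the eta quotient for
  \<open>h + 1\<close>.\<close>

lemma level10_theta:
  fixes q :: "'a::{real_normed_field,banach}"
  assumes "q \<noteq> 0" "norm q < 1"
  defines "t \<equiv> \<lambda>a. theta (q ^ a) (q ^ 10)"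
  shows "(t 3)\<^sup>2 * (t 4)\<^sup>2 - q\<^sup>2 * (t 1)\<^sup>2 * (t 2)\<^sup>2 = t 2 * t 4 * (t 5)\<^sup>2"
    and "(t 2)\<^sup>2 * (t 4)\<^sup>2 - q * (t 1)\<^sup>2 * (t 3)\<^sup>2 = t 1 * t 3 * (t 5)\<^sup>2"
proof -
  define s where "s = (\<lambda>a::int. theta (q powi a) (q ^ 10))"
  have n: "q ^ 10 \<noteq> 0" "norm (q ^ 10) < 1"
    using assms by (auto simp: norm_power power_less_one_iff)
  have neg: "s (- a) = - s a / q powi a" for a
    using theta_inverse[OF n(2), of "q powi a"] assms(1) by (simp add: s_def power_int_minus_divide)
  have refl: "s (10 - a) = s a" for a
    using theta_reflect[OF n(1), of "q powi a"] assms(1) by (simp add: s_def power_int_diff)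
  define a b c d e where ts: "a = t 1" "b = t 2" "c = t 3" "d = t 4" "e = t 5"
  have st: "s 1 = a" "s 2 = b" "s 3 = c" "s 4 = d" "s 5 = e"
    by (simp_all add: s_def t_def ts)
  have s: "s 6 = d" "s 7 = c" "s 8 = b" "s (- 1) = - a / q" "s (- 2) = - b / q\<^sup>2"
    "s (- 3) = - c / q ^ 3" "s (- 4) = - d / q ^ 4"
    using refl[of 4] refl[of 3] refl[of 2] neg[of 1] neg[of 2] neg[of 3] neg[of 4] by (simp_all add: st)
  have three: "q powi y * (s (x + y) * s (x - y)) * (s (u + v) * s (u - v))
    = q powi u * (s (x + u) * s (x - u) * (s (y + v) * s (y - v)) - s (x + v) * s (x - v) * (s (y + u) * s (y - u)))"
    for x y u v
    unfolding s_def using assms by (intro theta_three_term_powi) auto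
  \<comment> \<open>Here \<open>x = 5\<close>, \<open>y = -1\<close>, \<open>u = 3\<close>,
    \<open>v = 0\<close> (the instantiation starts with y). The three products have the exponents 4,
    6, 3, 3, then 8, 2, -1, -1, then 5, 5, 2, -4.\<close>
  have "q ^ 3 * (c\<^sup>2 * d\<^sup>2 - q\<^sup>2 * a\<^sup>2 * b\<^sup>2) = q ^ 3 * (b * d * e\<^sup>2)"
    using three[of "-1" 5 3 0] assms(1) by (simp add: s st field_simps eval_nat_numeral)
  then show "(t 3)\<^sup>2 * (t 4)\<^sup>2 - q\<^sup>2 * (t 1)\<^sup>2 * (t 2)\<^sup>2 = t 2 * t 4 * (t 5)\<^sup>2"
    using assms(1) by (simp add: ts)
  \<comment> \<open>Here \<open>x = 1\<close>, \<open>y = 3\<close>, \<open>u = 4\<close>,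
    \<open>v = 2\<close>. The exponents are 4, -2, 6, 2, then 5, -3, 5, 1, then 3, -1, 7,
    -1.\<close>
  have "q ^ 4 * (b\<^sup>2 * d\<^sup>2 - q * a\<^sup>2 * c\<^sup>2) = q ^ 4 * (a * c * e\<^sup>2)"
    using three[of 3 1 4 2] assms(1) by (simp add: s st field_simps eval_nat_numeral)
  then show "(t 2)\<^sup>2 * (t 4)\<^sup>2 - q * (t 1)\<^sup>2 * (t 3)\<^sup>2 = t 1 * t 3 * (t 5)\<^sup>2"
    using assms(1) by (simp add: ts)
qed

subsection \<open>Eta quotients of level 10\<close>

lemma euler_E_pos: "0 \<le> q \<Longrightarrow> q < 1 \<Longrightarrow> euler_E q > 0"
  unfolding euler_E_eq_qpoch by (rule qpoch_pos)

lemma prod_lessThan_10: "(\<Prod>i<10. f i) = f 0 * f 1 * f 2 * f 3 * f 4 * f 5 * f 6 * f 7 * f 8 * f (9::nat)"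
  by (simp add: lessThan_nat_numeral mult_ac)

lemma prod_lessThan_5: "(\<Prod>i<5. f i) = f 0 * f 1 * f 2 * f 3 * f (4::nat)"
  by (simp add: lessThan_nat_numeral mult_ac)

lemma prod_lessThan_2: "(\<Prod>i<2. f i) = f 0 * f (1::nat)"
  by (simp add: lessThan_nat_numeral mult_ac)

text \<open>The residue class of 5 modulo 10 is its own mirror image: it enters E once, through g,
  but the theta value \<open>t 5\<close> twice.\<close>

lemma euler_E_level10:
  fixes q :: real
  assumes "0 < q" "q < 1"
  defines "t \<equiv> \<lambda>a. theta (q ^ a) (q ^ 10)" and "g \<equiv> qpoch (q ^ 5) (q ^ 10)"
  shows "euler_E q = t 1 * t 2 * t 3 * t 4 * g * euler_E (q ^ 10)"
    and "euler_E (q ^ 2) = t 2 * t 4 * euler_E (q ^ 10)"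
    and "euler_E (q ^ 5) = g * euler_E (q ^ 10)"
    and "t 5 = g\<^sup>2"
proof -
  have t: "t a = qpoch (q ^ a) (q ^ 10) * qpoch (q ^ (10 - a)) (q ^ 10)" if "a \<le> 10" for a
    using assms that by (simp add: t_def theta_def power_diff)
  have lt: "norm (q ^ n) < 1" if "n > 0" for n
    using assms that by (simp add: power_less_one_iff)
  have "euler_E q = (\<Prod>i<10. qpoch (q ^ Suc i) (q ^ 10))"
    unfolding euler_E_eq_qpoch using qpoch_dissect[of q 10 q] assms by simp
  then show "euler_E q = t 1 * t 2 * t 3 * t 4 * g * euler_E (q ^ 10)"
    unfolding prod_lessThan_10 by (simp add: t g_def euler_E_eq_qpoch del: power_Suc flip: numeral_2_eq_2)
  have "euler_E (q ^ 2) = (\<Prod>i<5. qpoch (q ^ (2 * Suc i)) (q ^ 10))"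
    unfolding euler_E_eq_qpoch using qpoch_dissect[OF lt, of 2 5 "q ^ 2"] by (simp flip: power_mult power_add)
  then show "euler_E (q ^ 2) = t 2 * t 4 * euler_E (q ^ 10)"
    unfolding prod_lessThan_5 by (simp add: t euler_E_eq_qpoch)
  have "euler_E (q ^ 5) = (\<Prod>i<2. qpoch (q ^ (5 * Suc i)) (q ^ 10))"
    unfolding euler_E_eq_qpoch using qpoch_dissect[OF lt, of 5 2 "q ^ 5"] by (simp flip: power_mult power_add)
  then show "euler_E (q ^ 5) = g * euler_E (q ^ 10)"
    unfolding prod_lessThan_2 by (simp add: g_def euler_E_eq_qpoch)
  show "t 5 = g\<^sup>2"
    by (simp add: t g_def power2_eq_square)
qed

lemma theta_pos:
  fixes q :: real
  assumes "0 < q" "q < 1" "0 < z" "q < z" "z < 1"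
  shows "theta z q > 0"
  unfolding theta_def using assms by (intro mult_pos_pos qpoch_pos) auto

text \<open>Gauss's product for phi at \<open>- q\<close>: the triple product contributes the odd
  factors squared, and these are \<open>E(q)/E(q^2)\<close>.\<close>

lemma phi_eq_euler_E:
  fixes q :: real
  assumes "0 < q" "q < 1"
  shows "infsum (jtp_term (q\<^sup>2) (- q)) UNIV = (euler_E q)\<^sup>2 / euler_E (q\<^sup>2)"
proof -
  have q2: "0 < q\<^sup>2" "q\<^sup>2 < 1"
    using assms by (auto simp: power_less_one_iff)
  have "euler_E q = (\<Prod>i<2. qpoch (q ^ Suc i) (q ^ 2))"
    unfolding euler_E_eq_qpoch using qpoch_dissect[of q 2 q] assms by simp
  then have "euler_E q = qpoch q (q\<^sup>2) * euler_E (q\<^sup>2)"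
    unfolding prod_lessThan_2 by (simp add: euler_E_eq_qpoch power2_eq_square)
  moreover have "infsum (jtp_term (q\<^sup>2) (- q)) UNIV = euler_E (q\<^sup>2) * (qpoch q (q\<^sup>2))\<^sup>2"
    using assms q2 infsum_jtp_term[of "q\<^sup>2" q] by (simp add: euler_E_eq_qpoch theta_def power2_eq_square)
  moreover have "euler_E (q\<^sup>2) > 0"
    using q2 by (intro euler_E_pos) auto
  ultimately show ?thesis
    by (simp add: power2_eq_square)
qed

text \<open>Besides its pole, this function takes the values $0$, $-1$ and $4$ at the cusps of $X_0(10)$.\<close>

definition hauptmodul :: "real \<Rightarrow> real" where
  "hauptmodul q = euler_E (q ^ 2) * euler_E (q ^ 5) ^ 5 / (q * euler_E q * euler_E (q ^ 10) ^ 5)"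

text \<open>The exponent \<open>\<epsilon>(n)\<close> is 1 for n congruent to 1, 2, 8, 9 modulo 10
  and -1 for 3, 4, 6, 7, so the product is a quotient of theta values. The factor q makes the value
  at 0 equal to 0.\<close>

definition ramanujan_k :: "real \<Rightarrow> real" where
  "ramanujan_k q = q * (theta q (q ^ 10) * theta (q ^ 2) (q ^ 10)) / (theta (q ^ 3) (q ^ 10) * theta (q ^ 4) (q ^ 10))"

lemma theta_level10_pos:
  fixes q :: real
  assumes "0 < q" "q < 1" "0 < a" "a < 10"
  shows "theta (q ^ a) (q ^ 10) > 0"
  using assms by (intro theta_pos power_strict_decreasing) (auto simp: power_less_one_iff)

text \<open>In these coordinates every identity between eta quotients of level 10 becomes a rational
  identity modulo the two relations at the end.\<close>

lemma level10_parametrization: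
  assumes "0 < q" "q < 1"
  obtains a b c d g f :: real
  where "a > 0" "b > 0" "c > 0" "d > 0" "g > 0" "f > 0"
    and "a = theta q (q ^ 10)" "c = theta (q ^ 3) (q ^ 10)"
    and "euler_E q = a * b * c * d * g * f" "euler_E (q ^ 2) = b * d * f"
    and "euler_E (q ^ 5) = g * f" "euler_E (q ^ 10) = f" "ramanujan_k q = q * (a * b) / (c * d)"
    and "c\<^sup>2 * d\<^sup>2 - q\<^sup>2 * a\<^sup>2 * b\<^sup>2 = b * d * g ^ 4"
    and "b\<^sup>2 * d\<^sup>2 = q * a\<^sup>2 * c\<^sup>2 + a * c * g ^ 4"
proof -
  define t where "t = (\<lambda>a. theta (q ^ a) (q ^ 10))"
  define g where "g = qpoch (q ^ 5) (q ^ 10)"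
  have pos: "t n > 0" if "0 < n" "n < 10" for n
    unfolding t_def using assms that by (rule theta_level10_pos)
  have "g > 0" "euler_E (q ^ 10) > 0"
    unfolding g_def using assms by (auto intro!: qpoch_pos euler_E_pos simp: power_less_one_iff)
  note E = euler_E_level10[OF assms, folded t_def g_def]
  have lv: "(t 3)\<^sup>2 * (t 4)\<^sup>2 - q\<^sup>2 * (t 1)\<^sup>2 * (t 2)\<^sup>2 = t 2 * t 4 * g ^ 4"
    "(t 2)\<^sup>2 * (t 4)\<^sup>2 = q * (t 1)\<^sup>2 * (t 3)\<^sup>2 + t 1 * t 3 * g ^ 4"
    using level10_theta[of q, folded t_def] assms unfolding E(4) by (simp_all add: t_def algebra_simps)
  have k: "ramanujan_k q = q * (t 1 * t 2) / (t 3 * t 4)"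
    by (simp add: ramanujan_k_def t_def)
  show ?thesis
    by (rule that[of "t 1" "t 2" "t 3" "t 4" g "euler_E (q ^ 10)"])
       (use pos[of 1] pos[of 2] pos[of 3] pos[of 4] \<open>g > 0\<close> \<open>euler_E (q ^ 10) > 0\<close> E(1-3) lv k in \<open>simp_all add: t_def\<close>)
qed

lemma hauptmodul_eq_ramanujan_k:
  assumes "0 < q" "q < 1"
  shows "hauptmodul q = 1 / ramanujan_k q - ramanujan_k q"
proof -
  obtain a b c d g f :: real where pos: "a > 0" "b > 0" "c > 0" "d > 0" "g > 0" "f > 0"
    and E: "euler_E q = a * b * c * d * g * f" "euler_E (q ^ 2) = b * d * f"
      "euler_E (q ^ 5) = g * f" "euler_E (q ^ 10) = f" "ramanujan_k q = q * (a * b) / (c * d)"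
    and *: "c\<^sup>2 * d\<^sup>2 - q\<^sup>2 * a\<^sup>2 * b\<^sup>2 = b * d * g ^ 4"
    by (rule level10_parametrization[OF assms])
  have "hauptmodul q = (b * d * g ^ 4) / (q * a * b * c * d)"
    unfolding hauptmodul_def E using pos assms
    by (simp add: divide_simps) (simp add: algebra_simps eval_nat_numeral)
  also have "\<dots> = 1 / ramanujan_k q - ramanujan_k q"
    unfolding *[symmetric] E using pos assms by (simp add: divide_simps) (simp add: algebra_simps eval_nat_numeral)
  finally show ?thesis .
qed

lemma hauptmodul_plus_1:
  assumes "0 < q" "q < 1"
  shows "hauptmodul q + 1 = euler_E (q ^ 2) ^ 4 * euler_E (q ^ 5) ^ 2 / (q * euler_E q ^ 2 * euler_E (q ^ 10) ^ 4)"
proof -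
  obtain a b c d g f :: real where pos: "a > 0" "b > 0" "c > 0" "d > 0" "g > 0" "f > 0"
    and E: "euler_E q = a * b * c * d * g * f" "euler_E (q ^ 2) = b * d * f"
      "euler_E (q ^ 5) = g * f" "euler_E (q ^ 10) = f"
    and *: "b\<^sup>2 * d\<^sup>2 = q * a\<^sup>2 * c\<^sup>2 + a * c * g ^ 4"
    by (rule level10_parametrization[OF assms])
  have "hauptmodul q + 1 = (q * a\<^sup>2 * c\<^sup>2 + a * c * g ^ 4) / (q * a\<^sup>2 * c\<^sup>2)"
    unfolding hauptmodul_def E using pos assms
    by (simp add: divide_simps) (simp add: algebra_simps eval_nat_numeral)
  also have "\<dots> = euler_E (q ^ 2) ^ 4 * euler_E (q ^ 5) ^ 2 / (q * euler_E q ^ 2 * euler_E (q ^ 10) ^ 4)"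
    unfolding *[symmetric] E using pos assms
    by (simp add: divide_simps) (simp add: algebra_simps eval_nat_numeral)
  finally show ?thesis .
qed

text \<open>In the coordinates above h is \<open>g^4 / (q a c)\<close>, and \<open>q a c\<close>
  matches the mixed term of \<open>phi_square_identity\<close>. The constant 4 counts the nonzero
  residue classes modulo \<open>2 - i\<close>.\<close>

lemma hauptmodul_minus_4:
  assumes "0 < q" "q < 1"
  shows "hauptmodul q - 4 = euler_E q ^ 3 * euler_E (q ^ 5) / (q * euler_E (q ^ 2) * euler_E (q ^ 10) ^ 3)"
proof -
  obtain a b c d g f :: real where pos: "a > 0" "b > 0" "c > 0" "d > 0" "g > 0" "f > 0"
    and ac: "a = theta q (q ^ 10)" "c = theta (q ^ 3) (q ^ 10)"
    and E: "euler_E q = a * b * c * d * g * f" "euler_E (q ^ 2) = b * d * f"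
      "euler_E (q ^ 5) = g * f" "euler_E (q ^ 10) = f"
    by (rule level10_parametrization[OF assms])
  have ten: "0 < q ^ 10" "q ^ 10 < 1" "0 < q ^ 5" "q ^ 5 < 1"
    using assms by (auto simp: power_less_one_iff)
  have "infsum (jtp_term (q ^ (2 * 1)) (- (q ^ 1))) UNIV = (a * b * c * d * g * f)\<^sup>2 / (b * d * f)"
    using phi_eq_euler_E[OF assms] by (simp add: E)
  moreover have "infsum (jtp_term (q ^ (2 * 5)) (- (q ^ 5))) UNIV = (g * f)\<^sup>2 / f"
    using phi_eq_euler_E[OF ten(3,4)] by (simp add: E flip: power_mult)
  moreover have "infsum (jtp_term (q ^ (2 * 5)) (- (q ^ 1))) UNIV = f * a"
    "infsum (jtp_term (q ^ (2 * 5)) (- (q ^ 3))) UNIV = f * c"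
    using infsum_jtp_term[of "q ^ 10" q] infsum_jtp_term[of "q ^ 10" "q ^ 3"] assms ten
    by (simp_all add: ac E(4)[symmetric] euler_E_eq_qpoch)
  ultimately have "((a * b * c * d * g * f)\<^sup>2 / (b * d * f))\<^sup>2 = ((g * f)\<^sup>2 / f)\<^sup>2 - 4 * q * (f * a * (f * c))"
    using phi_square_identity[of q] assms by simp
  moreover have "((a * b * c * d * g * f)\<^sup>2 / (b * d * f))\<^sup>2 = f\<^sup>2 * (a ^ 4 * b\<^sup>2 * c ^ 4 * d\<^sup>2 * g ^ 4)"
    using pos by (simp add: divide_simps) (simp add: algebra_simps eval_nat_numeral)
  moreover have "((g * f)\<^sup>2 / f)\<^sup>2 - 4 * q * (f * a * (f * c)) = f\<^sup>2 * (g ^ 4 - 4 * q * a * c)"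
    using pos by (simp add: divide_simps) (simp add: algebra_simps eval_nat_numeral)
  ultimately have *: "a ^ 4 * b\<^sup>2 * c ^ 4 * d\<^sup>2 * g ^ 4 = g ^ 4 - 4 * q * a * c"
    using pos by simp
  have "hauptmodul q - 4 = (g ^ 4 - 4 * q * a * c) / (q * a * c)"
    unfolding hauptmodul_def E using pos assms
    by (simp add: divide_simps) (simp add: algebra_simps eval_nat_numeral)
  also have "\<dots> = euler_E q ^ 3 * euler_E (q ^ 5) / (q * euler_E (q ^ 2) * euler_E (q ^ 10) ^ 3)"
    unfolding *[symmetric] E using pos assms
    by (simp add: divide_simps) (simp add: algebra_simps eval_nat_numeral)
  finally show ?thesis .
qed

subsection \<open>Differences of Weierstrass functions\<close>

lemma prodinf_one_minus_LIMSEQ: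
  fixes a :: "nat \<Rightarrow> 'a::{real_normed_field,banach}"
  assumes "summable (\<lambda>j. norm (a j))"
  shows "(\<lambda>n. \<Prod>j<n. 1 - w * a j) \<longlonglongrightarrow> (\<Prod>j. 1 - w * a j)"
proof -
  have "summable (\<lambda>j. norm ((1 - w * a j) - 1))"
    using assms by (auto simp: norm_mult intro!: summable_mult)
  then have "convergent_prod (\<lambda>j. 1 - w * a j)"
    by (intro abs_convergent_prod_imp_convergent_prod summable_imp_abs_convergent_prod)
  from convergent_prod_LIMSEQ[OF this] show ?thesis
    unfolding LIMSEQ_lessThan_iff_atMost .
qed

text \<open>Telescoping writes the difference quotient as a series with terms \<open>- a j\<close>
  times a partial product. Each partial product tends to 1, so only a majorant is needed to pass to
  the limit.\<close>

lemma prodinf_one_minus_deriv: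
  fixes a :: "nat \<Rightarrow> 'a::{real_normed_field,banach}"
  assumes a: "summable (\<lambda>j. norm (a j))" and w: "w \<longlonglongrightarrow> 0" "\<And>n. w n \<noteq> 0"
  shows "(\<lambda>n. ((\<Prod>j. 1 - w n * a j) - 1) / w n) \<longlonglongrightarrow> - (\<Sum>j. a j)"
proof -
  have tele: "(\<Prod>j<N. 1 - v * a j) - 1 = - v * (\<Sum>j<N. a j * (\<Prod>i<j. 1 - v * a i))" for v N
    by (induction N) (simp_all add: algebra_simps)
  have sums: "(\<lambda>j. a j * (\<Prod>i<j. 1 - v * a i)) sums (- (((\<Prod>j. 1 - v * a j) - 1) / v))" if "v \<noteq> 0" for v
  proof -
    have "(\<Sum>j<N. a j * (\<Prod>i<j. 1 - v * a i)) = - (((\<Prod>j<N. 1 - v * a j) - 1) / v)" for N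
      using tele[where N = N and v = v] that by simp
    then show ?thesis
      unfolding sums_def using that by (simp only:) (intro tendsto_intros prodinf_one_minus_LIMSEQ[OF a])
  qed
  \<comment> \<open>For \<open>norm v \<le> 1\<close> each factor is at most
    \<open>exp (norm (a i))\<close>, so M bounds all partial products uniformly.\<close>
  define M where "M = exp (\<Sum>j. norm (a j))"
  have bound: "norm (\<Prod>i<j. 1 - v * a i) \<le> M" if "norm v \<le> 1" for v j
  proof -
    have "norm (\<Prod>i<j. 1 - v * a i) = (\<Prod>i<j. norm (1 - v * a i))"
      by (simp add: prod_norm)
    also have "\<dots> \<le> (\<Prod>i<j. exp (norm (a i)))"
    proof (intro prod_mono conjI norm_ge_zero)
      fix i
      have "norm (1 - v * a i) \<le> norm (1::'a) + norm (v * a i)"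
        by (rule norm_triangle_ineq4)
      also have "\<dots> \<le> 1 + norm (a i)"
        using that by (simp add: norm_mult mult_left_le_one_le)
      also have "\<dots> \<le> exp (norm (a i))"
        by (rule exp_ge_add_one_self)
      finally show "norm (1 - v * a i) \<le> exp (norm (a i))" .
    qed
    also have "\<dots> = exp (\<Sum>i<j. norm (a i))"
      by (simp add: exp_sum)
    also have "\<dots> \<le> M"
      unfolding M_def using a by (auto intro: sum_le_suminf)
    finally show ?thesis .
  qed
  have ev: "eventually (\<lambda>n. norm (w n) \<le> 1) sequentially"
    using order_tendstoD(2)[OF tendsto_norm_zero[OF w(1)], of 1] by (auto elim: eventually_mono)
  have "eventually (\<lambda>(k, n). norm (a k * (\<Prod>i<k. 1 - w n * a i)) \<le> norm (a k) * M) (at_top \<times>\<^sub>F sequentially)"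
    using eventually_prodI[OF eventually_True ev, of sequentially]
    by (rule eventually_mono) (auto simp: norm_mult intro!: mult_left_mono bound)
  moreover have "(\<lambda>n. a k * (\<Prod>i<k. 1 - w n * a i)) \<longlonglongrightarrow> a k" for k
  proof -
    have "(\<lambda>n. a k * (\<Prod>i<k. 1 - w n * a i)) \<longlonglongrightarrow> a k * (\<Prod>i<k. 1 - 0 * a i)"
      by (intro tendsto_intros w)
    then show ?thesis by simp
  qed
  moreover have "summable (\<lambda>k. norm (a k) * M)"
    using a by (rule summable_mult2)
  ultimately have "(\<lambda>n. \<Sum>k. a k * (\<Prod>i<k. 1 - w n * a i)) \<longlonglongrightarrow> (\<Sum>k. a k)"
    using tannerys_theorem[of "\<lambda>k n. a k * (\<Prod>i<k. 1 - w n * a i)" a sequentially "\<lambda>k. norm (a k) * M"] by simp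
  moreover have "(\<Sum>k. a k * (\<Prod>i<k. 1 - w n * a i)) = - (((\<Prod>j. 1 - w n * a j) - 1) / w n)" for n
    using sums[OF w(2)] by (rule sums_unique[symmetric])
  ultimately have "(\<lambda>n. - (((\<Prod>j. 1 - w n * a j) - 1) / w n)) \<longlonglongrightarrow> (\<Sum>k. a k)"
    by simp
  from tendsto_minus[OF this] show ?thesis by simp
qed

lemma prodinf_one_minus_tendsto_1:
  fixes a :: "nat \<Rightarrow> 'a::{real_normed_field,banach}"
  assumes a: "summable (\<lambda>j. norm (a j))" and w: "w \<longlonglongrightarrow> 0" "\<And>n. w n \<noteq> 0"
  shows "(\<lambda>n. \<Prod>j. 1 - w n * a j) \<longlonglongrightarrow> 1"
proof -
  have "(\<lambda>n. 1 + w n * (((\<Prod>j. 1 - w n * a j) - 1) / w n)) \<longlonglongrightarrow> 1 + 0 * (- (\<Sum>j. a j))"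
    by (intro tendsto_intros prodinf_one_minus_deriv a w)
  then show ?thesis using w(2) by simp
qed

text \<open>The sum of \<open>n z^n\<close>, continued as a rational function. At
  \<open>z = exp (i t)\<close> it is \<open>- 1 / (4 sin^2 (t/2))\<close>, the trigonometric
  degeneration of the Weierstrass function up to normalisation, and it is invariant under
  \<open>z \<mapsto> 1/z\<close>.\<close>

definition koebe :: "'a::real_normed_field \<Rightarrow> 'a" where
  "koebe z = z / (1 - z)\<^sup>2"

lemma summable_koebe:
  fixes q :: "'a::{real_normed_field,banach}"
  assumes "norm q < 1" "\<And>j. a * q ^ j \<noteq> 1"
  shows "summable (\<lambda>j. norm (koebe (a * q ^ j)))"
proof -
  have "(\<lambda>j. a * q ^ j) \<longlonglongrightarrow> a * 0"
    using assms by (intro tendsto_intros LIMSEQ_power_zero)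
  then have "(\<lambda>j. inverse ((1 - a * q ^ j)\<^sup>2)) \<longlonglongrightarrow> inverse ((1 - 0)\<^sup>2)"
    by (intro tendsto_intros) auto
  then have "Bseq (\<lambda>j. inverse ((1 - a * q ^ j)\<^sup>2))"
    by (intro convergent_imp_Bseq convergentI)
  then obtain K where K: "\<And>j. norm (inverse ((1 - a * q ^ j)\<^sup>2)) \<le> K"
    unfolding Bseq_def by blast
  have "summable (\<lambda>j. norm q ^ j)"
    using assms(1) by (simp add: summable_geometric_iff)
  then have "summable (\<lambda>j. norm a * norm q ^ j * K)"
    by (rule summable_mult2[OF summable_mult])
  then show ?thesis
  proof (rule summable_comparison_test')
    fix j
    have "norm (koebe (a * q ^ j)) = norm a * norm q ^ j * norm (inverse ((1 - a * q ^ j)\<^sup>2))"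
      by (simp add: koebe_def divide_inverse norm_mult norm_power)
    also have "\<dots> \<le> norm a * norm q ^ j * K"
      using K by (intro mult_left_mono) auto
    finally show "norm (norm (koebe (a * q ^ j))) \<le> norm a * norm q ^ j * K" by simp
  qed
qed

text \<open>Since $(1 - X u)(1 - X / u) = (1 - X)^2 - X (1 - u)^2 / u$, the left-hand side depends on $u$ only through
  $(1 - u)^2 / u$. Hence a first-order limit suffices to extract the second logarithmic derivative of theta.\<close>

lemma qpoch_mult_qpoch:
  fixes q :: "'a::{real_normed_field,banach}"
  assumes "norm q < 1" "\<And>j. a * q ^ j \<noteq> 1" "u \<noteq> 0"
  shows "qpoch (a * u) q * qpoch (a / u) q = (qpoch a q)\<^sup>2 * (\<Prod>j. 1 - (1 - u)\<^sup>2 / u * koebe (a * q ^ j))"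
proof -
  have "(\<lambda>n. (\<Prod>j<n. 1 - a * u * q ^ j) * (\<Prod>j<n. 1 - a / u * q ^ j)) \<longlonglongrightarrow> qpoch (a * u) q * qpoch (a / u) q"
    by (intro tendsto_mult qpoch_LIMSEQ assms)
  moreover have "(\<Prod>j<n. 1 - a * u * q ^ j) * (\<Prod>j<n. 1 - a / u * q ^ j)
      = (\<Prod>j<n. 1 - a * q ^ j)\<^sup>2 * (\<Prod>j<n. 1 - (1 - u)\<^sup>2 / u * koebe (a * q ^ j))" for n
    unfolding power2_eq_square[of "prod _ _"] prod.distrib[symmetric]
  proof (rule prod.cong)
    fix j
    define X where "X = a * q ^ j"
    have "Y * Y * (1 - v * (X / Y\<^sup>2)) = Y\<^sup>2 - v * X" if "Y \<noteq> 0" for Y v :: 'a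
      using that by (simp add: field_simps power2_eq_square)
    from this[of "1 - X" "(1 - u)\<^sup>2 / u"]
    have "(1 - X) * (1 - X) * (1 - (1 - u)\<^sup>2 / u * (X / (1 - X)\<^sup>2)) = (1 - X)\<^sup>2 - (1 - u)\<^sup>2 / u * X"
      using assms(2)[of j] by (simp add: X_def)
    also have "\<dots> = (1 - X * u) * (1 - X / u)"
      using assms(3) by (simp add: field_simps power2_eq_square)
    finally show "(1 - a * u * q ^ j) * (1 - a / u * q ^ j) = (1 - a * q ^ j) * (1 - a * q ^ j) * (1 - (1 - u)\<^sup>2 / u * koebe (a * q ^ j))"
      by (simp add: X_def koebe_def mult_ac)
  qed simp
  moreover have "(\<lambda>n. (\<Prod>j<n. 1 - a * q ^ j)\<^sup>2 * (\<Prod>j<n. 1 - (1 - u)\<^sup>2 / u * koebe (a * q ^ j)))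
     \<longlonglongrightarrow> (qpoch a q)\<^sup>2 * (\<Prod>j. 1 - (1 - u)\<^sup>2 / u * koebe (a * q ^ j))"
    by (intro tendsto_intros qpoch_LIMSEQ prodinf_one_minus_LIMSEQ summable_koebe assms)
  ultimately show ?thesis
    by (simp add: LIMSEQ_unique)
qed

text \<open>The Weierstrass function in multiplicative notation, up to an affine normalisation: the
  sum of \<open>koebe (x q^n)\<close> over all integers n, with negative n folded back by the
  symmetry of \<open>koebe\<close>. Only differences occur, so no additive constant is carried
  along.\<close>

definition wp :: "'a::{real_normed_field,banach} \<Rightarrow> 'a \<Rightarrow> 'a" where
  "wp x q = (\<Sum>j. koebe (x * q ^ j)) + (\<Sum>j. koebe (q / x * q ^ j))"

text \<open>The classical expression of a difference of Weierstrass values by sigma functions. It is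
  the three-term relation at \<open>v = 1\<close>, divided by \<open>(1 - u)^2 / u\<close> in the
  limit of u tending to 1.\<close>

lemma wp_difference:
  fixes q :: "'a::{real_normed_field,banach}"
  assumes q: "q \<noteq> 0" "norm q < 1" and xy: "x \<noteq> 0" "y \<noteq> 0"
    and x: "\<And>j. x * q ^ j \<noteq> 1" "\<And>j. q / x * q ^ j \<noteq> 1"
    and y: "\<And>j. y * q ^ j \<noteq> 1" "\<And>j. q / y * q ^ j \<noteq> 1"
  shows "y * qpoch q q ^ 4 * (theta (x * y) q * theta (x / y) q) = (wp y q - wp x q) * ((theta x q)\<^sup>2 * (theta y q)\<^sup>2)"
proof -
  \<comment> \<open>Any sequence tending to 1 but avoiding it would serve; w is the only combination
    of u on which the products depend.\<close>
  define u :: "nat \<Rightarrow> real" where "u n = 1 + 1 / real (Suc n)" for n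
  define w :: "nat \<Rightarrow> 'a" where "w n = (1 - of_real (u n))\<^sup>2 / of_real (u n)" for n
  have u: "u n > 1" for n by (simp add: u_def)
  have u0: "(of_real (u n) :: 'a) \<noteq> 0" "(of_real (u n) :: 'a) \<noteq> 1" for n
    using u[of n] by (auto simp: of_real_eq_1_iff)
  have w0: "w n \<noteq> 0" for n
    using u0[of n] by (auto simp: w_def)
  have ulim: "u \<longlonglongrightarrow> 1"
    unfolding u_def using tendsto_add[OF tendsto_const LIMSEQ_inverse_real_of_nat, of 1] by (simp add: inverse_eq_divide)
  have wlim: "w \<longlonglongrightarrow> 0"
  proof -
    have "w \<longlonglongrightarrow> (1 - of_real 1)\<^sup>2 / of_real 1"
      unfolding w_def by (intro tendsto_intros ulim) auto
    then show ?thesis by simp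
  qed
  define P where "P = (\<lambda>a v. \<Prod>j. 1 - v * koebe (a * q ^ j))"
  have qq: "q * q ^ j \<noteq> 1" for j
    using power_Suc_neq_1[OF q(2), of j] by simp
  have fac: "theta (z * of_real (u n)) q * theta (z / of_real (u n)) q = (theta z q)\<^sup>2 * (P z (w n) * P (q / z) (w n))"
    if "z \<noteq> 0" "\<And>j. z * q ^ j \<noteq> 1" "\<And>j. q / z * q ^ j \<noteq> 1" for z n
  proof -
    have "theta (z * of_real (u n)) q * theta (z / of_real (u n)) q
      = (qpoch (z * of_real (u n)) q * qpoch (z / of_real (u n)) q) * (qpoch (q / z * of_real (u n)) q * qpoch (q / z / of_real (u n)) q)"
      using that(1) u0 by (simp add: theta_def mult_ac)
    also have "\<dots> = ((qpoch z q)\<^sup>2 * P z (w n)) * ((qpoch (q / z) q)\<^sup>2 * P (q / z) (w n))"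
      unfolding P_def w_def using that u0 q by (subst (1 2) qpoch_mult_qpoch) auto
    finally show ?thesis
      by (simp add: theta_def power_mult_distrib mult_ac)
  qed
  define T where "T = (\<lambda>x y. theta (x * y) q * theta (x / y) q)"
  have Tu: "(theta (of_real (u n)) q)\<^sup>2 = of_real (u n) * w n * (qpoch q q ^ 4 * (P q (w n))\<^sup>2)" for n
  proof -
    have "theta (of_real (u n)) q = (1 - of_real (u n)) * (qpoch (q * of_real (u n)) q * qpoch (q / of_real (u n)) q)"
      unfolding theta_def by (subst qpoch_rec[OF q(2)]) (simp add: mult_ac)
    also have "qpoch (q * of_real (u n)) q * qpoch (q / of_real (u n)) q = (qpoch q q)\<^sup>2 * P q (w n)"
      unfolding P_def w_def by (rule qpoch_mult_qpoch[OF q(2) qq u0(1)])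
    finally have "(theta (of_real (u n)) q)\<^sup>2 = (1 - of_real (u n))\<^sup>2 * (((qpoch q q)\<^sup>2)\<^sup>2 * (P q (w n))\<^sup>2)"
      by (simp add: power_mult_distrib)
    also have "(1 - of_real (u n))\<^sup>2 = of_real (u n) * w n"
      using u0[of n] by (simp add: w_def)
    finally show ?thesis by simp
  qed
  have main: "y * T x y * (qpoch q q ^ 4 * (P q (w n))\<^sup>2)
      = ((P x (w n) * P (q / x) (w n) - 1) / w n - (P y (w n) * P (q / y) (w n) - 1) / w n) * ((theta x q)\<^sup>2 * (theta y q)\<^sup>2)" for n
  proof -
    define U where "U = (of_real (u n) :: 'a)"
    have "y * T x y * T U 1 = U * (T x U * T y 1 - T x 1 * T y U)"
      unfolding T_def U_def using q xy u0 by (intro theta_three_term) auto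
    moreover have "T U 1 = U * w n * (qpoch q q ^ 4 * (P q (w n))\<^sup>2)"
      using Tu[of n] by (simp add: T_def U_def power2_eq_square)
    moreover have "T x U = (theta x q)\<^sup>2 * (P x (w n) * P (q / x) (w n))" "T y U = (theta y q)\<^sup>2 * (P y (w n) * P (q / y) (w n))"
      unfolding T_def U_def using fac xy x y by auto
    moreover have "T x 1 = (theta x q)\<^sup>2" "T y 1 = (theta y q)\<^sup>2"
      by (simp_all add: T_def power2_eq_square)
    ultimately have "U * (w n * (y * T x y * (qpoch q q ^ 4 * (P q (w n))\<^sup>2)))
      = U * ((P x (w n) * P (q / x) (w n) - P y (w n) * P (q / y) (w n)) * ((theta x q)\<^sup>2 * (theta y q)\<^sup>2))"
      by (simp add: algebra_simps)
    then have "w n * (y * T x y * (qpoch q q ^ 4 * (P q (w n))\<^sup>2))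
      = (P x (w n) * P (q / x) (w n) - P y (w n) * P (q / y) (w n)) * ((theta x q)\<^sup>2 * (theta y q)\<^sup>2)"
      using u0[of n] by (simp add: U_def)
    then have "y * T x y * (qpoch q q ^ 4 * (P q (w n))\<^sup>2)
      = (P x (w n) * P (q / x) (w n) - P y (w n) * P (q / y) (w n)) / w n * ((theta x q)\<^sup>2 * (theta y q)\<^sup>2)"
      using w0[of n] by (simp add: nonzero_eq_divide_eq mult_ac)
    then show ?thesis
      by (simp add: diff_divide_distrib)
  qed
  have lim1: "(\<lambda>n. P a (w n)) \<longlonglongrightarrow> 1" if "\<And>j. a * q ^ j \<noteq> 1" for a
    unfolding P_def by (intro prodinf_one_minus_tendsto_1 summable_koebe q that wlim w0)
  have lim2: "(\<lambda>n. (P a (w n) - 1) / w n) \<longlonglongrightarrow> - (\<Sum>j. koebe (a * q ^ j))" if "\<And>j. a * q ^ j \<noteq> 1" for a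
    unfolding P_def by (intro prodinf_one_minus_deriv summable_koebe q that wlim w0)
  have lim: "(\<lambda>n. (P z (w n) * P (q / z) (w n) - 1) / w n) \<longlonglongrightarrow> - wp z q"
    if "\<And>j. z * q ^ j \<noteq> 1" "\<And>j. q / z * q ^ j \<noteq> 1" for z
  proof -
    \<comment> \<open>The product rule in the form
      \<open>(A B - 1) / w = (A - 1) / w * B + (B - 1) / w\<close>.\<close>
    have "(\<lambda>n. (P z (w n) - 1) / w n * P (q / z) (w n) + (P (q / z) (w n) - 1) / w n)
        \<longlonglongrightarrow> - (\<Sum>j. koebe (z * q ^ j)) * 1 + - (\<Sum>j. koebe (q / z * q ^ j))"
      by (intro tendsto_add tendsto_mult lim1 lim2 that)
    moreover have "(P z (w n) - 1) / w n * P (q / z) (w n) + (P (q / z) (w n) - 1) / w n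
        = (P z (w n) * P (q / z) (w n) - 1) / w n" for n
      using w0[of n] by (simp add: divide_simps) (simp add: algebra_simps)
    ultimately show ?thesis
      by (simp add: wp_def)
  qed
  have "(\<lambda>n. y * T x y * (qpoch q q ^ 4 * (P q (w n))\<^sup>2)) \<longlonglongrightarrow> y * T x y * (qpoch q q ^ 4 * 1\<^sup>2)"
    by (intro tendsto_mult tendsto_power tendsto_const lim1 qq)
  moreover have "(\<lambda>n. y * T x y * (qpoch q q ^ 4 * (P q (w n))\<^sup>2)) \<longlonglongrightarrow> (- wp x q - - wp y q) * ((theta x q)\<^sup>2 * (theta y q)\<^sup>2)"
    unfolding main by (intro tendsto_mult tendsto_diff tendsto_const lim x y)
  ultimately have "y * T x y * (qpoch q q ^ 4 * 1\<^sup>2) = (- wp x q - - wp y q) * ((theta x q)\<^sup>2 * (theta y q)\<^sup>2)"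
    by (rule LIMSEQ_unique)
  then show ?thesis
    by (simp add: T_def mult_ac)
qed

subsection \<open>A Lambert series of level 5\<close>

definition legendre5 :: "nat \<Rightarrow> real" where
  "legendre5 n = (if n mod 5 \<in> {1, 4} then 1 else if n mod 5 \<in> {2, 3} then - 1 else 0)"

lemma abs_legendre5_le: "\<bar>legendre5 n\<bar> \<le> 1"
  by (simp add: legendre5_def)

lemma koebe_sums:
  fixes z :: "'a::{real_normed_field,banach}"
  assumes "norm z < 1"
  shows "(\<lambda>n. of_nat n * z ^ n) sums koebe z"
proof -
  have "(\<lambda>n. z * (of_nat (Suc n) * z ^ n)) sums (z * (1 / (1 - z)\<^sup>2))"
    by (intro sums_mult geometric_deriv_sums assms)
  then have "(\<lambda>n. of_nat (Suc n) * z ^ Suc n) sums koebe z"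
    by (simp add: koebe_def mult_ac)
  then show ?thesis
    by (subst (asm) sums_Suc_iff) simp
qed

section \<open>Fifth roots of unity and the quadratic Gauss sum\<close>

text \<open>The root stays abstract: its choice affects only the sign of \<open>gauss\<close>, and
  the final formula contains only the square of \<open>gauss\<close>.\<close>

locale fifth_root =
  fixes z :: complex
  assumes z5: "z ^ 5 = 1" and z_neq_1: "z \<noteq> 1"
begin

lemma sum0: "1 + z + z ^ 2 + z ^ 3 + z ^ 4 = 0"
proof -
  have "(z - 1) * (1 + z + z ^ 2 + z ^ 3 + z ^ 4) = z ^ 5 - 1"
    by (simp add: algebra_simps eval_nat_numeral)
  then show ?thesis using z5 z_neq_1 by simp
qed

definition gauss :: complex where "gauss = z - z ^ 2 - z ^ 3 + z ^ 4"

lemma periods: "(z + z ^ 4) + (z ^ 2 + z ^ 3) = - 1" "(z + z ^ 4) * (z ^ 2 + z ^ 3) = - 1"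
proof -
  show 1: "(z + z ^ 4) + (z ^ 2 + z ^ 3) = - 1"
    using sum0 by algebra
  have "(z + z ^ 4) * (z ^ 2 + z ^ 3) = z ^ 3 + z ^ 4 + z ^ 5 * z + z ^ 5 * z ^ 2"
    by (simp add: algebra_simps eval_nat_numeral)
  then show "(z + z ^ 4) * (z ^ 2 + z ^ 3) = - 1"
    using 1 by (simp add: z5 algebra_simps)
qed

lemma gauss_square: "gauss * gauss = 5"
proof -
  have "(u - v) * (u - v) = (u + v)\<^sup>2 - 4 * (u * v)" for u v :: complex
    by (simp add: power2_eq_square algebra_simps)
  from this[of "z + z ^ 4" "z ^ 2 + z ^ 3"] show ?thesis
    unfolding periods by (simp add: gauss_def algebra_simps)
qed

lemma gauss_nonzero: "gauss \<noteq> 0"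
  using gauss_square by auto

lemma z_nonzero: "z \<noteq> 0"
  using z5 by auto

lemma norm_z: "norm z = 1"
  using power_eq_1_iff[OF z5] by simp

lemma z2_neq_1: "z ^ 2 \<noteq> 1"
proof
  assume h: "z ^ 2 = 1"
  have "z = 1" using z5 h by algebra
  then show False using z_neq_1 by simp
qed

text \<open>These are the terms of exponent 0 in the two Weierstrass values; they produce the
  constant 1 of the Lambert identity.\<close>

lemma koebe_z: "koebe (z ^ 2) - koebe z = 1 / gauss"
proof -
  have "gauss * (z ^ 2 * (1 - z)\<^sup>2 - z * (1 - z ^ 2)\<^sup>2) = (1 - z ^ 2)\<^sup>2 * (1 - z)\<^sup>2"
    unfolding gauss_def using sum0 z5 by algebra
  moreover have "(1 - z ^ 2)\<^sup>2 * (1 - z)\<^sup>2 \<noteq> 0"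
    using z_neq_1 z2_neq_1 by auto
  ultimately show ?thesis
    using z_neq_1 z2_neq_1 gauss_nonzero by (simp add: koebe_def divide_simps mult_ac)
qed

lemma gauss_sum: "z ^ n - (z ^ 2) ^ n - (z ^ 3) ^ n + (z ^ 4) ^ n = gauss * of_real (legendre5 n)"
proof -
  define r where "r = n mod 5"
  have "z ^ n = z ^ (5 * (n div 5) + r)"
    by (simp add: r_def)
  also have "\<dots> = z ^ r"
    using z5 by (simp add: power_add power_mult)
  finally have v: "z ^ n = z ^ r" .
  have sw: "(z ^ i) ^ n = (z ^ n) ^ i" for i
    by (simp add: mult.commute flip: power_mult)
  have "r < 5" by (simp add: r_def)
  then consider "r = 0" | "r = 1" | "r = 2" | "r = 3" | "r = 4" by linarith
  then show ?thesis
  proof cases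
    case 1
    then show ?thesis unfolding sw v by (simp add: legendre5_def r_def)
  next
    case 2
    then show ?thesis unfolding sw v by (simp add: legendre5_def r_def gauss_def)
  next
    case 3
    have "z ^ 2 - (z ^ 2) ^ 2 - (z ^ 2) ^ 3 + (z ^ 2) ^ 4 = - (z - z ^ 2 - z ^ 3 + z ^ 4)"
      using z5 by algebra
    with 3 show ?thesis unfolding sw v by (simp add: legendre5_def r_def gauss_def)
  next
    case 4
    have "z ^ 3 - (z ^ 3) ^ 2 - (z ^ 3) ^ 3 + (z ^ 3) ^ 4 = - (z - z ^ 2 - z ^ 3 + z ^ 4)"
      using z5 by algebra
    with 4 show ?thesis unfolding sw v by (simp add: legendre5_def r_def gauss_def)
  next
    case 5
    have "z ^ 4 - (z ^ 4) ^ 2 - (z ^ 4) ^ 3 + (z ^ 4) ^ 4 = z - z ^ 2 - z ^ 3 + z ^ 4"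
      using z5 by algebra
    with 5 show ?thesis unfolding sw v by (simp add: legendre5_def r_def gauss_def)
  qed
qed

lemma prod_roots: "(1 - x) * (1 - z * x) * (1 - z ^ 2 * x) * (1 - z ^ 3 * x) * (1 - z ^ 4 * x) = 1 - x ^ 5"
proof -
  define A B where AB: "A = z + z ^ 4" "B = z ^ 2 + z ^ 3"
  have "(1 - z * x) * (1 - z ^ 4 * x) = 1 - A * x + z ^ 5 * x\<^sup>2" "(1 - z ^ 2 * x) * (1 - z ^ 3 * x) = 1 - B * x + z ^ 5 * x\<^sup>2"
    by (simp_all add: AB algebra_simps eval_nat_numeral)
  then have "(1 - x) * (1 - z * x) * (1 - z ^ 2 * x) * (1 - z ^ 3 * x) * (1 - z ^ 4 * x)
      = (1 - x) * ((1 - A * x + x\<^sup>2) * (1 - B * x + x\<^sup>2))"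
    unfolding z5 by (simp add: mult_ac)
  also have "(1 - A * x + x\<^sup>2) * (1 - B * x + x\<^sup>2) = 1 - (A + B) * x + (2 + A * B) * x\<^sup>2 - (A + B) * x ^ 3 + x ^ 4"
    by (simp add: algebra_simps eval_nat_numeral)
  also have "\<dots> = 1 + x + x\<^sup>2 + x ^ 3 + x ^ 4"
    unfolding AB periods by simp
  also have "(1 - x) * \<dots> = 1 - x ^ 5"
    by (simp add: algebra_simps eval_nat_numeral)
  finally show ?thesis .
qed

lemma qpoch_roots:
  assumes "norm q < 1"
  shows "qpoch q q * qpoch (z * q) q * qpoch (z ^ 2 * q) q * qpoch (z ^ 3 * q) q * qpoch (z ^ 4 * q) q = qpoch (q ^ 5) (q ^ 5)"
proof -
  have "(\<lambda>n. (\<Prod>j<n. 1 - q * q ^ j) * (\<Prod>j<n. 1 - z * q * q ^ j) * (\<Prod>j<n. 1 - z ^ 2 * q * q ^ j)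
      * (\<Prod>j<n. 1 - z ^ 3 * q * q ^ j) * (\<Prod>j<n. 1 - z ^ 4 * q * q ^ j))
    \<longlonglongrightarrow> qpoch q q * qpoch (z * q) q * qpoch (z ^ 2 * q) q * qpoch (z ^ 3 * q) q * qpoch (z ^ 4 * q) q"
    by (intro tendsto_mult qpoch_LIMSEQ assms)
  moreover have "(\<Prod>j<n. 1 - q * q ^ j) * (\<Prod>j<n. 1 - z * q * q ^ j) * (\<Prod>j<n. 1 - z ^ 2 * q * q ^ j)
      * (\<Prod>j<n. 1 - z ^ 3 * q * q ^ j) * (\<Prod>j<n. 1 - z ^ 4 * q * q ^ j) = (\<Prod>j<n. 1 - q ^ 5 * (q ^ 5) ^ j)" for n
  proof -
    have "(q * q ^ j) ^ 5 = q ^ 5 * (q ^ 5) ^ j" for j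
      by (simp add: power_mult_distrib mult.commute flip: power_mult)
    then show ?thesis
      unfolding prod.distrib[symmetric] using prod_roots[of "q * q ^ j" for j] by (intro prod.cong) (simp_all add: mult.assoc)
  qed
  ultimately have "(\<lambda>n. \<Prod>j<n. 1 - q ^ 5 * (q ^ 5) ^ j)
    \<longlonglongrightarrow> qpoch q q * qpoch (z * q) q * qpoch (z ^ 2 * q) q * qpoch (z ^ 3 * q) q * qpoch (z ^ 4 * q) q"
    by simp
  then show ?thesis
    using assms by (intro qpoch_eqI[symmetric]) (auto simp: norm_power power_less_one_iff)
qed

text \<open>At \<open>x = z\<close> and \<open>y = z^2\<close> the values at
  \<open>x y = z^(-2)\<close> and \<open>x / y = z^(-1)\<close> are again those at
  \<open>z^2\<close> and z up to elementary factors, so half of the theta factors cancel. The rest,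
  multiplied by \<open>qpoch q q\<close>, runs over all fifth roots of unity and collapses to base
  \<open>q^5\<close>.\<close>

lemma wp_z:
  fixes q :: complex
  assumes "q \<noteq> 0" "norm q < 1"
  shows "qpoch q q ^ 5 = (wp (z ^ 2) q - wp z q) * gauss * qpoch (q ^ 5) (q ^ 5)"
proof -
  have ne: "x * q ^ j \<noteq> 1" if "norm x = 1" "x \<noteq> 1" for x j
  proof (cases j)
    case (Suc i)
    have "norm (x * q ^ j) < 1"
      using assms that Suc by (simp add: norm_mult norm_power power_less_one_iff del: power_Suc)
    then show ?thesis by auto
  qed (use that in auto)
  have ne': "q / x * q ^ j \<noteq> 1" if "norm x = 1" for x j
  proof -
    have "norm (q / x * q ^ j) = norm q ^ Suc j"
      using that by (simp add: norm_mult norm_divide norm_power)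
    then have "norm (q / x * q ^ j) < 1"
      using assms by (simp add: power_less_one_iff del: power_Suc)
    then show ?thesis by auto
  qed
  have n2: "norm (z ^ 2) = 1"
    by (simp add: norm_power norm_z)
  have inv: "q / z = z ^ 4 * q" "q / z ^ 2 = z ^ 3 * q"
    using z5 z_nonzero by (simp_all add: field_simps eval_nat_numeral)
  have th1: "theta z q = (1 - z) * (qpoch (z * q) q * qpoch (z ^ 4 * q) q)"
    unfolding theta_def inv by (subst qpoch_rec[OF assms(2)]) simp
  have th2: "theta (z ^ 2) q = (1 - z ^ 2) * (qpoch (z ^ 2 * q) q * qpoch (z ^ 3 * q) q)"
    unfolding theta_def inv by (subst qpoch_rec[OF assms(2)]) simp
  have nz: "theta z q \<noteq> 0" "theta (z ^ 2) q \<noteq> 0"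
    unfolding theta_def
    using qpoch_nonzero[OF assms(2) ne[OF norm_z z_neq_1]] qpoch_nonzero[OF assms(2) ne'[OF norm_z]]
      qpoch_nonzero[OF assms(2) ne[OF n2 z2_neq_1]] qpoch_nonzero[OF assms(2) ne'[OF n2]] by simp_all
  have thprod: "theta z q * theta (z ^ 2) q * qpoch q q = (1 - z) * (1 - z ^ 2) * qpoch (q ^ 5) (q ^ 5)"
    unfolding th1 th2 qpoch_roots[OF assms(2), symmetric] by simp
  have h1: "theta (z * z ^ 2) q = - theta (z ^ 2) q / z ^ 2"
  proof -
    have "z * z ^ 2 = 1 / z ^ 2"
      using z5 z_nonzero by (simp add: field_simps eval_nat_numeral)
    then show ?thesis using theta_inverse[OF assms(2), of "z ^ 2"] z_nonzero by simp
  qed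
  have h2: "theta (z / z ^ 2) q = - theta z q / z"
  proof -
    have "z / z ^ 2 = 1 / z"
      using z_nonzero by (simp add: field_simps eval_nat_numeral)
    then show ?thesis using theta_inverse[OF assms(2), of z] z_nonzero by simp
  qed
  have h3: "z ^ 2 * qpoch q q ^ 4 * (theta (z * z ^ 2) q * theta (z / z ^ 2) q) = (wp (z ^ 2) q - wp z q) * ((theta z q)\<^sup>2 * (theta (z ^ 2) q)\<^sup>2)"
    using assms z_nonzero ne[OF norm_z z_neq_1] ne'[OF norm_z] ne[OF n2 z2_neq_1] ne'[OF n2] by (intro wp_difference) auto
  have "(theta z q * theta (z ^ 2) q) * qpoch q q ^ 4 = (theta z q * theta (z ^ 2) q) * ((wp (z ^ 2) q - wp z q) * z * (theta z q * theta (z ^ 2) q))"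
    using h3 unfolding h1 h2 using z_nonzero by (simp add: field_simps power2_eq_square)
  then have "qpoch q q ^ 4 = (wp (z ^ 2) q - wp z q) * z * (theta z q * theta (z ^ 2) q)"
    using nz by simp
  then have "qpoch q q ^ 5 = (wp (z ^ 2) q - wp z q) * z * (theta z q * theta (z ^ 2) q * qpoch q q)"
    by (simp add: eval_nat_numeral)
  also have "\<dots> = (wp (z ^ 2) q - wp z q) * (z * ((1 - z) * (1 - z ^ 2))) * qpoch (q ^ 5) (q ^ 5)"
    unfolding thprod by simp
  also have "z * ((1 - z) * (1 - z ^ 2)) = gauss"
    by (simp add: gauss_def algebra_simps eval_nat_numeral)
  finally show ?thesis .
qed

text \<open>Expanding each \<open>koebe\<close> value as a power series turns the combination of the
  four roots into a Gauss sum, that is, into \<open>gauss\<close> times the Legendre symbol.\<close>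

lemma lambert_sums_aux:
  fixes q :: real
  assumes "0 < q" "q < 1"
  shows "(\<lambda>j. \<Sum>n. legendre5 n * (real n * (q ^ Suc j) ^ n)) sums ((1 - euler_E q ^ 5 / euler_E (q ^ 5)) / 5)"
proof -
  define Q where "Q = complex_of_real q"
  have Q: "Q \<noteq> 0" "norm Q < 1"
    using assms by (auto simp: Q_def)
  have ne: "x * Q * Q ^ j \<noteq> 1" and lt: "norm (x * Q * Q ^ j) < 1" if "norm x = 1" for x j
  proof -
    have "norm (x * Q * Q ^ j) = norm Q ^ Suc j"
      using that by (simp add: norm_mult norm_power)
    then show "norm (x * Q * Q ^ j) < 1"
      using Q by (simp add: power_less_one_iff del: power_Suc)
    then show "x * Q * Q ^ j \<noteq> 1" by auto
  qed
  have nz: "norm (z ^ i) = 1" for i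
    by (simp add: norm_power norm_z)
  define S where "S i = (\<Sum>j. koebe (z ^ i * Q * Q ^ j))" for i
  have S: "(\<lambda>j. koebe (z ^ i * Q * Q ^ j)) sums S i" for i
    unfolding S_def by (intro summable_sums summable_norm_cancel[OF summable_koebe] Q ne nz)
  have inv: "Q / z = z ^ 4 * Q" "Q / z ^ 2 = z ^ 3 * Q"
    using z5 z_nonzero by (simp_all add: field_simps eval_nat_numeral)
  \<comment> \<open>The first half of \<open>wp\<close> starts at exponent 0 and the second at 1;
    splitting off the initial term puts all sums into the form \<open>S i\<close>.\<close>
  have head: "(\<Sum>j. koebe (z ^ i * Q ^ j)) = koebe (z ^ i) + S i" for i
  proof -
    have "(\<lambda>j. koebe (z ^ i * Q ^ Suc j)) sums S i"
      using S[of i] by (simp add: mult.assoc)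
    then have "(\<lambda>j. koebe (z ^ i * Q ^ j)) sums (S i + koebe (z ^ i * Q ^ 0))"
      by (rule sums_Suc)
    then show ?thesis by (simp add: sums_iff add.commute)
  qed
  have rho1: "wp z Q = koebe z + S 1 + S 4"
    using head[of 1] unfolding wp_def inv by (simp add: S_def)
  have rho2: "wp (z ^ 2) Q = koebe (z ^ 2) + S 2 + S 3"
    using head[of 2] unfolding wp_def inv by (simp add: S_def)
  define R where "R j = (\<Sum>n. legendre5 n * (real n * (q ^ Suc j) ^ n))" for j
  have R: "koebe (z ^ 1 * Q * Q ^ j) - koebe (z ^ 2 * Q * Q ^ j) - koebe (z ^ 3 * Q * Q ^ j) + koebe (z ^ 4 * Q * Q ^ j) = gauss * of_real (R j)" for j
  proof -
    define X where "X = Q * Q ^ j"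
    have "(\<lambda>n. of_nat n * (z ^ 1 * Q * Q ^ j) ^ n - of_nat n * (z ^ 2 * Q * Q ^ j) ^ n
        - of_nat n * (z ^ 3 * Q * Q ^ j) ^ n + of_nat n * (z ^ 4 * Q * Q ^ j) ^ n)
      sums (koebe (z ^ 1 * Q * Q ^ j) - koebe (z ^ 2 * Q * Q ^ j) - koebe (z ^ 3 * Q * Q ^ j) + koebe (z ^ 4 * Q * Q ^ j))"
      by (intro sums_add sums_diff koebe_sums lt nz)
    moreover have "of_nat n * (z ^ 1 * Q * Q ^ j) ^ n - of_nat n * (z ^ 2 * Q * Q ^ j) ^ n
        - of_nat n * (z ^ 3 * Q * Q ^ j) ^ n + of_nat n * (z ^ 4 * Q * Q ^ j) ^ n
        = gauss * of_real (legendre5 n * (real n * (q ^ Suc j) ^ n))" for n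
    proof -
      have "of_nat n * (z ^ 1 * Q * Q ^ j) ^ n - of_nat n * (z ^ 2 * Q * Q ^ j) ^ n
        - of_nat n * (z ^ 3 * Q * Q ^ j) ^ n + of_nat n * (z ^ 4 * Q * Q ^ j) ^ n
        = of_nat n * X ^ n * (z ^ n - (z ^ 2) ^ n - (z ^ 3) ^ n + (z ^ 4) ^ n)"
        unfolding X_def mult.assoc[of _ Q] power_mult_distrib[of "z ^ _"] by (simp add: algebra_simps)
      also have "\<dots> = gauss * of_real (legendre5 n * (real n * (q ^ Suc j) ^ n))"
        unfolding gauss_sum by (simp add: X_def Q_def)
      finally show ?thesis .
    qed
    ultimately have *: "(\<lambda>n. gauss * of_real (legendre5 n * (real n * (q ^ Suc j) ^ n)))
      sums (koebe (z ^ 1 * Q * Q ^ j) - koebe (z ^ 2 * Q * Q ^ j) - koebe (z ^ 3 * Q * Q ^ j) + koebe (z ^ 4 * Q * Q ^ j))"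
      by simp
    have "norm (q ^ Suc j) < 1"
      using assms by (simp add: power_less_one_iff del: power_Suc)
    from koebe_sums[OF this] have "summable (\<lambda>n. real n * (q ^ Suc j) ^ n)"
      by (rule sums_summable)
    then have "summable (\<lambda>n. legendre5 n * (real n * (q ^ Suc j) ^ n))"
    proof (rule summable_comparison_test')
      show "norm (legendre5 n * (real n * (q ^ Suc j) ^ n)) \<le> real n * (q ^ Suc j) ^ n" for n
        using abs_legendre5_le[of n] assms by (simp add: abs_mult mult_left_le_one_le)
    qed
    then have "(\<lambda>n. gauss * of_real (legendre5 n * (real n * (q ^ Suc j) ^ n))) sums (gauss * of_real (R j))"
      unfolding R_def by (intro sums_mult sums_of_real summable_sums)
    with * show ?thesis by (rule sums_unique2)
  qed
  \<comment> \<open>The additional factor \<open>gauss\<close> creates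
    \<open>gauss * gauss = 5\<close>, which makes both sides real and free of the choice of
    root.\<close>
  have "(\<lambda>j. gauss * (koebe (z ^ 1 * Q * Q ^ j) - koebe (z ^ 2 * Q * Q ^ j) - koebe (z ^ 3 * Q * Q ^ j) + koebe (z ^ 4 * Q * Q ^ j)))
     sums (gauss * (S 1 - S 2 - S 3 + S 4))"
    by (intro sums_mult sums_add sums_diff S)
  then have "(\<lambda>j. gauss * gauss * of_real (R j)) sums (gauss * (S 1 - S 2 - S 3 + S 4))"
    unfolding R by (simp add: mult.assoc)
  also have "gauss * (S 1 - S 2 - S 3 + S 4) = gauss * (1 / gauss - (wp (z ^ 2) Q - wp z Q))"
    unfolding rho1 rho2 koebe_z[symmetric] by simp
  also have "\<dots> = 1 - (wp (z ^ 2) Q - wp z Q) * gauss"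
    using gauss_nonzero by (simp add: algebra_simps)
  also have "(wp (z ^ 2) Q - wp z Q) * gauss = of_real (euler_E q ^ 5 / euler_E (q ^ 5))"
  proof -
    have "qpoch Q Q = of_real (euler_E q)"
      unfolding Q_def euler_E_eq_qpoch using assms by (intro qpoch_of_real) auto
    moreover have "qpoch (Q ^ 5) (Q ^ 5) = of_real (euler_E (q ^ 5))"
      unfolding Q_def euler_E_eq_qpoch of_real_power[symmetric] using assms by (intro qpoch_of_real) (auto simp: power_less_one_iff)
    moreover have "euler_E (q ^ 5) \<noteq> 0"
      using euler_E_pos[of "q ^ 5"] assms by (simp add: power_less_one_iff)
    ultimately show ?thesis
      using wp_z[OF Q] by (simp add: field_simps)
  qed
  finally have "(\<lambda>j. of_real (5 * R j)) sums (of_real (1 - euler_E q ^ 5 / euler_E (q ^ 5)) :: complex)"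
    by (simp add: gauss_square)
  then have "(\<lambda>j. 5 * R j) sums (1 - euler_E q ^ 5 / euler_E (q ^ 5))"
    by (simp only: sums_of_real_iff)
  from sums_divide[OF this, of 5] show ?thesis
    unfolding R_def by simp
qed

end

interpretation fr5: fifth_root "cis (2 * pi / 5)"
proof
  show "cis (2 * pi / 5) ^ 5 = 1"
    by (simp add: Complex.DeMoivre)
  have "cos (2 * pi / 5) < cos 0"
    by (rule cos_monotone_0_pi) (auto simp: pi_gt_zero)
  then show "cis (2 * pi / 5) \<noteq> 1"
    by (auto simp: complex_eq_iff)
qed

text \<open>Exchange the summations and sum the geometric series over j. Absolute convergence
  follows by comparison with the \<open>koebe\<close> series.\<close>

lemma lambert_identity:
  fixes q :: real
  assumes "0 < q" "q < 1"
  shows "(\<lambda>n. legendre5 n * real n * q ^ n / (1 - q ^ n)) sums ((1 - euler_E q ^ 5 / euler_E (q ^ 5)) / 5)"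
proof -
  define f where "f = (\<lambda>(j, n). legendre5 n * (real n * (q ^ Suc j) ^ n))"
  define L where "L = (1 - euler_E q ^ 5 / euler_E (q ^ 5)) / 5"
  have X: "0 < q ^ Suc j" "q ^ Suc j < 1" for j
    using assms by (auto simp: power_less_one_iff simp del: power_Suc)
  have nn: "((\<lambda>n. real n * (q ^ Suc j) ^ n) has_sum koebe (q ^ Suc j)) UNIV" for j
    using X[of j] less_imp_le by (intro sums_nonneg_imp_has_sum koebe_sums) auto
  have "(\<lambda>(j, n). real n * (q ^ Suc j) ^ n) summable_on UNIV \<times> UNIV"
  proof (rule summable_on_SigmaI)
    show "((\<lambda>n. case (j, n) of (j, n) \<Rightarrow> real n * (q ^ Suc j) ^ n) has_sum koebe (q ^ Suc j)) UNIV" for j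
      using nn[of j] by simp
    have "q * q ^ j \<noteq> 1" for j
      using X(2)[of j] by simp
    then have "summable (\<lambda>j. norm (koebe (q * q ^ j)))"
      using assms by (intro summable_koebe) auto
    then have "(\<lambda>j. koebe (q * q ^ j)) summable_on UNIV"
      by (rule norm_summable_imp_summable_on)
    then show "(\<lambda>j. koebe (q ^ Suc j)) summable_on UNIV" by simp
  qed (use assms in auto)
  then have "(\<lambda>p. norm (f p)) summable_on UNIV \<times> UNIV"
  proof (rule summable_on_comparison_test)
    show "norm (f p) \<le> (case p of (j, n) \<Rightarrow> real n * (q ^ Suc j) ^ n)" for p
      using abs_legendre5_le[of "snd p"] assms by (auto simp: f_def case_prod_unfold abs_mult mult_left_le_one_le)
  qed auto
  then have f: "f summable_on UNIV \<times> UNIV"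
    by (rule abs_summable_summable)
  then obtain S where S: "(f has_sum S) (UNIV \<times> UNIV)"
    by (auto simp: summable_on_def)
  have "((\<lambda>j. \<Sum>n. legendre5 n * (real n * (q ^ Suc j) ^ n)) has_sum S) UNIV"
  proof (rule has_sum_SigmaD[OF S])
    fix j
    have "(\<lambda>n. f (j, n)) summable_on UNIV"
      using summable_on_SigmaD1[of "\<lambda>j n. f (j, n)" UNIV "\<lambda>_. UNIV" j] f by simp
    then show "((\<lambda>n. f (j, n)) has_sum (\<Sum>n. legendre5 n * (real n * (q ^ Suc j) ^ n))) UNIV"
      using has_sum_imp_sums[of "\<lambda>n. f (j, n)"] by (auto simp: f_def has_sum_iff sums_iff)
  qed
  then have "(\<lambda>j. \<Sum>n. legendre5 n * (real n * (q ^ Suc j) ^ n)) sums S"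
    by (rule has_sum_imp_sums)
  moreover have "(\<lambda>j. \<Sum>n. legendre5 n * (real n * (q ^ Suc j) ^ n)) sums L"
    unfolding L_def by (rule fr5.lambert_sums_aux[OF assms])
  ultimately have "S = L" by (rule sums_unique2)
  have "((\<lambda>n. legendre5 n * real n * q ^ n / (1 - q ^ n)) has_sum S) UNIV"
  proof (rule has_sum_SigmaD[OF has_sum_swap[THEN iffD1, OF S]])
    fix n :: nat
    show "((\<lambda>j. case (n, j) of (x, y) \<Rightarrow> f (y, x)) has_sum legendre5 n * real n * q ^ n / (1 - q ^ n)) UNIV"
    \<comment> \<open>For \<open>n = 0\<close> the denominator vanishes; the factor n makes both
      sides 0.\<close>
    proof (cases "n = 0")
      case False
      have "0 < q ^ n" "q ^ n < 1"
        using assms False by (auto simp: power_less_one_iff)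
      then have "(\<lambda>j. q ^ n * (q ^ n) ^ j) sums (q ^ n * (1 / (1 - q ^ n)))"
        by (intro sums_mult geometric_sums) auto
      then have "((\<lambda>j. q ^ n * (q ^ n) ^ j) has_sum (q ^ n * (1 / (1 - q ^ n)))) UNIV"
        using \<open>0 < q ^ n\<close> by (intro sums_nonneg_imp_has_sum) auto
      then have "((\<lambda>j. legendre5 n * real n * (q ^ n * (q ^ n) ^ j)) has_sum (legendre5 n * real n * (q ^ n * (1 / (1 - q ^ n))))) UNIV"
        by (rule has_sum_cmult_right)
      moreover have "(q ^ Suc j) ^ n = q ^ n * (q ^ n) ^ j" for j
        by (simp add: power_mult_distrib mult.commute flip: power_mult)
      ultimately show ?thesis
        by (simp add: f_def mult.assoc)
    qed (simp add: f_def)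
  qed
  then show ?thesis
    unfolding \<open>S = L\<close> L_def by (rule has_sum_imp_sums)
qed

subsection \<open>The logarithmic derivative of Ramanujan's function k\<close>

text \<open>The logarithm of $q^{-1/5} r(q)$, where $r$ is the Rogers-Ramanujan continued fraction; $k(q) = r(q) r(q^2)^2$.\<close>

definition ln_rr :: "real \<Rightarrow> real" where
  "ln_rr q = (\<Sum>n. legendre5 n * ln (1 - q ^ n))"

lemma legendre5_0 [simp]: "legendre5 0 = 0"
  by (simp add: legendre5_def)

text \<open>Termwise differentiation, the differentiated terms being dominated by
  \<open>n r^(n-1) / (1 - r)\<close> on the whole interval. The interval includes 0 because
  continuity of k at the lower limit of integration is needed.\<close>

lemma ln_rr_sums_deriv:
  assumes r: "0 < r" "r < 1" and x: "x \<in> {0..r}"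
  shows "(\<lambda>n. legendre5 n * ln (1 - x ^ n)) sums ln_rr x"
    and "(ln_rr has_real_derivative (\<Sum>n. - (legendre5 n * real n * x ^ (n - 1) / (1 - x ^ n)))) (at x within {0..r})"
proof -
  define f' where "f' n x = - (legendre5 n * real n * x ^ (n - 1) / (1 - x ^ n))" for n and x :: real
  have "\<exists>g. \<forall>x\<in>{0..r}. (\<lambda>n. legendre5 n * ln (1 - x ^ n)) sums g x \<and> (g has_field_derivative (\<Sum>n. f' n x)) (at x within {0..r})"
  proof (rule has_field_derivative_series)
    show "((\<lambda>x. legendre5 n * ln (1 - x ^ n)) has_field_derivative f' n x) (at x within {0..r})" if "x \<in> {0..r}" for n x
    proof (cases "n = 0")
      case False
      have "x ^ n < 1"
        using that r False by (simp add: power_less_one_iff)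
      then show ?thesis
        by (auto intro!: derivative_eq_intros simp: f'_def)
    qed (simp add: f'_def)
    show "uniform_limit {0..r} (\<lambda>n x. \<Sum>i<n. f' i x) (\<lambda>x. \<Sum>n. f' n x) sequentially"
    proof (rule Weierstrass_m_test)
      fix n x assume x: "x \<in> {0..r}"
      show "norm (f' n x) \<le> real n * r ^ n * (1 / (r * (1 - r)))"
      proof (cases n)
        case (Suc m)
        have "x ^ n \<le> x ^ 1"
          using x r Suc by (intro power_decreasing) auto
        then have d: "1 - r \<le> 1 - x ^ n" using x by simp
        have "norm (f' n x) = \<bar>legendre5 n\<bar> * (real n * (x ^ m / (1 - x ^ n)))"
          using x r d Suc by (simp add: f'_def abs_mult abs_divide)
        also have "\<dots> \<le> 1 * (real n * (r ^ m / (1 - r)))"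
          using x r d abs_legendre5_le[of n]
          by (intro mult_mono frac_le power_mono mult_nonneg_nonneg divide_nonneg_nonneg) auto
        also have "\<dots> = real n * r ^ n * (1 / (r * (1 - r)))"
          using r Suc by simp
        finally show ?thesis .
      qed (simp add: f'_def)
    next
      show "summable (\<lambda>n. real n * r ^ n * (1 / (r * (1 - r))))"
        using koebe_sums[of r] r by (intro summable_mult2) (auto simp: sums_iff)
    qed
    show "0 \<in> {0..r}" using r by simp
    have "(\<lambda>n. legendre5 n * ln (1 - 0 ^ n)) = (\<lambda>n. 0)"
      by (auto simp: fun_eq_iff power_0_left)
    then show "summable (\<lambda>n. legendre5 n * ln (1 - 0 ^ n))" by simp
  qed simp
  then obtain g where g: "\<And>x. x \<in> {0..r} \<Longrightarrow> (\<lambda>n. legendre5 n * ln (1 - x ^ n)) sums g x"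
    "\<And>x. x \<in> {0..r} \<Longrightarrow> (g has_field_derivative (\<Sum>n. f' n x)) (at x within {0..r})"
    by blast
  have eq: "g y = ln_rr y" if "y \<in> {0..r}" for y
    using g(1)[OF that] by (simp add: ln_rr_def sums_iff)
  show "(\<lambda>n. legendre5 n * ln (1 - x ^ n)) sums ln_rr x"
    using g(1)[OF x] eq[OF x] by simp
  show "(ln_rr has_real_derivative (\<Sum>n. - (legendre5 n * real n * x ^ (n - 1) / (1 - x ^ n)))) (at x within {0..r})"
    using has_field_derivative_transform_within[OF g(2)[OF x] zero_less_one x, of ln_rr] eq by (simp add: f'_def)
qed

lemma ln_rr_continuous: "0 < r \<Longrightarrow> r < 1 \<Longrightarrow> continuous_on {0..r} ln_rr"
  by (rule DERIV_continuous_on[OF ln_rr_sums_deriv(2)])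

lemma ln_rr_has_derivative:
  assumes "0 < q" "q < 1"
  shows "(ln_rr has_real_derivative (euler_E q ^ 5 / euler_E (q ^ 5) - 1) / (5 * q)) (at q)"
proof -
  define r where "r = (q + 1) / 2"
  have r: "0 < r" "r < 1" "q \<in> {0..r}" "q \<in> interior {0..r}"
    using assms by (auto simp: r_def)
  have "(ln_rr has_real_derivative (\<Sum>n. - (legendre5 n * real n * q ^ (n - 1) / (1 - q ^ n)))) (at q)"
    using ln_rr_sums_deriv(2)[OF r(1-3)] at_within_interior[OF r(4)] by simp
  moreover have "(\<lambda>n. - (legendre5 n * real n * q ^ (n - 1) / (1 - q ^ n))) sums (- ((1 - euler_E q ^ 5 / euler_E (q ^ 5)) / 5 / q))"
  proof -
    have "legendre5 n * real n * q ^ (n - 1) / (1 - q ^ n) = legendre5 n * real n * q ^ n / (1 - q ^ n) / q" for n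
      using assms by (cases n) auto
    then show ?thesis
      using sums_minus[OF sums_divide[OF lambert_identity[OF assms], of q]] by simp
  qed
  moreover have "- ((1 - euler_E q ^ 5 / euler_E (q ^ 5)) / 5 / q) = (euler_E q ^ 5 / euler_E (q ^ 5) - 1) / (5 * q)"
    using assms by (simp add: field_simps)
  ultimately show ?thesis
    by (simp add: sums_iff)
qed

lemma ln_qpoch_sums:
  fixes q a :: real
  assumes "0 < q" "q < 1" "0 < a" "a < 1"
  shows "(\<lambda>j. ln (1 - a * q ^ j)) sums ln (qpoch a q)"
proof -
  have pos: "1 - a * q ^ j > 0" for j
  proof -
    have "a * q ^ j \<le> a * 1"
      using assms by (intro mult_left_mono power_le_one) auto
    then show ?thesis using assms(4) by linarith
  qed
  have "(\<lambda>n. ln (\<Prod>j<n. 1 - a * q ^ j)) \<longlonglongrightarrow> ln (qpoch a q)"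
    using assms qpoch_pos[of q a] by (intro tendsto_ln qpoch_LIMSEQ) auto
  moreover have "ln (\<Prod>j<n. 1 - a * q ^ j) = (\<Sum>j<n. ln (1 - a * q ^ j))" for n
    by (intro ln_prod) (use pos in \<open>force simp: less_le\<close>)+
  ultimately show ?thesis
    by (simp add: sums_def)
qed

text \<open>Grouping the logarithms in blocks of five separates the residue classes; classes 1 and 4
  form the numerator, 2 and 3 the denominator.\<close>

lemma exp_ln_rr:
  assumes "0 < q" "q < 1"
  shows "exp (ln_rr q) = theta q (q ^ 5) / theta (q ^ 2) (q ^ 5)"
proof -
  define p where "p a = qpoch (q ^ a) (q ^ 5)" for a
  have q5: "0 < q ^ a" "q ^ a < 1" if "a > 0" for a
    using assms that by (auto simp: power_less_one_iff)
  have p: "p a > 0" if "a > 0" for a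
    unfolding p_def using q5 that by (intro qpoch_pos less_imp_le[OF q5(1)]) auto
  have l: "(\<lambda>j. ln (1 - q ^ (5 * j + a))) sums ln (p a)" if "a > 0" for a
  proof -
    have "q ^ (5 * j + a) = q ^ a * (q ^ 5) ^ j" for j
      by (simp add: power_add power_mult)
    then show ?thesis
      using ln_qpoch_sums[OF q5 q5, of 5 a] that unfolding p_def by simp
  qed
  have "(\<lambda>n. legendre5 n * ln (1 - q ^ n)) sums ln_rr q"
    using ln_rr_sums_deriv(1)[of q q] assms by simp
  then have "(\<lambda>j. \<Sum>n=j * 5..<j * 5 + 5. legendre5 n * ln (1 - q ^ n)) sums ln_rr q"
    by (rule sums_group) simp
  moreover have "(\<Sum>n=j * 5..<j * 5 + 5. legendre5 n * ln (1 - q ^ n))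
      = ln (1 - q ^ (5 * j + 1)) - ln (1 - q ^ (5 * j + 2)) - ln (1 - q ^ (5 * j + 3)) + ln (1 - q ^ (5 * j + 4))" for j
  proof -
    have "(\<Sum>n=j * 5..<j * 5 + 5. legendre5 n * ln (1 - q ^ n)) = (\<Sum>r<5. legendre5 (5 * j + r) * ln (1 - q ^ (5 * j + r)))"
      by (rule sum.reindex_bij_witness[of _ "\<lambda>r. r + j * 5" "\<lambda>n. n - j * 5"]) auto
    also have "\<dots> = ln (1 - q ^ (5 * j + 1)) - ln (1 - q ^ (5 * j + 2)) - ln (1 - q ^ (5 * j + 3)) + ln (1 - q ^ (5 * j + 4))"
      by (simp add: lessThan_nat_numeral legendre5_def mod_Suc)
    finally show ?thesis .
  qed
  ultimately have "(\<lambda>j. ln (1 - q ^ (5 * j + 1)) - ln (1 - q ^ (5 * j + 2)) - ln (1 - q ^ (5 * j + 3)) + ln (1 - q ^ (5 * j + 4))) sums ln_rr q"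
    by simp
  moreover have "(\<lambda>j. ln (1 - q ^ (5 * j + 1)) - ln (1 - q ^ (5 * j + 2)) - ln (1 - q ^ (5 * j + 3)) + ln (1 - q ^ (5 * j + 4)))
     sums (ln (p 1) - ln (p 2) - ln (p 3) + ln (p 4))"
    by (intro sums_add sums_diff l) auto
  ultimately have "ln_rr q = ln (p 1) - ln (p 2) - ln (p 3) + ln (p 4)"
    by (rule sums_unique2)
  then have "exp (ln_rr q) = p 1 * p 4 / (p 2 * p 3)"
    using p by (simp add: exp_add exp_diff)
  moreover have "q ^ 5 / q = q ^ 4" "q ^ 5 / q\<^sup>2 = q ^ 3"
    using assms by (simp_all add: field_simps eval_nat_numeral)
  ultimately show ?thesis
    by (simp add: theta_def p_def)
qed

lemma theta_dissect2:
  fixes q :: real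
  assumes "0 < q" "q < 1" "0 < a" "a < 5"
  shows "theta (q ^ a) (q ^ 5) = theta (q ^ a) (q ^ 10) * theta (q ^ (5 - a)) (q ^ 10)"
proof -
  have q5: "norm (q ^ 5) < 1"
    using assms by (simp add: power_less_one_iff)
  have dis: "qpoch (q ^ b) (q ^ 5) = qpoch (q ^ b) (q ^ 10) * qpoch (q ^ (b + 5)) (q ^ 10)" for b
    using qpoch_dissect[OF q5, of 2 "q ^ b"] by (simp add: prod_lessThan_2 flip: power_mult power_add)
  have "q ^ 5 / q ^ a = q ^ (5 - a)" "q ^ 10 / q ^ a = q ^ (5 - a + 5)" "q ^ 10 / q ^ (5 - a) = q ^ (a + 5)"
    using assms by (auto simp: add.commute simp flip: power_diff)
  then show ?thesis
    unfolding theta_def by (simp only: dis mult_ac)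
qed

text \<open>The fractional powers \<open>q^(1/5)\<close> of \<open>r(q)\<close> and
  \<open>q^(4/5)\<close> of \<open>r(q^2)^2\<close> combine to q. In base \<open>q^10\<close> the
  quotient for \<open>q^2\<close> is the theta value at \<open>q^2\<close> over that at
  \<open>q^4\<close>.\<close>

lemma ramanujan_k_eq_exp:
  assumes "0 \<le> q" "q < 1"
  shows "ramanujan_k q = q * exp (ln_rr q + 2 * ln_rr (q\<^sup>2))"
proof (cases "q = 0")
  case False
  with assms have q: "0 < q" "q < 1" by auto
  have q2: "0 < q\<^sup>2" "q\<^sup>2 < 1"
    using q by (auto simp: power_less_one_iff)
  define t where "t a = theta (q ^ a) (q ^ 10)" for a
  have t: "t a > 0" if "0 < a" "a < 10" for a
    unfolding t_def using q that by (rule theta_level10_pos)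
  have "exp (ln_rr q) = t 1 * t 4 / (t 2 * t 3)"
    unfolding exp_ln_rr[OF q] using theta_dissect2[OF q, of 1] theta_dissect2[OF q, of 2] by (simp add: t_def)
  moreover have "exp (ln_rr (q\<^sup>2)) = t 2 / t 4"
    unfolding exp_ln_rr[OF q2] by (simp add: t_def flip: power_mult)
  ultimately have "q * exp (ln_rr q + 2 * ln_rr (q\<^sup>2)) = q * (t 1 * t 4 / (t 2 * t 3) * (t 2 / t 4)\<^sup>2)"
    by (simp add: exp_add exp_double)
  also have "\<dots> = q * (t 1 * t 2) / (t 3 * t 4)"
    using t[of 1] t[of 2] t[of 3] t[of 4] by (simp add: field_simps power2_eq_square)
  finally show ?thesis
    by (simp add: ramanujan_k_def t_def)
qed (simp add: ramanujan_k_def)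

lemma ramanujan_k_continuous:
  assumes "0 < r" "r < 1"
  shows "continuous_on {0..r} ramanujan_k"
proof -
  have c: "continuous_on {0..r} ln_rr"
    using assms by (rule ln_rr_continuous)
  have "continuous_on {0..r} (\<lambda>q. ln_rr (q\<^sup>2))"
  proof (rule continuous_on_compose2[OF c])
    show "(\<lambda>q. q\<^sup>2) ` {0..r} \<subseteq> {0..r}"
    proof (intro image_subsetI)
      fix q assume q: "q \<in> {0..r}"
      then have "q\<^sup>2 \<le> q * 1"
        unfolding power2_eq_square using assms by (intro mult_left_mono) auto
      with q show "q\<^sup>2 \<in> {0..r}" by simp
    qed
  qed (intro continuous_intros)
  then have "continuous_on {0..r} (\<lambda>q. q * exp (ln_rr q + 2 * ln_rr (q\<^sup>2)))"
    by (intro continuous_intros c)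
  then show ?thesis
    using ramanujan_k_eq_exp assms by (subst continuous_on_cong[OF refl, of _ _ "\<lambda>q. q * exp (ln_rr q + 2 * ln_rr (q\<^sup>2))"]) auto
qed

text \<open>Relative to the eta quotient on the right, the two terms on the left are
  \<open>(h - 4)/h\<close> and \<open>4 (h + 1)/h\<close>.\<close>

lemma level10_weight2:
  assumes "0 < q" "q < 1"
  shows "euler_E q ^ 5 / euler_E (q ^ 5) + 4 * (euler_E (q ^ 2) ^ 5 / euler_E (q ^ 10))
    = 5 * (euler_E q * euler_E (q ^ 2) ^ 2 * euler_E (q ^ 5) ^ 3 / euler_E (q ^ 10) ^ 2)"
proof -
  define a b c d where E: "a = euler_E q" "b = euler_E (q ^ 2)" "c = euler_E (q ^ 5)" "d = euler_E (q ^ 10)"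
  have pos: "a > 0" "b > 0" "c > 0" "d > 0"
    unfolding E using assms by (auto intro!: euler_E_pos simp: power_less_one_iff)
  have h: "hauptmodul q = b * c ^ 5 / (q * a * d ^ 5)"
    by (simp add: hauptmodul_def E)
  have h0: "hauptmodul q \<noteq> 0"
    unfolding h using pos assms by simp
  have "a ^ 5 / c = a * b ^ 2 * c ^ 3 / d ^ 2 * ((a ^ 3 * c / (q * b * d ^ 3)) / hauptmodul q)"
    unfolding h using pos assms by (simp add: divide_simps) (simp add: eval_nat_numeral)
  also have "a ^ 3 * c / (q * b * d ^ 3) = hauptmodul q - 4"
    unfolding hauptmodul_minus_4[OF assms] E ..
  finally have 1: "a ^ 5 / c = a * b ^ 2 * c ^ 3 / d ^ 2 * ((hauptmodul q - 4) / hauptmodul q)" .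
  have "b ^ 5 / d = a * b ^ 2 * c ^ 3 / d ^ 2 * ((b ^ 4 * c ^ 2 / (q * a ^ 2 * d ^ 4)) / hauptmodul q)"
    unfolding h using pos assms by (simp add: divide_simps) (simp add: eval_nat_numeral)
  also have "b ^ 4 * c ^ 2 / (q * a ^ 2 * d ^ 4) = hauptmodul q + 1"
    unfolding hauptmodul_plus_1[OF assms] E ..
  finally have 2: "b ^ 5 / d = a * b ^ 2 * c ^ 3 / d ^ 2 * ((hauptmodul q + 1) / hauptmodul q)" .
  have "w * ((h - 4) / h) + 4 * (w * ((h + 1) / h)) = 5 * w" if "h \<noteq> 0" for w h :: real
    using that by (simp add: field_simps)
  from this[OF h0] show ?thesis
    unfolding E[symmetric] 1 2 .
qed

lemma ramanujan_k_has_derivative: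
  assumes "0 < q" "q < 1"
  shows "(ramanujan_k has_real_derivative
    ramanujan_k q * (euler_E q * euler_E (q ^ 2) ^ 2 * euler_E (q ^ 5) ^ 3 / euler_E (q ^ 10) ^ 2) / q) (at q)"
proof -
  have q2: "0 < q\<^sup>2" "q\<^sup>2 < 1"
    using assms by (auto simp: power_less_one_iff)
  define A where "A = euler_E q ^ 5 / euler_E (q ^ 5)"
  define B where "B = euler_E (q ^ 2) ^ 5 / euler_E (q ^ 10)"
  have lu1: "(ln_rr has_real_derivative (A - 1) / (5 * q)) (at q)"
    using ln_rr_has_derivative[OF assms] by (simp add: A_def)
  have lu2: "(ln_rr has_real_derivative (B - 1) / (5 * q\<^sup>2)) (at (q\<^sup>2))"
    using ln_rr_has_derivative[OF q2] by (simp add: B_def flip: power_mult)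
  have "((\<lambda>q. ln_rr (q\<^sup>2)) has_real_derivative (B - 1) / (5 * q\<^sup>2) * (2 * q)) (at q)"
    by (rule DERIV_chain2[where f = ln_rr and g = "\<lambda>q. q\<^sup>2", OF lu2]) (auto intro!: derivative_eq_intros)
  then have "((\<lambda>q. q * exp (ln_rr q + 2 * ln_rr (q\<^sup>2))) has_real_derivative
      exp (ln_rr q + 2 * ln_rr (q\<^sup>2)) + q * (exp (ln_rr q + 2 * ln_rr (q\<^sup>2)) * ((A - 1) / (5 * q) + 2 * ((B - 1) / (5 * q\<^sup>2) * (2 * q))))) (at q)"
    using lu1 by (auto intro!: derivative_eq_intros)
  \<comment> \<open>The constants cancel: 1 from the factor q, against -1/5 and -4/5 from the two
    logarithmic derivatives.\<close>
  also have "exp (ln_rr q + 2 * ln_rr (q\<^sup>2)) + q * (exp (ln_rr q + 2 * ln_rr (q\<^sup>2)) * ((A - 1) / (5 * q) + 2 * ((B - 1) / (5 * q\<^sup>2) * (2 * q))))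
      = exp (ln_rr q + 2 * ln_rr (q\<^sup>2)) * ((A + 4 * B) / 5)"
    using assms by (simp add: field_simps power2_eq_square)
  also have "\<dots> = ramanujan_k q * ((A + 4 * B) / 5) / q"
    using assms ramanujan_k_eq_exp[of q] by simp
  also have "(A + 4 * B) / 5 = euler_E q * euler_E (q ^ 2) ^ 2 * euler_E (q ^ 5) ^ 3 / euler_E (q ^ 10) ^ 2"
    using level10_weight2[OF assms] by (simp add: A_def B_def)
  finally have d: "((\<lambda>q. q * exp (ln_rr q + 2 * ln_rr (q\<^sup>2))) has_real_derivative
     ramanujan_k q * (euler_E q * euler_E (q ^ 2) ^ 2 * euler_E (q ^ 5) ^ 3 / euler_E (q ^ 10) ^ 2) / q) (at q)" .
  show ?thesis
    by (rule has_field_derivative_transform_within_open[OF d, of "{0<..<1}"]) (use assms ramanujan_k_eq_exp in auto)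
qed

subsection \<open>Transformation of theta functions\<close>

lemma exp_le_one_minus:
  fixes y :: real
  assumes "0 \<le> y" "y < 1"
  shows "exp (- y / (1 - y)) \<le> 1 - y"
proof -
  have "1 / (1 - y) = 1 + y / (1 - y)"
    using assms by (simp add: field_simps)
  also have "\<dots> \<le> exp (y / (1 - y))"
    by (rule exp_ge_add_one_self)
  finally show ?thesis
    using assms by (simp add: exp_minus field_simps)
qed

text \<open>The function \<open>cos y * exp (y^2 / 2)\<close> decreases because
  \<open>t cos t \<le> sin t\<close>. This gives the Gaussian majorant for the powers of
  cosines.\<close>

lemma cos_le_exp:
  fixes x :: real
  assumes "\<bar>x\<bar> \<le> pi / 2"
  shows "cos x \<le> exp (- x\<^sup>2 / 2)"
proof -
  have *: "cos y \<le> exp (- y\<^sup>2 / 2)" if y: "0 \<le> y" "y \<le> pi / 2" for y :: real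
  proof -
    have p: "t * cos t - sin t \<le> 0" if t: "0 \<le> t" "t \<le> pi / 2" for t :: real
    proof -
      have "t * cos t - sin t \<le> 0 * cos 0 - sin 0"
      proof (rule DERIV_nonpos_imp_nonincreasing[OF t(1)])
        fix x assume x: "0 \<le> x" "x \<le> t"
        have "((\<lambda>x. x * cos x - sin x) has_real_derivative - (x * sin x)) (at x)"
          by (auto intro!: derivative_eq_intros)
        moreover have "- (x * sin x) \<le> 0"
          using x t by (simp add: sin_ge_zero)
        ultimately show "\<exists>y. ((\<lambda>x. x * cos x - sin x) has_real_derivative y) (at x) \<and> y \<le> 0"
          by blast
      qed
      then show ?thesis by simp
    qed
    have "cos y * exp (y\<^sup>2 / 2) \<le> cos 0 * exp (0\<^sup>2 / 2)"
    proof (rule DERIV_nonpos_imp_nonincreasing[OF y(1)])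
      fix x assume x: "0 \<le> x" "x \<le> y"
      have "((\<lambda>x. cos x * exp (x\<^sup>2 / 2)) has_real_derivative exp (x\<^sup>2 / 2) * (x * cos x - sin x)) (at x)"
        by (auto intro!: derivative_eq_intros simp: algebra_simps)
      moreover have "exp (x\<^sup>2 / 2) * (x * cos x - sin x) \<le> 0"
        using x y p[of x] by (intro mult_nonneg_nonpos) auto
      ultimately show "\<exists>y. ((\<lambda>x. cos x * exp (x\<^sup>2 / 2)) has_real_derivative y) (at x) \<and> y \<le> 0"
        by blast
    qed
    then show ?thesis
      by (simp add: exp_minus field_simps)
  qed
  show ?thesis
    using *[of "\<bar>x\<bar>"] assms by simp
qed

text \<open>The matching lower bound; its exponent is asymptotic to \<open>- x^2 / 2\<close> at 0,
  which is enough for the limit.\<close>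

lemma cos_ge_exp:
  fixes x :: real
  assumes "x\<^sup>2 < 2"
  shows "exp (- (x\<^sup>2 / 2) / (1 - x\<^sup>2 / 2)) \<le> cos x"
proof -
  have "\<bar>sin (x / 2)\<bar> \<le> \<bar>x / 2\<bar>"
    by (rule abs_sin_x_le_abs_x)
  then have "(sin (x / 2))\<^sup>2 \<le> (x / 2)\<^sup>2"
    by (rule abs_le_square_iff[THEN iffD1])
  moreover have "cos x = 1 - 2 * (sin (x / 2))\<^sup>2"
    using cos_double_sin[of "x / 2"] by simp
  ultimately have "1 - x\<^sup>2 / 2 \<le> cos x"
    by (simp add: power_divide)
  moreover have "exp (- (x\<^sup>2 / 2) / (1 - x\<^sup>2 / 2)) \<le> 1 - x\<^sup>2 / 2"
    using assms by (intro exp_le_one_minus) auto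
  ultimately show ?thesis by simp
qed

section \<open>Asymptotics of binomial coefficients near the centre\<close>

lemma binomial_central_ratio:
  assumes "r \<le> m"
  shows "real (2 * m choose (m + r)) = real (2 * m choose m) * (\<Prod>i<r. (real m - real i) / (real m + real i + 1))"
  using assms
proof (induction r)
  case (Suc r)
  have "Suc (m + r) * (2 * m choose Suc (m + r)) = (2 * m - (m + r)) * (2 * m choose (m + r))"
  proof (cases "2 * m")
    case (Suc n)
    then show ?thesis
      using Suc_times_binomial[of "m + r" n] binomial_absorb_comp[of "2 * m" "m + r"] by simp
  qed (use Suc.prems in auto)
  then have "real (Suc (m + r) * (2 * m choose Suc (m + r))) = real ((m - r) * (2 * m choose (m + r)))"
    by simp
  then have "(real m + real r + 1) * real (2 * m choose Suc (m + r)) = (real m - real r) * real (2 * m choose (m + r))"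
    using Suc.prems by (simp add: of_nat_diff algebra_simps)
  then have "real (2 * m choose (m + Suc r)) = real (2 * m choose (m + r)) * ((real m - real r) / (real m + real r + 1))"
    by (simp add: field_simps add_nonneg_eq_0_iff)
  then show ?case
    using Suc by simp
qed simp

lemma sum_odd_real: "(\<Sum>i<r. 2 * real i + 1) = (real r)\<^sup>2"
  by (induction r) (simp_all add: power2_eq_square algebra_simps)

text \<open>Each factor is \<open>1 - (2 i + 1)/(m + i + 1)\<close>; with
  \<open>1 + x \<le> exp x\<close> and the common denominator \<open>m + r\<close>, the odd numbers
  add up to \<open>r^2\<close>. The lower bound proceeds likewise with the denominator
  \<open>m - r\<close>.\<close>

lemma binomial_central_upper:
  assumes "r \<le> m"
  shows "real (2 * m choose (m + r)) \<le> real (2 * m choose m) * exp (- (real r)\<^sup>2 / (real m + real r))"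
proof -
  have "(\<Prod>i<r. (real m - real i) / (real m + real i + 1)) \<le> (\<Prod>i<r. exp (- (2 * real i + 1) / (real m + real r)))"
  proof (rule prod_mono, intro conjI)
    fix i assume "i \<in> {..<r}"
    then have i: "real i + 1 \<le> real r" "real r \<le> real m" using assms by auto
    then show "0 \<le> (real m - real i) / (real m + real i + 1)" by simp
    have "(real m - real i) / (real m + real i + 1) = 1 + (- (2 * real i + 1) / (real m + real i + 1))"
      by (simp add: field_simps add_nonneg_eq_0_iff)
    also have "\<dots> \<le> exp (- (2 * real i + 1) / (real m + real i + 1))"
      by (rule exp_ge_add_one_self)
    finally have 1: "(real m - real i) / (real m + real i + 1) \<le> exp (- (2 * real i + 1) / (real m + real i + 1))" .
    have "(2 * real i + 1) / (real m + real r) \<le> (2 * real i + 1) / (real m + real i + 1)"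
      using i by (intro frac_le) auto
    then have "exp (- (2 * real i + 1) / (real m + real i + 1)) \<le> exp (- (2 * real i + 1) / (real m + real r))"
      by (simp only: exp_le_cancel_iff minus_divide_left[symmetric] neg_le_iff_le)
    with 1 show "(real m - real i) / (real m + real i + 1) \<le> exp (- (2 * real i + 1) / (real m + real r))"
      by (rule order_trans)
  qed
  also have "\<dots> = exp (\<Sum>i<r. - (2 * real i + 1) / (real m + real r))"
    by (simp add: exp_sum)
  also have "(\<Sum>i<r. - (2 * real i + 1) / (real m + real r)) = - (\<Sum>i<r. 2 * real i + 1) / (real m + real r)"
    by (simp only: sum_divide_distrib[symmetric] sum_negf)
  also have "\<dots> = - (real r)\<^sup>2 / (real m + real r)"
    unfolding sum_odd_real ..
  finally show ?thesis
    unfolding binomial_central_ratio[OF assms] by (intro mult_left_mono) auto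
qed

lemma binomial_central_lower:
  assumes "r < m"
  shows "real (2 * m choose (m + r)) \<ge> real (2 * m choose m) * exp (- (real r)\<^sup>2 / (real m - real r))"
proof -
  have "exp (- (real r)\<^sup>2 / (real m - real r)) = exp (- (\<Sum>i<r. 2 * real i + 1) / (real m - real r))"
    unfolding sum_odd_real ..
  also have "- (\<Sum>i<r. 2 * real i + 1) / (real m - real r) = (\<Sum>i<r. - (2 * real i + 1) / (real m - real r))"
    by (simp only: sum_divide_distrib[symmetric] sum_negf)
  also have "exp \<dots> = (\<Prod>i<r. exp (- (2 * real i + 1) / (real m - real r)))"
    by (simp add: exp_sum)
  also have "\<dots> \<le> (\<Prod>i<r. (real m - real i) / (real m + real i + 1))"
  proof (rule prod_mono, intro conjI)
    fix i assume "i \<in> {..<r}"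
    then have i: "real i + 1 \<le> real r" "real r < real m" using assms by auto
    define y where "y = (2 * real i + 1) / (real m + real i + 1)"
    have y: "0 \<le> y" "y < 1" "1 - y = (real m - real i) / (real m + real i + 1)"
      using i by (simp_all add: y_def field_simps add_nonneg_eq_0_iff)
    have "y / (1 - y) = (2 * real i + 1) / (real m - real i)"
      unfolding y(3) using i by (simp add: y_def divide_simps)
    also have "\<dots> \<le> (2 * real i + 1) / (real m - real r)"
      using i by (intro frac_le) auto
    finally have "exp (- (2 * real i + 1) / (real m - real r)) \<le> exp (- y / (1 - y))"
      by (simp only: exp_le_cancel_iff minus_divide_left[symmetric] neg_le_iff_le)
    also have "\<dots> \<le> 1 - y"
      by (rule exp_le_one_minus[OF y(1,2)])
    finally show "exp (- (2 * real i + 1) / (real m - real r)) \<le> (real m - real i) / (real m + real i + 1)"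
      unfolding y(3) .
  qed simp
  finally show ?thesis
    unfolding binomial_central_ratio[OF less_imp_le[OF assms]] by (intro mult_left_mono) auto
qed

text \<open>With the normalisation \<open>2 m + 1\<close> the squared expression is exactly the
  reciprocal of a partial product of Wallis.\<close>

lemma wallis_binomial:
  "(\<lambda>m. sqrt (2 * real m + 1) * (real (2 * m choose m) / 4 ^ m)) \<longlonglongrightarrow> sqrt (2 / pi)"
proof -
  define c where "c m = real (2 * m choose m) / 4 ^ m" for m
  have c_Suc: "c (Suc m) = c m * ((2 * real m + 1) / (2 * real m + 2))" for m
  proof -
    have "Suc m * (2 * Suc m choose Suc m) = 2 * (Suc m * (Suc (2 * m) choose Suc m))"
    proof -
      have "2 * Suc m choose Suc m = (Suc (2 * m) choose m) + (Suc (2 * m) choose Suc m)"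
        by simp
      moreover have "Suc (2 * m) choose m = Suc (2 * m) choose Suc m"
        using binomial_symmetric[of m "Suc (2 * m)"] by simp
      ultimately show ?thesis by simp
    qed
    also have "Suc m * (Suc (2 * m) choose Suc m) = Suc (2 * m) * (2 * m choose m)"
      by (rule Suc_times_binomial)
    finally have "real (Suc m * (2 * Suc m choose Suc m)) = real (2 * (Suc (2 * m) * (2 * m choose m)))"
      by (simp only:)
    then have "(real m + 1) * real (2 * Suc m choose Suc m) = 2 * (2 * real m + 1) * real (2 * m choose m)"
      by (simp only: of_nat_mult of_nat_Suc of_nat_numeral) (simp add: algebra_simps)
    then show ?thesis
      unfolding c_def by (simp add: divide_simps add_nonneg_eq_0_iff) (simp add: algebra_simps)
  qed
  have prod1: "(\<Prod>k=1..m. (4 * (real k)\<^sup>2) / (4 * (real k)\<^sup>2 - 1)) * ((c m)\<^sup>2 * (2 * real m + 1)) = 1" for m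
  proof (induction m)
    case 0
    show ?case by (simp add: c_def)
  next
    case (Suc m)
    define x where "x = real m"
    have x: "x \<ge> 0" by (simp add: x_def)
    have "4 * (real (Suc m))\<^sup>2 - 1 = (2 * x + 1) * (2 * x + 3)"
      by (simp add: x_def power2_eq_square algebra_simps)
    then have "(4 * (real (Suc m))\<^sup>2) / (4 * (real (Suc m))\<^sup>2 - 1) * (((2 * x + 1) / (2 * x + 2))\<^sup>2 * (2 * real (Suc m) + 1)) = (2 * x + 1)"
      using x by (simp add: x_def divide_simps add_nonneg_eq_0_iff power2_eq_square) (simp add: algebra_simps)
    moreover have "(P * W) * ((d * R)\<^sup>2 * D) = P * (d\<^sup>2 * (W * (R\<^sup>2 * D)))" for P W d R D :: real
      by (simp add: power_mult_distrib mult_ac)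
    moreover have "(\<Prod>k=1..Suc m. (4 * (real k)\<^sup>2) / (4 * (real k)\<^sup>2 - 1))
      = (\<Prod>k=1..m. (4 * (real k)\<^sup>2) / (4 * (real k)\<^sup>2 - 1)) * ((4 * (real (Suc m))\<^sup>2) / (4 * (real (Suc m))\<^sup>2 - 1))"
      by simp
    ultimately have "(\<Prod>k=1..Suc m. (4 * (real k)\<^sup>2) / (4 * (real k)\<^sup>2 - 1)) * ((c (Suc m))\<^sup>2 * (2 * real (Suc m) + 1))
      = (\<Prod>k=1..m. (4 * (real k)\<^sup>2) / (4 * (real k)\<^sup>2 - 1)) * ((c m)\<^sup>2 * (2 * x + 1))"
      unfolding c_Suc x_def by (simp only:)
    also have "\<dots> = 1" using Suc.IH by (simp add: x_def)
    finally show ?case .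
  qed
  have "(c m)\<^sup>2 * (2 * real m + 1) = inverse (\<Prod>k=1..m. (4 * (real k)\<^sup>2) / (4 * (real k)\<^sup>2 - 1))" for m
    using inverse_unique[OF prod1[of m]] by simp
  moreover have "(\<lambda>m. inverse (\<Prod>k=1..m. (4 * (real k)\<^sup>2) / (4 * (real k)\<^sup>2 - 1))) \<longlonglongrightarrow> inverse (pi / 2)"
    by (intro tendsto_inverse wallis) simp
  ultimately have "(\<lambda>m. (c m)\<^sup>2 * (2 * real m + 1)) \<longlonglongrightarrow> inverse (pi / 2)"
    by simp
  then have "(\<lambda>m. sqrt ((c m)\<^sup>2 * (2 * real m + 1))) \<longlonglongrightarrow> sqrt (inverse (pi / 2))"
    by (rule tendsto_real_sqrt)
  moreover have "sqrt ((c m)\<^sup>2 * (2 * real m + 1)) = sqrt (2 * real m + 1) * c m" for m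
    by (simp add: real_sqrt_mult c_def)
  ultimately show ?thesis
    by (simp add: c_def)
qed

section \<open>A finite form of the theta transformation\<close>

text \<open>Orthogonality over the \<open>2 n\<close> solutions of \<open>z^(2 n) = -1\<close>: the
  power sums vanish unless \<open>2 n\<close> divides the exponent, and each factor
  \<open>z^(2 n)\<close> contributes a sign.\<close>

lemma sum_cis_odd:
  fixes t :: int
  assumes "n > 0"
  shows "(\<Sum>j\<in>{-int n..<int n}. cis (pi * (2 * real_of_int j + 1) / (2 * real n) * real_of_int t))
    = (if 2 * int n dvd t then of_nat (2 * n) * (- 1) powi (t div (2 * int n)) else 0)"
proof (cases "2 * int n dvd t")
  case True
  then obtain k where k: "t = 2 * int n * k" by blast
  have "cis (pi * (2 * real_of_int j + 1) / (2 * real n) * real_of_int t) = (- 1) powi k" for j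
  proof -
    have "pi * (2 * real_of_int j + 1) / (2 * real n) * real_of_int t = real_of_int ((2 * j + 1) * k) * pi"
      using assms by (simp add: k)
    then have "cis (pi * (2 * real_of_int j + 1) / (2 * real n) * real_of_int t) = cis (real_of_int ((2 * j + 1) * k) * pi)"
      by (simp only:)
    also have "\<dots> = cis pi powi ((2 * j + 1) * k)"
      by (rule cis_power_int[symmetric])
    also have "\<dots> = (- 1) powi k"
      by (simp add: power_int_minus_left)
    finally show ?thesis .
  qed
  then show ?thesis
    using assms by (simp add: k)
next
  case False
  define x where "x = cis (pi / real n * real_of_int t)"
  have "x \<noteq> 1"
  proof
    assume "x = 1"
    then have "cos (pi / real n * real_of_int t) = 1"
      by (simp add: x_def complex_eq_iff)
    then obtain i :: int where "pi / real n * real_of_int t = real_of_int i * 2 * pi"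
      using cos_one_2pi_int by blast
    then have "real_of_int t = real_of_int (2 * int n * i)"
      using assms by (simp add: field_simps)
    then have "t = 2 * int n * i" by linarith
    with False show False by simp
  qed
  have "x ^ (2 * n) = cis (real_of_int (2 * t) * pi)"
    unfolding x_def Complex.DeMoivre using assms by (simp add: field_simps)
  also have "\<dots> = cis pi powi (2 * t)"
    by (rule cis_power_int[symmetric])
  also have "\<dots> = 1" by simp
  finally have x1: "x ^ (2 * n) = 1" .
  have "(\<Sum>j\<in>{-int n..<int n}. cis (pi * (2 * real_of_int j + 1) / (2 * real n) * real_of_int t))
     = (\<Sum>i<2 * n. cis (pi * (1 - 2 * real n) / (2 * real n) * real_of_int t) * x ^ i)"
  proof (rule sum.reindex_bij_witness[of _ "\<lambda>i. int i - int n" "\<lambda>j. nat (j + int n)"])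
    fix j assume j: "j \<in> {-int n..<int n}"
    then have jn: "real (nat (j + int n)) = real_of_int j + real n" by simp
    show "cis (pi * (1 - 2 * real n) / (2 * real n) * real_of_int t) * x ^ nat (j + int n)
      = cis (pi * (2 * real_of_int j + 1) / (2 * real n) * real_of_int t)"
      unfolding x_def Complex.DeMoivre cis_mult jn using assms by (intro arg_cong[of _ _ cis]) (simp add: field_simps)
  qed auto
  also have "\<dots> = cis (pi * (1 - 2 * real n) / (2 * real n) * real_of_int t) * (\<Sum>i<2 * n. x ^ i)"
    by (simp add: sum_distrib_left)
  also have "(\<Sum>i<2 * n. x ^ i) = 0"
    using geometric_sum[OF \<open>x \<noteq> 1\<close>, of "2 * n"] x1 by simp
  finally show ?thesis using False by simp
qed

text \<open>Polya's proof of the theta transformation: expand $(\zeta + \zeta^{-1})^{2m}$ and sum over all $\zeta$ with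
  $\zeta^{4n} = -1$, up to sign. The theorem results in the limit $n \to \infty$ with $m \approx 4 n^2 / s$.\<close>

lemma finite_theta_transformation:
  assumes "n > 0"
  shows "(\<Sum>j\<in>{-int n..<int n}. cos (pi * (2 * real_of_int j + 1) / (4 * real n)) ^ (2 * m))
    = infsum (\<lambda>k::int. (- 1) powi k * (2 * real n * (real (2 * m choose (m + nat \<bar>k\<bar> * (2 * n))) / 4 ^ m))) UNIV"
proof -
  define x where "x j = pi * (2 * real_of_int j + 1) / (4 * real n)" for j
  define t where "t r = int r - int m" for r
  define g where "g k = (- 1) powi k * (2 * real n * (real (2 * m choose (m + nat \<bar>k\<bar> * (2 * n))) / 4 ^ m))" for k :: int
  \<comment> \<open>The finitely many k for which the binomial coefficient does not vanish.\<close>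
  define K where "K = {k::int. \<bar>k\<bar> * (2 * int n) \<le> int m}"
  have K: "finite K"
  proof (rule finite_subset)
    show "K \<subseteq> {-int m..int m}"
    proof
      fix k assume "k \<in> K"
      then have "\<bar>k\<bar> * (2 * int n) \<le> int m" by (simp add: K_def)
      moreover have "\<bar>k\<bar> * 1 \<le> \<bar>k\<bar> * (2 * int n)"
        using assms by (intro mult_left_mono) auto
      ultimately show "k \<in> {-int m..int m}" by auto
    qed
  qed simp
  \<comment> \<open>The binomial expansion has exponents \<open>2 (r - m)\<close>, so the doubled
    angle \<open>2 x j\<close> appears, which is the one in \<open>sum_cis_odd\<close>.\<close>
  have cos_pow: "complex_of_real (cos (x j) ^ (2 * m)) = (\<Sum>r\<le>2 * m. of_nat (2 * m choose r) / 4 ^ m * cis (pi * (2 * real_of_int j + 1) / (2 * real n) * real_of_int (t r)))" for j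
  proof -
    have "complex_of_real (cos (x j)) = (cis (x j) + cis (- x j)) / 2"
      by (simp add: complex_eq_iff)
    then have "complex_of_real (cos (x j) ^ (2 * m)) = ((cis (x j) + cis (- x j)) / 2) ^ (2 * m)"
      by (simp only: of_real_power)
    also have "\<dots> = (cis (x j) + cis (- x j)) ^ (2 * m) / 4 ^ m"
      unfolding power_divide by (simp add: power_mult)
    also have "(cis (x j) + cis (- x j)) ^ (2 * m) = (\<Sum>r\<le>2 * m. of_nat (2 * m choose r) * cis (x j) ^ r * cis (- x j) ^ (2 * m - r))"
      by (rule binomial_ring)
    also have "\<dots> = (\<Sum>r\<le>2 * m. of_nat (2 * m choose r) * cis (pi * (2 * real_of_int j + 1) / (2 * real n) * real_of_int (t r)))"
    proof (rule sum.cong)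
      fix r assume "r \<in> {..2 * m}"
      then have "real (2 * m - r) = 2 * real m - real r" by (simp add: of_nat_diff)
      then have "real r * x j + real (2 * m - r) * - x j = pi * (2 * real_of_int j + 1) / (2 * real n) * real_of_int (t r)"
        using assms by (simp add: x_def t_def field_simps)
      then have "cis (x j) ^ r * cis (- x j) ^ (2 * m - r) = cis (pi * (2 * real_of_int j + 1) / (2 * real n) * real_of_int (t r))"
        unfolding Complex.DeMoivre cis_mult by (simp only:)
      then show "of_nat (2 * m choose r) * cis (x j) ^ r * cis (- x j) ^ (2 * m - r)
         = of_nat (2 * m choose r) * cis (pi * (2 * real_of_int j + 1) / (2 * real n) * real_of_int (t r))"
        by (simp only: mult.assoc)
    qed simp
    finally show ?thesis
      by (simp add: sum_divide_distrib)
  qed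
  have "complex_of_real (\<Sum>j\<in>{-int n..<int n}. cos (x j) ^ (2 * m))
     = (\<Sum>j\<in>{-int n..<int n}. \<Sum>r\<le>2 * m. of_nat (2 * m choose r) / 4 ^ m * cis (pi * (2 * real_of_int j + 1) / (2 * real n) * real_of_int (t r)))"
    unfolding of_real_sum cos_pow ..
  also have "\<dots> = (\<Sum>r\<le>2 * m. \<Sum>j\<in>{-int n..<int n}. of_nat (2 * m choose r) / 4 ^ m * cis (pi * (2 * real_of_int j + 1) / (2 * real n) * real_of_int (t r)))"
    by (rule sum.swap)
  also have "\<dots> = (\<Sum>r\<le>2 * m. of_nat (2 * m choose r) / 4 ^ m * (if 2 * int n dvd t r then of_nat (2 * n) * (- 1) powi (t r div (2 * int n)) else 0))"
    unfolding sum_distrib_left[symmetric] sum_cis_odd[OF assms] ..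
  also have "\<dots> = (\<Sum>r\<in>{r\<in>{..2 * m}. 2 * int n dvd t r}. of_nat (2 * m choose r) / 4 ^ m * (of_nat (2 * n) * (- 1) powi (t r div (2 * int n))))"
    by (subst sum.inter_filter) (auto intro!: sum.cong)
  also have "\<dots> = (\<Sum>k\<in>K. complex_of_real (g k))"
  proof (rule sum.reindex_bij_witness[of _ "\<lambda>k. nat (int m + k * (2 * int n))" "\<lambda>r. t r div (2 * int n)"])
    fix r assume r: "r \<in> {r\<in>{..2 * m}. 2 * int n dvd t r}"
    then obtain k where k: "t r = 2 * int n * k" by auto
    have div: "t r div (2 * int n) = k"
      using assms by (simp add: k)
    have rk: "int r = int m + k * (2 * int n)" using k by (simp add: t_def algebra_simps)
    show "nat (int m + t r div (2 * int n) * (2 * int n)) = r"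
      unfolding div rk[symmetric] by simp
    have abs: "\<bar>k\<bar> * (2 * int n) = \<bar>t r\<bar>"
      by (simp add: k abs_mult)
    also have "\<dots> \<le> int m"
      using r by (auto simp: t_def)
    finally show "t r div (2 * int n) \<in> K"
      unfolding div K_def by simp
    define d where "d = nat \<bar>k\<bar> * (2 * n)"
    have "int d = \<bar>int r - int m\<bar>"
      using abs by (simp add: d_def t_def)
    then have "m + d = r \<or> m + d = 2 * m - r \<and> r \<le> 2 * m"
      using r by auto
    then have "2 * m choose (m + d) = 2 * m choose r"
      using binomial_symmetric[of r "2 * m"] by auto
    then have "2 * m choose (m + nat \<bar>k\<bar> * (2 * n)) = 2 * m choose r"
      unfolding d_def .
    then show "complex_of_real (g (t r div (2 * int n))) = of_nat (2 * m choose r) / 4 ^ m * (of_nat (2 * n) * (- 1) powi (t r div (2 * int n)))"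
      unfolding div g_def by (simp add: mult_ac power_int_minus_left)
  next
    fix k assume k: "k \<in> K"
    have abs: "\<bar>k * (2 * int n)\<bar> \<le> int m"
      using k by (simp add: K_def abs_mult)
    then have *: "int (nat (int m + k * (2 * int n))) = int m + k * (2 * int n)" by simp
    then have t: "t (nat (int m + k * (2 * int n))) = k * (2 * int n)" by (simp add: t_def)
    show "t (nat (int m + k * (2 * int n))) div (2 * int n) = k"
      unfolding t using assms by simp
    have "nat (int m + k * (2 * int n)) \<le> 2 * m" using abs by linarith
    then show "nat (int m + k * (2 * int n)) \<in> {r\<in>{..2 * m}. 2 * int n dvd t r}"
      using t by simp
  qed
  finally have "(\<Sum>j\<in>{-int n..<int n}. cos (x j) ^ (2 * m)) = (\<Sum>k\<in>K. g k)"
    unfolding of_real_sum[symmetric] of_real_eq_iff .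
  also have "\<dots> = infsum g K"
    by (rule infsum_finite[OF K, symmetric])
  also have "\<dots> = infsum g UNIV"
  proof (rule infsum_cong_neutral)
    fix k assume "k \<in> UNIV - K"
    then have "int m < int (nat \<bar>k\<bar> * (2 * n))" by (simp add: K_def)
    then have "2 * m < m + nat \<bar>k\<bar> * (2 * n)" by linarith
    then show "g k = 0" unfolding g_def by simp
  qed auto
  finally show ?thesis
    unfolding x_def g_def .
qed

section \<open>Passage to the limit\<close>

lemma exp_quadratic_summable:
  fixes c :: real
  assumes "c > 0"
  shows "(\<lambda>k::int. exp (- c * (real_of_int k)\<^sup>2)) summable_on UNIV"
    and "(\<lambda>j::int. exp (- c * (2 * real_of_int j + 1)\<^sup>2)) summable_on UNIV"
proof -
  have pw: "exp a powi k = exp (real_of_int k * a)" for a :: real and k :: int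
    by (simp add: exp_power_int)
  have triangular: "2 * real_of_int (triangular k) = real_of_int k * (real_of_int k - 1)" for k
    using arg_cong[OF two_triangular[of k], of real_of_int] by simp
  have "jtp_term (exp (- (2 * c))) (exp (- c)) k = exp (- c * (real_of_int k)\<^sup>2)" for k
  proof -
    have "jtp_term (exp (- (2 * c))) (exp (- c)) k = exp (real_of_int (triangular k) * (- (2 * c)) + real_of_int k * - c)"
      by (simp only: jtp_term_def pw exp_add)
    also have "real_of_int (triangular k) * (- (2 * c)) + real_of_int k * - c = - c * (2 * real_of_int (triangular k) + real_of_int k)"
      by (simp add: algebra_simps)
    also have "\<dots> = - c * (real_of_int k)\<^sup>2"
      unfolding triangular by (simp add: algebra_simps power2_eq_square)
    finally show ?thesis .
  qed
  then show "(\<lambda>k::int. exp (- c * (real_of_int k)\<^sup>2)) summable_on UNIV"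
    using jtp_term_summable[of "exp (- (2 * c))" "exp (- c)"] assms by simp
  have "exp (- c) * jtp_term (exp (- (8 * c))) (exp (- (8 * c))) k = exp (- c * (2 * real_of_int k + 1)\<^sup>2)" for k
  proof -
    have "exp (- c) * jtp_term (exp (- (8 * c))) (exp (- (8 * c))) k = exp (- c + (real_of_int (triangular k) * (- (8 * c)) + real_of_int k * - (8 * c)))"
      by (simp only: jtp_term_def pw exp_add)
    also have "- c + (real_of_int (triangular k) * (- (8 * c)) + real_of_int k * - (8 * c)) = - c * (1 + 4 * (2 * real_of_int (triangular k)) + 8 * real_of_int k)"
      by (simp add: algebra_simps)
    also have "\<dots> = - c * (2 * real_of_int k + 1)\<^sup>2"
      unfolding triangular by (simp add: algebra_simps power2_eq_square)
    finally show ?thesis .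
  qed
  moreover have "norm (jtp_term (exp (- (8 * c))) (exp (- (8 * c))) k) = jtp_term (exp (- (8 * c))) (exp (- (8 * c))) k" for k
    by (simp add: jtp_term_def abs_mult)
  ultimately show "(\<lambda>j::int. exp (- c * (2 * real_of_int j + 1)\<^sup>2)) summable_on UNIV"
    using summable_on_cmult_right[OF jtp_term_summable[of "exp (- (8 * c))" "exp (- (8 * c))"], of "exp (- c)"] assms by simp
qed

text \<open>Jacobi's imaginary transformation between the second and the fourth theta constant. The
  finite identity is passed to the limit on both sides: the cosines become Gaussians in j, the
  binomial coefficients Gaussians in k.\<close>

theorem theta_transformation:
  fixes s :: real
  assumes "s > 0"
  shows "infsum (\<lambda>j::int. exp (- (pi\<^sup>2 / (4 * s)) * (2 * real_of_int j + 1)\<^sup>2)) UNIV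
    = sqrt (s / pi) * infsum (\<lambda>k::int. (- 1) powi k * exp (- s * (real_of_int k)\<^sup>2)) UNIV"
proof -
  define N where "N n = real (Suc n)" for n
  \<comment> \<open>The choice \<open>m / N^2\<close> close to \<open>4 / s\<close> makes
    \<open>m x^2\<close>, with \<open>x = pi (2 j + 1) / (4 N)\<close>, tend to
    \<open>pi^2 (2 j + 1)^2 / (4 s)\<close>, and \<open>r^2 / m\<close>, with
    \<open>r = 2 k N\<close>, tend to \<open>s k^2\<close>.\<close>
  define m where "m n = nat \<lfloor>4 * (N n)\<^sup>2 / s\<rfloor>" for n
  define A where "A n = real (m n) / (N n)\<^sup>2" for n
  have N: "N n > 0" for n by (simp add: N_def)
  have Ninv: "(\<lambda>n. 1 / N n) \<longlonglongrightarrow> 0"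
    unfolding N_def using LIMSEQ_inverse_real_of_nat by (simp add: inverse_eq_divide)
  have mub: "real (m n) \<le> 4 * (N n)\<^sup>2 / s" and mlb: "4 * (N n)\<^sup>2 / s - 1 \<le> real (m n)" for n
    using assms by (simp_all add: m_def)
  have mA: "real (m n) = A n * (N n)\<^sup>2" for n
    using N[of n] by (simp add: A_def)
  have Aub: "A n \<le> 4 / s" and Alb: "4 / s - (1 / N n)\<^sup>2 \<le> A n" for n
  proof -
    show "A n \<le> 4 / s"
      using mub[of n] N[of n] assms by (simp add: A_def divide_simps)
    have "(4 * (N n)\<^sup>2 / s - 1) / (N n)\<^sup>2 \<le> A n"
      unfolding A_def using mlb[of n] by (intro divide_right_mono) auto
    also have "(4 * (N n)\<^sup>2 / s - 1) / (N n)\<^sup>2 = 4 / s - (1 / N n)\<^sup>2"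
      using N[of n] assms by (simp add: field_simps power2_eq_square)
    finally show "4 / s - (1 / N n)\<^sup>2 \<le> A n" .
  qed
  have Alim: "A \<longlonglongrightarrow> 4 / s"
  proof (rule tendsto_sandwich[of "\<lambda>n. 4 / s - (1 / N n)\<^sup>2" A sequentially "\<lambda>_. 4 / s"])
    have "(\<lambda>n. 4 / s - (1 / N n)\<^sup>2) \<longlonglongrightarrow> 4 / s - 0\<^sup>2"
      by (intro tendsto_intros Ninv)
    then show "(\<lambda>n. 4 / s - (1 / N n)\<^sup>2) \<longlonglongrightarrow> 4 / s" by simp
  qed (use Aub Alb in \<open>auto intro: always_eventually\<close>)
  \<comment> \<open>Any positive constant below the limit \<open>4 / s\<close> yields a summable
    majorant independent of n.\<close>
  have Apos: "eventually (\<lambda>n. A n > 2 / s) sequentially"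
    using assms by (intro order_tendstoD(1)[OF Alim]) (simp add: divide_strict_right_mono)

  define f where "f n j = (if j \<in> {-int (Suc n)..<int (Suc n)} then cos (pi * (2 * real_of_int j + 1) / (4 * N n)) ^ (2 * m n) else 0)" for n j
  have x_le: "\<bar>pi * (2 * real_of_int j + 1) / (4 * N n)\<bar> \<le> pi / 2" if "j \<in> {-int (Suc n)..<int (Suc n)}" for n j
  proof -
    have "\<bar>2 * j + 1\<bar> \<le> 2 * int (Suc n)" using that by auto
    then have "real_of_int \<bar>2 * j + 1\<bar> \<le> real_of_int (2 * int (Suc n))"
      by (rule of_int_le_iff[THEN iffD2])
    then have "\<bar>2 * real_of_int j + 1\<bar> \<le> 2 * N n" by (simp add: N_def)
    then have "pi * \<bar>2 * real_of_int j + 1\<bar> \<le> pi * (2 * N n)" by (intro mult_left_mono) auto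
    then have "pi * \<bar>2 * real_of_int j + 1\<bar> / (4 * N n) \<le> pi * (2 * N n) / (4 * N n)"
      using N[of n] by (intro divide_right_mono) auto
    moreover have "\<bar>pi * (2 * real_of_int j + 1) / (4 * N n)\<bar> = pi * \<bar>2 * real_of_int j + 1\<bar> / (4 * N n)"
      unfolding abs_divide abs_mult using N[of n] by simp
    ultimately show ?thesis using N[of n] by simp
  qed
  have mx: "real (m n) * (pi * (2 * real_of_int j + 1) / (4 * N n))\<^sup>2 = A n * (pi\<^sup>2 / 16) * (2 * real_of_int j + 1)\<^sup>2" for n j
    unfolding mA using N[of n] by (simp add: field_simps power2_eq_square)
  have f_ub: "f n j \<le> exp (- (A n * (pi\<^sup>2 / 16) * (2 * real_of_int j + 1)\<^sup>2))" and f_nn: "0 \<le> f n j" for n j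
  proof -
    define x where "x = pi * (2 * real_of_int j + 1) / (4 * N n)"
    show "0 \<le> f n j" unfolding f_def by (simp add: power_mult)
    show "f n j \<le> exp (- (A n * (pi\<^sup>2 / 16) * (2 * real_of_int j + 1)\<^sup>2))"
    proof (cases "j \<in> {-int (Suc n)..<int (Suc n)}")
      case True
      have "\<bar>x\<bar> \<le> pi / 2" unfolding x_def using x_le[OF True] .
      then have "0 \<le> cos x" "cos x \<le> exp (- x\<^sup>2 / 2)"
        using cos_le_exp[of x] by (auto intro!: cos_ge_zero)
      then have "cos x ^ (2 * m n) \<le> exp (- x\<^sup>2 / 2) ^ (2 * m n)"
        by (intro power_mono)
      also have "\<dots> = exp (- (real (m n) * x\<^sup>2))"
        by (simp flip: exp_of_nat_mult)
      finally show ?thesis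
        using True unfolding f_def x_def mx by simp
    qed (auto simp: f_def)
  qed
  have f_lim: "(\<lambda>n. f n j) \<longlonglongrightarrow> exp (- (pi\<^sup>2 / (4 * s)) * (2 * real_of_int j + 1)\<^sup>2)" for j
  proof (rule tendsto_sandwich)
    define x where "x n = pi * (2 * real_of_int j + 1) / (4 * N n)" for n
    have xlim: "x \<longlonglongrightarrow> 0"
    proof -
      have "(\<lambda>n. pi * (2 * real_of_int j + 1) / 4 * (1 / N n)) \<longlonglongrightarrow> pi * (2 * real_of_int j + 1) / 4 * 0"
        by (intro tendsto_intros Ninv)
      then show ?thesis by (simp add: x_def[abs_def])
    qed
    have "eventually (\<lambda>n. (x n)\<^sup>2 < 2) sequentially"
      using tendsto_power[OF xlim, of 2] by (intro order_tendstoD(2)[of _ "0\<^sup>2"]) auto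
    moreover have "eventually (\<lambda>n. \<bar>j\<bar> < int (Suc n)) sequentially"
      using eventually_ge_at_top[of "nat \<bar>j\<bar>"] by eventually_elim linarith
    ultimately show "eventually (\<lambda>n. exp (- (A n * (pi\<^sup>2 / 16) * (2 * real_of_int j + 1)\<^sup>2 / (1 - (x n)\<^sup>2 / 2))) \<le> f n j) sequentially"
    proof eventually_elim
      case (elim n)
      have "exp (- ((x n)\<^sup>2 / 2) / (1 - (x n)\<^sup>2 / 2)) ^ (2 * m n) \<le> cos (x n) ^ (2 * m n)"
        using elim(1) by (intro power_mono cos_ge_exp) auto
      also have "exp (- ((x n)\<^sup>2 / 2) / (1 - (x n)\<^sup>2 / 2)) ^ (2 * m n) = exp (- (real (m n) * (x n)\<^sup>2 / (1 - (x n)\<^sup>2 / 2)))"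
      proof -
        have "exp (- (y / 2) / D) ^ (2 * M) = exp (- (real M * y / D))" for y D :: real and M
          by (simp flip: exp_of_nat_mult)
        then show ?thesis .
      qed
      also have "real (m n) * (x n)\<^sup>2 = A n * (pi\<^sup>2 / 16) * (2 * real_of_int j + 1)\<^sup>2"
        unfolding x_def by (rule mx)
      also have "cos (x n) ^ (2 * m n) = f n j"
        using elim(2) by (auto simp: f_def x_def)
      finally show ?case .
    qed
    show "eventually (\<lambda>n. f n j \<le> exp (- (A n * (pi\<^sup>2 / 16) * (2 * real_of_int j + 1)\<^sup>2))) sequentially"
      using f_ub by (intro always_eventually allI)
    have eq: "4 / s * (pi\<^sup>2 / 16) * (2 * real_of_int j + 1)\<^sup>2 = pi\<^sup>2 / (4 * s) * (2 * real_of_int j + 1)\<^sup>2"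
      by simp
    have "(\<lambda>n. exp (- (A n * (pi\<^sup>2 / 16) * (2 * real_of_int j + 1)\<^sup>2))) \<longlonglongrightarrow> exp (- (4 / s * (pi\<^sup>2 / 16) * (2 * real_of_int j + 1)\<^sup>2))"
      by (intro tendsto_intros Alim)
    then show "(\<lambda>n. exp (- (A n * (pi\<^sup>2 / 16) * (2 * real_of_int j + 1)\<^sup>2))) \<longlonglongrightarrow> exp (- (pi\<^sup>2 / (4 * s)) * (2 * real_of_int j + 1)\<^sup>2)"
      unfolding eq by simp
    have "(\<lambda>n. exp (- (A n * (pi\<^sup>2 / 16) * (2 * real_of_int j + 1)\<^sup>2 / (1 - (x n)\<^sup>2 / 2)))) \<longlonglongrightarrow> exp (- (4 / s * (pi\<^sup>2 / 16) * (2 * real_of_int j + 1)\<^sup>2 / (1 - 0\<^sup>2 / 2)))"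
      by (intro tendsto_intros Alim xlim) auto
    then show "(\<lambda>n. exp (- (A n * (pi\<^sup>2 / 16) * (2 * real_of_int j + 1)\<^sup>2 / (1 - (x n)\<^sup>2 / 2)))) \<longlonglongrightarrow> exp (- (pi\<^sup>2 / (4 * s)) * (2 * real_of_int j + 1)\<^sup>2)"
      unfolding eq by simp
  qed
  have LHS: "(\<lambda>n. infsum (f n) UNIV) \<longlonglongrightarrow> infsum (\<lambda>j::int. exp (- (pi\<^sup>2 / (4 * s)) * (2 * real_of_int j + 1)\<^sup>2)) UNIV"
  proof (rule tannery_int[OF f_lim])
    show "eventually (\<lambda>n. \<forall>j. norm (f n j) \<le> exp (- (2 / s * (pi\<^sup>2 / 16)) * (2 * real_of_int j + 1)\<^sup>2)) sequentially"
      using Apos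
    proof eventually_elim
      case (elim n)
      show ?case
      proof
        fix j
        have "2 / s * (pi\<^sup>2 / 16) * (2 * real_of_int j + 1)\<^sup>2 \<le> A n * (pi\<^sup>2 / 16) * (2 * real_of_int j + 1)\<^sup>2"
          using elim by (intro mult_right_mono) auto
        then have "exp (- (A n * (pi\<^sup>2 / 16) * (2 * real_of_int j + 1)\<^sup>2)) \<le> exp (- (2 / s * (pi\<^sup>2 / 16)) * (2 * real_of_int j + 1)\<^sup>2)"
          by simp
        then show "norm (f n j) \<le> exp (- (2 / s * (pi\<^sup>2 / 16)) * (2 * real_of_int j + 1)\<^sup>2)"
          unfolding real_norm_def abs_of_nonneg[OF f_nn] by (rule order_trans[OF f_ub])
      qed
    qed
    show "(\<lambda>j::int. exp (- (2 / s * (pi\<^sup>2 / 16)) * (2 * real_of_int j + 1)\<^sup>2)) summable_on UNIV"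
      using assms by (intro exp_quadratic_summable) simp
  qed

  define c where "c m = real (2 * m choose m) / 4 ^ m" for m
  define b where "b n = 2 * N n * c (m n)" for n
  define r where "r k n = nat \<bar>k\<bar> * (2 * Suc n)" for k :: int and n
  have r: "real (r k n) = 2 * \<bar>real_of_int k\<bar> * N n" for k n
    by (simp add: r_def N_def algebra_simps)
  define g where "g n k = (- 1) powi k * (2 * N n * (real (2 * m n choose (m n + r k n)) / 4 ^ m n))" for n k
  have minf: "filterlim m sequentially sequentially"
  proof -
    have "Z \<le> m n" if n: "nat \<lceil>s * (real Z + 1)\<rceil> \<le> n" for Z n
    proof -
      have "s * (real Z + 1) \<le> N n"
        using n unfolding N_def by linarith
      also have "N n \<le> 4 * (N n)\<^sup>2"
        unfolding power2_eq_square N_def by (simp add: algebra_simps)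
      finally have "real Z + 1 \<le> 4 * (N n)\<^sup>2 / s"
        using assms by (simp add: pos_le_divide_eq mult.commute)
      with mlb[of n] show ?thesis by linarith
    qed
    then show ?thesis
      unfolding filterlim_at_top eventually_sequentially by blast
  qed
  \<comment> \<open>By Wallis the prefactor behaves like \<open>2 N / sqrt (pi m)\<close>, and m is
    about \<open>4 N^2 / s\<close>.\<close>
  have blim: "b \<longlonglongrightarrow> sqrt (s / pi)"
  proof -
    have "(\<lambda>n. sqrt (4 / (2 * A n + (1 / N n)\<^sup>2)) * (sqrt (2 * real (m n) + 1) * c (m n))) \<longlonglongrightarrow> sqrt (4 / (2 * (4 / s) + 0\<^sup>2)) * sqrt (2 / pi)"
      unfolding c_def using assms by (intro tendsto_mult tendsto_intros Alim Ninv filterlim_compose[OF wallis_binomial minf]) auto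
    moreover have "sqrt (4 / (2 * A n + (1 / N n)\<^sup>2)) * (sqrt (2 * real (m n) + 1) * c (m n)) = b n" for n
    proof -
      have "4 / (2 * A n + (1 / N n)\<^sup>2) * (2 * real (m n) + 1) = (2 * N n)\<^sup>2"
      proof -
        have "2 * real (m n) + 1 = (N n)\<^sup>2 * (2 * A n + (1 / N n)\<^sup>2)"
          unfolding mA using N[of n] by (simp add: field_simps power2_eq_square)
        moreover have "2 * A n + (1 / N n)\<^sup>2 > 0"
          using N[of n] by (intro add_nonneg_pos) (auto simp: A_def)
        ultimately show ?thesis by (simp add: power_mult_distrib)
      qed
      then have "sqrt (4 / (2 * A n + (1 / N n)\<^sup>2)) * sqrt (2 * real (m n) + 1) = \<bar>2 * N n\<bar>"
        by (simp only: real_sqrt_mult[symmetric] real_sqrt_abs)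
      also have "\<dots> = 2 * N n"
        using N[of n] by simp
      finally have "sqrt (4 / (2 * A n + (1 / N n)\<^sup>2)) * sqrt (2 * real (m n) + 1) = 2 * N n" .
      then show ?thesis by (simp add: b_def mult.assoc[symmetric])
    qed
    moreover have "sqrt (4 / (2 * (4 / s) + 0\<^sup>2)) * sqrt (2 / pi) = sqrt (s / pi)"
      using assms by (simp flip: real_sqrt_mult)
    ultimately show ?thesis by simp
  qed
  have b_nn: "0 \<le> b n" for n
    using N[of n] by (simp add: b_def c_def)
  \<comment> \<open>Dividing by the central coefficient separates the prefactor b from the Gaussian
    decay in k.\<close>
  define R where "R n k = real (2 * m n choose (m n + r k n)) / real (2 * m n choose m n)" for n k
  have gR: "g n k = (- 1) powi k * (b n * R n k)" for n k
  proof -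
    have "real (2 * m n choose m n) > 0" by simp
    then show ?thesis by (simp add: g_def b_def c_def R_def)
  qed
  have R_nn: "0 \<le> R n k" for n k by (simp add: R_def)
  \<comment> \<open>The first bound is sharp in the limit, the second is the majorant: a nonzero
    coefficient requires \<open>r \<le> m\<close>, so \<open>m + r\<close> is at most
    \<open>8 N^2 / s\<close>, which still leaves half of the exponent.\<close>
  have R_ub: "R n k \<le> exp (- (4 * (real_of_int k)\<^sup>2 / (A n + 2 * \<bar>real_of_int k\<bar> * (1 / N n))))"
    and R_ub2: "R n k \<le> exp (- (s / 2) * (real_of_int k)\<^sup>2)" for n k
  proof -
    have *: "R n k \<le> exp (- (4 * (real_of_int k)\<^sup>2 / (A n + 2 * \<bar>real_of_int k\<bar> * (1 / N n)))) \<and> R n k \<le> exp (- (s / 2) * (real_of_int k)\<^sup>2)"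
    proof (cases "r k n \<le> m n")
      case True
      have "R n k \<le> exp (- (real (r k n))\<^sup>2 / (real (m n) + real (r k n)))"
        unfolding R_def using binomial_central_upper[OF True] by (simp add: pos_divide_le_eq mult.commute)
      also have "- (real (r k n))\<^sup>2 / (real (m n) + real (r k n)) = - (4 * (real_of_int k)\<^sup>2 / (A n + 2 * \<bar>real_of_int k\<bar> * (1 / N n)))"
      proof -
        have "real (m n) + real (r k n) = (N n)\<^sup>2 * (A n + 2 * \<bar>real_of_int k\<bar> * (1 / N n))"
          unfolding mA r using N[of n] by (simp add: field_simps power2_eq_square)
        moreover have "(real (r k n))\<^sup>2 = (N n)\<^sup>2 * (4 * (real_of_int k)\<^sup>2)"
          unfolding r by (simp add: power_mult_distrib)
        ultimately show ?thesis using N[of n] by simp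
      qed
      finally have 1: "R n k \<le> exp (- (4 * (real_of_int k)\<^sup>2 / (A n + 2 * \<bar>real_of_int k\<bar> * (1 / N n))))" .
      have "2 * \<bar>real_of_int k\<bar> * N n \<le> A n * (N n)\<^sup>2"
        using True unfolding mA[symmetric] r[symmetric] by simp
      then have "2 * \<bar>real_of_int k\<bar> * (1 / N n) \<le> A n"
        using N[of n] by (simp add: field_simps power2_eq_square)
      then have le: "A n + 2 * \<bar>real_of_int k\<bar> * (1 / N n) \<le> 8 / s"
        using Aub[of n] by simp
      have "exp (- (4 * (real_of_int k)\<^sup>2 / (A n + 2 * \<bar>real_of_int k\<bar> * (1 / N n)))) \<le> exp (- (s / 2) * (real_of_int k)\<^sup>2)"
      proof (cases "k = 0")
        case False
        have pos: "0 < A n + 2 * \<bar>real_of_int k\<bar> * (1 / N n)"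
          using False N[of n] by (intro add_nonneg_pos) (auto simp: A_def)
        have "s / 2 * (real_of_int k)\<^sup>2 = 4 * (real_of_int k)\<^sup>2 / (8 / s)"
          using assms by simp
        also have "\<dots> \<le> 4 * (real_of_int k)\<^sup>2 / (A n + 2 * \<bar>real_of_int k\<bar> * (1 / N n))"
          using le pos assms by (intro divide_left_mono mult_pos_pos) auto
        finally show ?thesis by simp
      qed simp
      with 1 show ?thesis by linarith
    next
      case False
      then have "2 * m n < m n + r k n" by simp
      then have "2 * m n choose (m n + r k n) = 0" by (rule binomial_eq_0)
      then have "R n k = 0" unfolding R_def by (simp only: of_nat_0 div_0)
      then show ?thesis by simp
    qed
    then show "R n k \<le> exp (- (4 * (real_of_int k)\<^sup>2 / (A n + 2 * \<bar>real_of_int k\<bar> * (1 / N n))))" "R n k \<le> exp (- (s / 2) * (real_of_int k)\<^sup>2)"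
      by auto
  qed
  have Rlim: "(\<lambda>n. R n k) \<longlonglongrightarrow> exp (- s * (real_of_int k)\<^sup>2)" for k
  proof (rule tendsto_sandwich[of "\<lambda>n. exp (- (4 * (real_of_int k)\<^sup>2 / (A n + (- 2) * \<bar>real_of_int k\<bar> * (1 / N n))))" "\<lambda>n. R n k" sequentially
      "\<lambda>n. exp (- (4 * (real_of_int k)\<^sup>2 / (A n + 2 * \<bar>real_of_int k\<bar> * (1 / N n))))"])
    show "eventually (\<lambda>n. R n k \<le> exp (- (4 * (real_of_int k)\<^sup>2 / (A n + 2 * \<bar>real_of_int k\<bar> * (1 / N n))))) sequentially"
      using R_ub by (intro always_eventually allI)
    \<comment> \<open>The parameter e treats the upper bound (\<open>e = 2\<close>) and the lower
      bound (\<open>e = -2\<close>) at once.\<close>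
    have lim: "(\<lambda>n. A n + e * \<bar>real_of_int k\<bar> * (1 / N n)) \<longlonglongrightarrow> 4 / s + e * \<bar>real_of_int k\<bar> * 0" for e
      by (intro tendsto_intros Alim Ninv)
    have "(\<lambda>n. exp (- (4 * (real_of_int k)\<^sup>2 / (A n + e * \<bar>real_of_int k\<bar> * (1 / N n))))) \<longlonglongrightarrow> exp (- (4 * (real_of_int k)\<^sup>2 / (4 / s + e * \<bar>real_of_int k\<bar> * 0)))" for e
      using assms by (intro tendsto_intros lim) auto
    moreover have "exp (- (4 * (real_of_int k)\<^sup>2 / (4 / s + e * \<bar>real_of_int k\<bar> * 0))) = exp (- s * (real_of_int k)\<^sup>2)" for e
      by simp
    ultimately have lim2: "(\<lambda>n. exp (- (4 * (real_of_int k)\<^sup>2 / (A n + e * \<bar>real_of_int k\<bar> * (1 / N n))))) \<longlonglongrightarrow> exp (- s * (real_of_int k)\<^sup>2)" for e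
      by (simp add: mult.commute)
    show "(\<lambda>n. exp (- (4 * (real_of_int k)\<^sup>2 / (A n + 2 * \<bar>real_of_int k\<bar> * (1 / N n))))) \<longlonglongrightarrow> exp (- s * (real_of_int k)\<^sup>2)"
      by (rule lim2)
    show "(\<lambda>n. exp (- (4 * (real_of_int k)\<^sup>2 / (A n + (- 2) * \<bar>real_of_int k\<bar> * (1 / N n))))) \<longlonglongrightarrow> exp (- s * (real_of_int k)\<^sup>2)"
      by (rule lim2)
    have "eventually (\<lambda>n. A n + (- 2) * \<bar>real_of_int k\<bar> * (1 / N n) > 0) sequentially"
      using assms by (intro order_tendstoD(1)[OF lim]) simp
    then show "eventually (\<lambda>n. exp (- (4 * (real_of_int k)\<^sup>2 / (A n + (- 2) * \<bar>real_of_int k\<bar> * (1 / N n)))) \<le> R n k) sequentially"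
    proof eventually_elim
      case (elim n)
      have eq: "real (m n) - real (r k n) = (N n)\<^sup>2 * (A n + (- 2) * \<bar>real_of_int k\<bar> * (1 / N n))"
        unfolding mA r using N[of n] by (simp add: field_simps power2_eq_square)
      moreover have "(real (r k n))\<^sup>2 = (N n)\<^sup>2 * (4 * (real_of_int k)\<^sup>2)"
        unfolding r by (simp add: power_mult_distrib)
      ultimately have eq2: "- (real (r k n))\<^sup>2 / (real (m n) - real (r k n)) = - (4 * (real_of_int k)\<^sup>2 / (A n + (- 2) * \<bar>real_of_int k\<bar> * (1 / N n)))"
        using N[of n] by simp
      have "real (m n) - real (r k n) > 0"
        unfolding eq using elim N[of n] by (intro mult_pos_pos) auto
      then have "r k n < m n" by simp
      from binomial_central_lower[OF this] show ?case
        unfolding R_def eq2 by (simp add: pos_le_divide_eq mult.commute)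
    qed
  qed
  obtain B where B: "\<And>n. b n \<le> B"
  proof -
    have "Bseq b" using blim by (intro convergent_imp_Bseq convergentI)
    then obtain B where "\<And>n. norm (b n) \<le> B" unfolding Bseq_def by blast
    then show ?thesis using that[of B] b_nn by simp
  qed
  have "(\<lambda>n. infsum (g n) UNIV) \<longlonglongrightarrow> infsum (\<lambda>k::int. (- 1) powi k * (sqrt (s / pi) * exp (- s * (real_of_int k)\<^sup>2))) UNIV"
  proof (rule tannery_int)
    show "(\<lambda>n. g n k) \<longlonglongrightarrow> (- 1) powi k * (sqrt (s / pi) * exp (- s * (real_of_int k)\<^sup>2))" for k
      unfolding gR by (intro tendsto_mult tendsto_const blim Rlim)
    have "norm (g n k) \<le> B * exp (- (s / 2) * (real_of_int k)\<^sup>2)" for n k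
    proof -
      have "norm (g n k) = b n * R n k"
        unfolding gR using b_nn[of n] R_nn[of n k] by (simp add: abs_mult power_int_minus_left)
      also have "\<dots> \<le> B * exp (- (s / 2) * (real_of_int k)\<^sup>2)"
        using B[of n] R_ub2[of n k] b_nn[of n] R_nn[of n k] by (intro mult_mono) auto
      finally show ?thesis .
    qed
    then show "eventually (\<lambda>n. \<forall>k. norm (g n k) \<le> B * exp (- (s / 2) * (real_of_int k)\<^sup>2)) sequentially"
      by (intro always_eventually) auto
    show "(\<lambda>k::int. B * exp (- (s / 2) * (real_of_int k)\<^sup>2)) summable_on UNIV"
      using assms by (intro summable_on_cmult_right exp_quadratic_summable) simp
  qed
  moreover have "infsum (f n) UNIV = infsum (g n) UNIV" for n
  proof -
    have "infsum (f n) UNIV = infsum (f n) {-int (Suc n)..<int (Suc n)}"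
      by (rule infsum_cong_neutral) (auto simp: f_def)
    also have "\<dots> = (\<Sum>j\<in>{-int (Suc n)..<int (Suc n)}. cos (pi * (2 * real_of_int j + 1) / (4 * N n)) ^ (2 * m n))"
      unfolding infsum_finite[OF finite_atLeastLessThan_int] by (rule sum.cong) (auto simp: f_def)
    also have "\<dots> = infsum (g n) UNIV"
      using finite_theta_transformation[of "Suc n" "m n"] unfolding N_def g_def r_def by simp
    finally show ?thesis .
  qed
  ultimately have "infsum (\<lambda>j::int. exp (- (pi\<^sup>2 / (4 * s)) * (2 * real_of_int j + 1)\<^sup>2)) UNIV
     = infsum (\<lambda>k::int. (- 1) powi k * (sqrt (s / pi) * exp (- s * (real_of_int k)\<^sup>2))) UNIV"
    using LHS by (simp add: LIMSEQ_unique)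
  also have "\<dots> = infsum (\<lambda>k::int. sqrt (s / pi) * ((- 1) powi k * exp (- s * (real_of_int k)\<^sup>2))) UNIV"
    by (simp only: mult.left_commute)
  also have "\<dots> = sqrt (s / pi) * infsum (\<lambda>k::int. (- 1) powi k * exp (- s * (real_of_int k)\<^sup>2)) UNIV"
    by (rule infsum_cmult_right')
  finally show ?thesis .
qed

subsection \<open>The value at the fixed point and the integrals\<close>

text \<open>Gauss's product for psi. The two-sided series meets every triangular number twice, and
  on the product side the factor 2 is the first factor of \<open>qpoch (- 1) p\<close>.\<close>

lemma psi_eq_euler_E:
  fixes p :: real
  assumes "0 < p" "p < 1"
  shows "infsum (jtp_term p p) UNIV = 2 * (euler_E (p\<^sup>2))\<^sup>2 / euler_E p"
proof -
  have "infsum (jtp_term p p) UNIV = qpoch p p * (qpoch (- p) p * qpoch (- 1) p)"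
    using jacobi_triple_product[of p p] assms by (simp add: has_sum_iff)
  also have "qpoch (- 1) p = 2 * qpoch (- p) p"
    using qpoch_rec[of p "- 1"] assms by simp
  finally have "infsum (jtp_term p p) UNIV * qpoch p p = 2 * (qpoch p p * qpoch (- p) p)\<^sup>2"
    by (simp add: power2_eq_square mult_ac)
  also have "qpoch p p * qpoch (- p) p = euler_E (p\<^sup>2)"
    using assms by (simp add: qpoch_mult_minus euler_E_eq_qpoch)
  finally show ?thesis
    using euler_E_pos[of p] assms by (simp add: euler_E_eq_qpoch field_simps)
qed

text \<open>Both sides of the theta transformation are eta quotients: phi at \<open>- q\<close> on
  one side and, after removing the term \<open>j = 0\<close>, psi at p on the other.\<close>

lemma euler_E_transformation:
  fixes s :: real
  assumes "s > 0"
  defines "q \<equiv> exp (- s)" and "p \<equiv> exp (- (2 * pi\<^sup>2 / s))"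
  shows "exp (- (pi\<^sup>2 / (4 * s))) * (2 * (euler_E (p\<^sup>2))\<^sup>2 / euler_E p) = sqrt (s / pi) * ((euler_E q)\<^sup>2 / euler_E (q\<^sup>2))"
proof -
  have q: "0 < q" "q < 1" and p: "0 < p" "p < 1"
    using assms by (auto simp: q_def p_def)
  have pw: "exp a powi k = exp (real_of_int k * a)" for a :: real and k :: int
    by (simp add: exp_power_int)
  have "jtp_term (q\<^sup>2) (- q) k = (- 1) powi k * exp (- s * (real_of_int k)\<^sup>2)" for k
  proof -
    have "jtp_term (q\<^sup>2) (- q) k = (- 1) powi k * q powi (k * k)"
      using jtp_term_quadratic[of q 1 1 k] q by (simp add: algebra_simps power2_eq_square)
    also have "q powi (k * k) = exp (- s * (real_of_int k)\<^sup>2)"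
      unfolding q_def pw by (simp add: power2_eq_square mult_ac)
    finally show ?thesis .
  qed
  then have "jtp_term (q\<^sup>2) (- q) = (\<lambda>k. (- 1) powi k * exp (- s * (real_of_int k)\<^sup>2))"
    by (rule ext)
  then have 1: "infsum (\<lambda>k::int. (- 1) powi k * exp (- s * (real_of_int k)\<^sup>2)) UNIV = (euler_E q)\<^sup>2 / euler_E (q\<^sup>2)"
    using phi_eq_euler_E[OF q] by (simp only:)
  have "exp (- (pi\<^sup>2 / (4 * s)) * (2 * real_of_int j + 1)\<^sup>2) = exp (- (pi\<^sup>2 / (4 * s))) * jtp_term p p j" for j :: int
  proof -
    have triangular: "2 * real_of_int (triangular j) = real_of_int j * (real_of_int j - 1)"
      using arg_cong[OF two_triangular[of j], of real_of_int] by simp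
    have "exp (- (pi\<^sup>2 / (4 * s))) * jtp_term p p j
       = exp (- (pi\<^sup>2 / (4 * s)) + (real_of_int (triangular j) * - (2 * pi\<^sup>2 / s) + real_of_int j * - (2 * pi\<^sup>2 / s)))"
      unfolding p_def by (simp only: jtp_term_def pw exp_add)
    also have "- (pi\<^sup>2 / (4 * s)) + (real_of_int (triangular j) * - (2 * pi\<^sup>2 / s) + real_of_int j * - (2 * pi\<^sup>2 / s))
       = - (pi\<^sup>2 / (4 * s)) * (1 + 4 * (2 * real_of_int (triangular j)) + 8 * real_of_int j)"
      using assms by (simp add: field_simps)
    also have "\<dots> = - (pi\<^sup>2 / (4 * s)) * (2 * real_of_int j + 1)\<^sup>2"
      unfolding triangular by (simp add: algebra_simps power2_eq_square)
    finally show ?thesis by simp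
  qed
  then have 2: "infsum (\<lambda>j::int. exp (- (pi\<^sup>2 / (4 * s)) * (2 * real_of_int j + 1)\<^sup>2)) UNIV
      = exp (- (pi\<^sup>2 / (4 * s))) * (2 * (euler_E (p\<^sup>2))\<^sup>2 / euler_E p)"
    unfolding psi_eq_euler_E[OF p, symmetric] infsum_cmult_right'[symmetric] by (simp only:)
  show ?thesis
    using theta_transformation[OF assms(1)] unfolding 1 2 .
qed

lemma hauptmodul_fixed_point: "hauptmodul (exp (- 2 * pi / sqrt 10)) = 4 + 2 * sqrt 5"
proof -
  define Q where "Q = exp (- 2 * pi / sqrt 10)"
  \<comment> \<open>The fourth root of Q: the squared exponential prefactors of both transformations
    are powers of w.\<close>
  define w where "w = exp (- (pi / (2 * sqrt 10)))"
  define R where "R = sqrt 10"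
  have R: "R > 0" "R * R = 10" by (simp_all add: R_def)
  have Q: "0 < Q" "Q < 1" by (simp_all add: Q_def)
  have w: "w > 0" by (simp add: w_def)
  define a b c d where E: "a = euler_E Q" "b = euler_E (Q ^ 2)" "c = euler_E (Q ^ 5)" "d = euler_E (Q ^ 10)"
  have pos: "a > 0" "b > 0" "c > 0" "d > 0"
    unfolding E using Q by (auto intro!: euler_E_pos simp: power_less_one_iff)
  have Qw: "Q = w ^ 4"
    unfolding Q_def w_def by (simp flip: exp_of_nat_mult)
  define s where "s = 2 * pi / R"
  have s: "s > 0" using R by (simp add: s_def)
  have q1: "exp (- s) = Q" by (simp add: s_def Q_def R_def)
  have q5: "exp (- (5 * s)) = Q ^ 5"
    unfolding q1[symmetric] by (simp flip: exp_of_nat_mult)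
  \<comment> \<open>The fixed-point property: the transformation at s leads from Q to
    \<open>Q^5\<close>, the one at \<open>5 s\<close> back from \<open>Q^5\<close> to Q.\<close>
  have ss: "2 * pi\<^sup>2 / s = 5 * s" "2 * pi\<^sup>2 / (5 * s) = s"
    using R by (simp_all add: s_def field_simps power2_eq_square)
  have p1: "exp (- (pi\<^sup>2 / (4 * s))) ^ 2 = w ^ 5"
  proof -
    have "2 * (pi\<^sup>2 / (4 * s)) = 5 * (pi / (2 * R))"
      using R by (simp add: s_def field_simps power2_eq_square)
    then have "real 2 * - (pi\<^sup>2 / (4 * s)) = real 5 * - (pi / (2 * R))" by simp
    then show ?thesis
      unfolding w_def R_def[symmetric] exp_of_nat_mult[symmetric] by (simp only:)
  qed
  have p2: "exp (- (pi\<^sup>2 / (4 * (5 * s)))) ^ 2 = w"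
  proof -
    have "2 * (pi\<^sup>2 / (4 * (5 * s))) = pi / (2 * R)"
      using R by (simp add: s_def field_simps power2_eq_square)
    then have "real 2 * - (pi\<^sup>2 / (4 * (5 * s))) = - (pi / (2 * R))" by simp
    then show ?thesis
      unfolding w_def R_def[symmetric] exp_of_nat_mult[symmetric] by (simp only:)
  qed
  have "exp (- (pi\<^sup>2 / (4 * s))) * (2 * d\<^sup>2 / c) = sqrt (s / pi) * (a\<^sup>2 / b)"
    using euler_E_transformation[OF s] unfolding ss q1 q5 by (simp add: E flip: power_mult)
  then have "(exp (- (pi\<^sup>2 / (4 * s))) * (2 * d\<^sup>2 / c))\<^sup>2 = (sqrt (s / pi) * (a\<^sup>2 / b))\<^sup>2"
    by (simp only:)
  then have "w ^ 5 * (2 * d\<^sup>2 / c)\<^sup>2 = 2 / R * (a\<^sup>2 / b)\<^sup>2"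
    unfolding power_mult_distrib[of "exp _"] p1 power_mult_distrib[of "sqrt _"] using R by (simp add: s_def)
  then have X: "(a\<^sup>2 * c / (b * d\<^sup>2))\<^sup>2 = 2 * R * w ^ 5"
    using pos R by (simp add: field_simps eval_nat_numeral)
  have "exp (- (pi\<^sup>2 / (4 * (5 * s)))) * (2 * b\<^sup>2 / a) = sqrt (5 * s / pi) * (c\<^sup>2 / d)"
    using euler_E_transformation[of "5 * s"] s unfolding ss q1 q5 by (simp add: E flip: power_mult)
  then have "(exp (- (pi\<^sup>2 / (4 * (5 * s)))) * (2 * b\<^sup>2 / a))\<^sup>2 = (sqrt (5 * s / pi) * (c\<^sup>2 / d))\<^sup>2"
    by (simp only:)
  then have "w * (2 * b\<^sup>2 / a)\<^sup>2 = 10 / R * (c\<^sup>2 / d)\<^sup>2"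
    unfolding power_mult_distrib[of "exp _"] p2 power_mult_distrib[of "sqrt _"] using R by (simp add: s_def)
  then have Y: "(a * c\<^sup>2 / (b\<^sup>2 * d))\<^sup>2 * 10 = 4 * w * R"
    using pos R by (simp add: field_simps eval_nat_numeral)
  define A where "A = a ^ 3 * c / (Q * b * d ^ 3)"
  have "A > 0" using pos Q by (simp add: A_def)
  \<comment> \<open>With \<open>X0\<close> and \<open>Y0\<close> for the eta quotients squared in X
    and Y, \<open>(Q * A)^3 * Y0 = X0^5\<close>. Squaring this makes both relations applicable, and
    w cancels.\<close>
  have "(A\<^sup>2) ^ 3 * (w ^ 24 * (a * c\<^sup>2 / (b\<^sup>2 * d))\<^sup>2) = ((a\<^sup>2 * c / (b * d\<^sup>2))\<^sup>2) ^ 5"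
    unfolding A_def Qw using pos w by (simp add: divide_simps) (simp add: power_mult_distrib mult_ac flip: power_mult power_add)
  also have "\<dots> = (2 * R * w ^ 5) ^ 5"
    unfolding X ..
  also have "\<dots> = 3200 * R * w ^ 25"
  proof -
    have "R ^ 5 = (R * R) * (R * R) * R" by (simp add: eval_nat_numeral)
    then have "R ^ 5 = 100 * R" unfolding R by simp
    then show ?thesis by (simp add: power_mult_distrib flip: power_mult)
  qed
  finally have "(A\<^sup>2) ^ 3 * w ^ 24 * ((a * c\<^sup>2 / (b\<^sup>2 * d))\<^sup>2 * 10) = 32000 * R * w ^ 25"
    by simp
  then have "(A\<^sup>2) ^ 3 * (4 * R * w ^ 25) = 20 ^ 3 * (4 * R * w ^ 25)"
    unfolding Y by (simp add: mult_ac eval_nat_numeral)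
  then have "(A\<^sup>2) ^ 3 = 20 ^ 3"
    using w R by simp
  then have "A\<^sup>2 = 20"
    by (rule power_eq_imp_eq_base) auto
  then have "A = sqrt 20"
    using \<open>A > 0\<close> by (simp add: real_sqrt_unique)
  also have "sqrt 20 = sqrt (2\<^sup>2 * 5)" by simp
  also have "\<dots> = 2 * sqrt 5" by (simp only: real_sqrt_mult real_sqrt_abs abs_numeral)
  finally have "A = 2 * sqrt 5" .
  then show ?thesis
    using hauptmodul_minus_4[OF Q] unfolding A_def E Q_def[symmetric] by simp
qed

section \<open>Integration in the variable k\<close>

lemma ramanujan_k_pos: "0 < q \<Longrightarrow> q < 1 \<Longrightarrow> ramanujan_k q > 0"
  using ramanujan_k_eq_exp[of q] by simp

text \<open>The first quantity is \<open>k (h - 4)\<close>, positive because \<open>h - 4\<close> is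
  an eta quotient; the other two are at least as large. So no primitive has a pole on the path of
  integration.\<close>

lemma ramanujan_k_denominators:
  assumes "0 \<le> q" "q < 1"
  shows "1 - 4 * ramanujan_k q - ramanujan_k q ^ 2 > 0" "1 + ramanujan_k q - ramanujan_k q ^ 2 > 0" "1 - ramanujan_k q ^ 2 > 0"
proof -
  define k where "k = ramanujan_k q"
  have k: "k \<ge> 0"
    using ramanujan_k_eq_exp[OF assms] assms by (simp add: k_def)
  have "1 - 4 * k - k ^ 2 > 0"
  proof (cases "q = 0")
    case True
    then show ?thesis by (simp add: k_def ramanujan_k_def)
  next
    case False
    with assms have q: "0 < q" "q < 1" by auto
    have "k > 0" unfolding k_def using q by (rule ramanujan_k_pos)
    have "euler_E q ^ 3 * euler_E (q ^ 5) / (q * euler_E (q ^ 2) * euler_E (q ^ 10) ^ 3) > 0"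
      using q by (intro divide_pos_pos mult_pos_pos zero_less_power euler_E_pos) (auto simp: power_less_one_iff)
    then have "1 / k - k - 4 > 0"
      using hauptmodul_minus_4[OF q] hauptmodul_eq_ramanujan_k[OF q] by (simp add: k_def)
    then have "k * (1 / k - k - 4) > 0"
      using \<open>k > 0\<close> by (rule mult_pos_pos[rotated])
    then show ?thesis
      using \<open>k > 0\<close> by (simp add: algebra_simps power2_eq_square)
  qed
  then show "1 - 4 * ramanujan_k q - ramanujan_k q ^ 2 > 0" "1 + ramanujan_k q - ramanujan_k q ^ 2 > 0" "1 - ramanujan_k q ^ 2 > 0"
    using k unfolding k_def by auto
qed

text \<open>Substitution \<open>y = k(q)\<close> in the fundamental theorem. At \<open>q = 0\<close>
  only continuity is asked for; inside the interval the hypothesis on F is an identity between eta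
  quotients.\<close>

lemma has_integral_ramanujan_k:
  assumes Q: "0 < Q" "Q < 1"
    and der: "\<And>q. 0 < q \<Longrightarrow> q < 1 \<Longrightarrow> (G has_real_derivative G' (ramanujan_k q)) (at (ramanujan_k q))"
    and cont: "isCont G 0"
    and eq: "\<And>q. 0 < q \<Longrightarrow> q < 1 \<Longrightarrow>
      G' (ramanujan_k q) * (ramanujan_k q * (euler_E q * euler_E (q ^ 2) ^ 2 * euler_E (q ^ 5) ^ 3 / euler_E (q ^ 10) ^ 2) / q) = F q"
  shows "(F has_integral (G (ramanujan_k Q) - G 0)) {0..Q}"
proof -
  have "(F has_integral (G (ramanujan_k Q) - G (ramanujan_k 0))) {0..Q}"
  proof (rule fundamental_theorem_of_calculus_interior)
    show "continuous_on {0..Q} (\<lambda>q. G (ramanujan_k q))"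
    proof (rule continuous_on_compose2[of "ramanujan_k ` {0..Q}" G])
      show "continuous_on (ramanujan_k ` {0..Q}) G"
      proof (rule continuous_at_imp_continuous_on, intro ballI)
        fix y assume "y \<in> ramanujan_k ` {0..Q}"
        then obtain q where q: "q \<in> {0..Q}" "y = ramanujan_k q" by auto
        show "isCont G y"
        proof (cases "q = 0")
          case True
          then show ?thesis using cont q by (simp add: ramanujan_k_def)
        next
          case False
          then show ?thesis using der[of q] q Q by (auto intro: DERIV_isCont)
        qed
      qed
      show "continuous_on {0..Q} ramanujan_k" using Q by (rule ramanujan_k_continuous)
    qed simp
    fix q assume "q \<in> {0<..<Q}"
    then have q: "0 < q" "q < 1" using Q by auto
    show "((\<lambda>q. G (ramanujan_k q)) has_vector_derivative F q) (at q)"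
      using DERIV_chain2[OF der[OF q] ramanujan_k_has_derivative[OF q]] eq[OF q]
      by (simp add: has_real_derivative_iff_has_vector_derivative)
  qed (use Q in auto)
  then show ?thesis by (simp add: ramanujan_k_def)
qed

theorem theorem2:
  shows "((\<lambda>q. euler_E q ^ 8 * euler_E (q ^ 10) ^ 3 / euler_E (q ^ 2) ^ 7)
            has_integral (1 - 2 * sqrt ((10 - 4 * sqrt 5) / 5))) {0 .. exp (- 2 * pi / sqrt 10)} \<and>
         ((\<lambda>q. q * euler_E q ^ 3 * euler_E (q ^ 10) ^ 8 / euler_E (q ^ 5) ^ 7)
            has_integral ((sqrt (10 - 4 * sqrt 5) - 1) / 4)) {0 .. exp (- 2 * pi / sqrt 10)} \<and>
         ((\<lambda>q. euler_E (q ^ 2) ^ 8 * euler_E (q ^ 5) ^ 3 / euler_E q ^ 7)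
            has_integral ((sqrt ((10 + 4 * sqrt 5) / 5) - 1) / 4)) {0 .. exp (- 2 * pi / sqrt 10)}"
proof -
  define Q where "Q = exp (- 2 * pi / sqrt 10)"
  have Q: "0 < Q" "Q < 1" by (simp_all add: Q_def)
  define K where "K = ramanujan_k Q"
  have K: "K > 0" unfolding K_def using Q by (rule ramanujan_k_pos)
  define r where "r = sqrt 5"
  have r: "r * r = 5" "r > 2"
    unfolding r_def by (auto intro: real_less_rsqrt)
  have h: "1 / K - K = 4 + 2 * r"
    using hauptmodul_fixed_point hauptmodul_eq_ramanujan_k[OF Q] unfolding Q_def[symmetric] K_def r_def by simp
  define S where "S = 1 / K + K"
  have S: "S > 0" "S\<^sup>2 = 40 + 16 * r"
  proof -
    show "S > 0" using K by (simp add: S_def add_pos_pos)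
    have "S\<^sup>2 = (1 / K - K)\<^sup>2 + 4"
      using K by (simp add: S_def power2_eq_square field_simps)
    also have "\<dots> = 40 + 16 * r"
      unfolding h using r by (simp add: power2_eq_square algebra_simps)
    finally show "S\<^sup>2 = 40 + 16 * r" .
  qed
  \<comment> \<open>Cancelling K leads back to S over \<open>h + 1\<close>, h and
    \<open>h - 4\<close>, with \<open>h = 4 + 2 r\<close>.\<close>
  have G: "(1 + K\<^sup>2) / (1 + K - K\<^sup>2) = S / (5 + 2 * r)" "(1 + K\<^sup>2) / (1 - K\<^sup>2) = S / (4 + 2 * r)"
    "(1 + K\<^sup>2) / (1 - 4 * K - K\<^sup>2) = S / (2 * r)"
  proof -
    have "1 + K\<^sup>2 = K * S" "1 + K - K\<^sup>2 = K * (1 / K - K + 1)" "1 - K\<^sup>2 = K * (1 / K - K)" "1 - 4 * K - K\<^sup>2 = K * (1 / K - K - 4)"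
      using K by (simp_all add: S_def algebra_simps power2_eq_square)
    then show "(1 + K\<^sup>2) / (1 + K - K\<^sup>2) = S / (5 + 2 * r)" "(1 + K\<^sup>2) / (1 - K\<^sup>2) = S / (4 + 2 * r)"
      "(1 + K\<^sup>2) / (1 - 4 * K - K\<^sup>2) = S / (2 * r)"
      unfolding h using K by simp_all
  qed
  have v1: "2 * sqrt ((10 - 4 * r) / 5) = S / (5 + 2 * r)"
  proof -
    have "(10 - 4 * r) / 5 = (40 + 16 * r) / (4 * (5 + 2 * r)\<^sup>2)"
    proof -
      \<comment> \<open>The two sides agree modulo \<open>r * r - 5\<close>; the last factor is the
        cofactor, obtained by polynomial division.\<close>
      have "(10 - 4 * r) * (4 * (5 + 2 * r)\<^sup>2) = (40 + 16 * r) * 5 + (r * r - 5) * (- 64 * r - 160)"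
        by (simp add: algebra_simps power2_eq_square)
      then have "(10 - 4 * r) * (4 * (5 + 2 * r)\<^sup>2) = (40 + 16 * r) * 5" using r by simp
      moreover have "5 + 2 * r \<noteq> 0" using r by simp
      ultimately show ?thesis by (subst frac_eq_eq) simp_all
    qed
    also have "\<dots> = (S / (2 * (5 + 2 * r)))\<^sup>2"
      unfolding S(2)[symmetric] power_divide power_mult_distrib by simp
    finally have "sqrt ((10 - 4 * r) / 5) = \<bar>S / (2 * (5 + 2 * r))\<bar>"
      by (simp only: real_sqrt_abs)
    then show ?thesis
      using S r by (simp add: field_simps)
  qed
  have v2: "sqrt (10 - 4 * r) = S / (4 + 2 * r)"
  proof -
    have "10 - 4 * r = (40 + 16 * r) / (4 + 2 * r)\<^sup>2"
    proof -
      have "(10 - 4 * r) * (4 + 2 * r)\<^sup>2 = (40 + 16 * r) + (r * r - 5) * (- 24 - 16 * r)"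
        by (simp add: algebra_simps power2_eq_square)
      then have "(10 - 4 * r) * (4 + 2 * r)\<^sup>2 = 40 + 16 * r" using r by simp
      moreover have "4 + 2 * r \<noteq> 0" using r by simp
      ultimately show ?thesis by (simp add: eq_divide_eq)
    qed
    also have "\<dots> = (S / (4 + 2 * r))\<^sup>2"
      unfolding S(2)[symmetric] by (simp add: power_divide)
    finally show ?thesis
      using S r by simp
  qed
  have v3: "sqrt ((10 + 4 * r) / 5) = S / (2 * r)"
  proof -
    have "(2 * r)\<^sup>2 = 20"
      using r by (simp add: power2_eq_square)
    then have "(10 + 4 * r) / 5 = (40 + 16 * r) / (2 * r)\<^sup>2"
      by simp
    also have "\<dots> = (S / (2 * r))\<^sup>2"
      unfolding S(2)[symmetric] by (simp add: power_divide)
    finally show ?thesis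
      using S r by simp
  qed
  have I1: "((\<lambda>q. euler_E q ^ 8 * euler_E (q ^ 10) ^ 3 / euler_E (q ^ 2) ^ 7) has_integral
      (- (1 + K\<^sup>2) / (1 + K - K\<^sup>2) - - (1 + 0\<^sup>2) / (1 + 0 - 0\<^sup>2))) {0..Q}"
    unfolding K_def
  \<comment> \<open>This is \<open>- s / (h + 1)\<close> expanded by k, hence regular at
    \<open>k = 0\<close>. The numerator of the derivative is \<open>k (h - 4)\<close>, itself an eta
    quotient up to the factor k, which is why the integrand is a pure eta quotient.\<close>
  proof (rule has_integral_ramanujan_k[OF Q, where G = "\<lambda>k. - (1 + k\<^sup>2) / (1 + k - k\<^sup>2)" and G' = "\<lambda>k. (1 - 4 * k - k\<^sup>2) / (1 + k - k\<^sup>2)\<^sup>2"])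
    fix q :: real assume q: "0 < q" "q < 1"
    define k where "k = ramanujan_k q"
    have k: "k > 0" "1 - 4 * k - k ^ 2 > 0" "1 + k - k ^ 2 > 0"
      unfolding k_def using ramanujan_k_pos[OF q] ramanujan_k_denominators[of q] q by auto
    have "((\<lambda>k. - (1 + k\<^sup>2) / (1 + k - k\<^sup>2)) has_real_derivative (1 - 4 * k - k\<^sup>2) / (1 + k - k\<^sup>2)\<^sup>2) (at k)"
      using k(3) by (auto intro!: derivative_eq_intros simp: power2_eq_square algebra_simps)
    then show "((\<lambda>k. - (1 + k\<^sup>2) / (1 + k - k\<^sup>2)) has_real_derivative (1 - 4 * ramanujan_k q - (ramanujan_k q)\<^sup>2) / (1 + ramanujan_k q - (ramanujan_k q)\<^sup>2)\<^sup>2) (at (ramanujan_k q))"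
      unfolding k_def .
    define a b c d where E: "a = euler_E q" "b = euler_E (q ^ 2)" "c = euler_E (q ^ 5)" "d = euler_E (q ^ 10)"
    have pos: "a > 0" "b > 0" "c > 0" "d > 0"
      unfolding E using q by (auto intro!: euler_E_pos simp: power_less_one_iff)
    have den: "1 - 4 * k - k\<^sup>2 = k * (a ^ 3 * c / (q * b * d ^ 3))" "1 + k - k\<^sup>2 = k * (b ^ 4 * c ^ 2 / (q * a ^ 2 * d ^ 4))"
      using hauptmodul_minus_4[OF q] hauptmodul_plus_1[OF q] hauptmodul_eq_ramanujan_k[OF q] k(1)
      unfolding E k_def[symmetric] by (simp_all add: field_simps power2_eq_square)
    show "(1 - 4 * ramanujan_k q - (ramanujan_k q)\<^sup>2) / (1 + ramanujan_k q - (ramanujan_k q)\<^sup>2)\<^sup>2 *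
        (ramanujan_k q * (euler_E q * (euler_E (q ^ 2))\<^sup>2 * euler_E (q ^ 5) ^ 3 / (euler_E (q ^ 10))\<^sup>2) / q)
      = euler_E q ^ 8 * euler_E (q ^ 10) ^ 3 / euler_E (q ^ 2) ^ 7"
      unfolding E[symmetric] k_def[symmetric] den using pos q k(1)
      by (simp add: divide_simps) (simp add: eval_nat_numeral)
  qed (auto intro!: continuous_intros)
  have I2: "((\<lambda>q. q * euler_E q ^ 3 * euler_E (q ^ 10) ^ 8 / euler_E (q ^ 5) ^ 7) has_integral
      ((1 + K\<^sup>2) / (1 - K\<^sup>2) / 4 - (1 + 0\<^sup>2) / (1 - 0\<^sup>2) / 4)) {0..Q}"
    unfolding K_def
  \<comment> \<open>The primitive \<open>s / (4 h)\<close>. Differentiating \<open>s / h\<close>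
    leaves \<open>4 k\<close> in the numerator; the factor 1/4 removes the 4.\<close>
  proof (rule has_integral_ramanujan_k[OF Q, where G = "\<lambda>k. (1 + k\<^sup>2) / (1 - k\<^sup>2) / 4" and G' = "\<lambda>k. k / (1 - k\<^sup>2)\<^sup>2"])
    fix q :: real assume q: "0 < q" "q < 1"
    define k where "k = ramanujan_k q"
    have k: "k > 0" "1 - k ^ 2 > 0"
      unfolding k_def using ramanujan_k_pos[OF q] ramanujan_k_denominators[of q] q by auto
    have "((\<lambda>k. (1 + k\<^sup>2) / (1 - k\<^sup>2)) has_real_derivative 4 * (k / (1 - k\<^sup>2)\<^sup>2)) (at k)"
      using k(2) by (auto intro!: derivative_eq_intros simp: power2_eq_square algebra_simps)
    from DERIV_cdivide[OF this, of 4] show "((\<lambda>k. (1 + k\<^sup>2) / (1 - k\<^sup>2) / 4) has_real_derivative ramanujan_k q / (1 - (ramanujan_k q)\<^sup>2)\<^sup>2) (at (ramanujan_k q))"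
      unfolding k_def nonzero_mult_div_cancel_left[OF zero_neq_numeral[symmetric]] .
    define a b c d where E: "a = euler_E q" "b = euler_E (q ^ 2)" "c = euler_E (q ^ 5)" "d = euler_E (q ^ 10)"
    have pos: "a > 0" "b > 0" "c > 0" "d > 0"
      unfolding E using q by (auto intro!: euler_E_pos simp: power_less_one_iff)
    have den: "1 - k\<^sup>2 = k * (b * c ^ 5 / (q * a * d ^ 5))"
      using hauptmodul_eq_ramanujan_k[OF q] k(1)
      unfolding hauptmodul_def E k_def[symmetric] by (simp add: field_simps power2_eq_square)
    show "ramanujan_k q / (1 - (ramanujan_k q)\<^sup>2)\<^sup>2 *
        (ramanujan_k q * (euler_E q * (euler_E (q ^ 2))\<^sup>2 * euler_E (q ^ 5) ^ 3 / (euler_E (q ^ 10))\<^sup>2) / q)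
      = q * euler_E q ^ 3 * euler_E (q ^ 10) ^ 8 / euler_E (q ^ 5) ^ 7"
      unfolding E[symmetric] k_def[symmetric] den using pos q k(1)
      by (simp add: divide_simps) (simp add: eval_nat_numeral)
  qed (auto intro!: continuous_intros)
  have I3: "((\<lambda>q. euler_E (q ^ 2) ^ 8 * euler_E (q ^ 5) ^ 3 / euler_E q ^ 7) has_integral
      ((1 + K\<^sup>2) / (1 - 4 * K - K\<^sup>2) / 4 - (1 + 0\<^sup>2) / (1 - 4 * 0 - 0\<^sup>2) / 4)) {0..Q}"
    unfolding K_def
  \<comment> \<open>The primitive \<open>s / (4 (h - 4))\<close>; the roles of \<open>h + 1\<close>
    and \<open>h - 4\<close> are exchanged compared with the first integral.\<close>
  proof (rule has_integral_ramanujan_k[OF Q, where G = "\<lambda>k. (1 + k\<^sup>2) / (1 - 4 * k - k\<^sup>2) / 4" and G' = "\<lambda>k. (1 + k - k\<^sup>2) / (1 - 4 * k - k\<^sup>2)\<^sup>2"])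
    fix q :: real assume q: "0 < q" "q < 1"
    define k where "k = ramanujan_k q"
    have k: "k > 0" "1 - 4 * k - k ^ 2 > 0" "1 + k - k ^ 2 > 0"
      unfolding k_def using ramanujan_k_pos[OF q] ramanujan_k_denominators[of q] q by auto
    have "((\<lambda>k. (1 + k\<^sup>2) / (1 - 4 * k - k\<^sup>2)) has_real_derivative 4 * ((1 + k - k\<^sup>2) / (1 - 4 * k - k\<^sup>2)\<^sup>2)) (at k)"
      using k(2) by (auto intro!: derivative_eq_intros simp: power2_eq_square algebra_simps)
    from DERIV_cdivide[OF this, of 4] show "((\<lambda>k. (1 + k\<^sup>2) / (1 - 4 * k - k\<^sup>2) / 4) has_real_derivative (1 + ramanujan_k q - (ramanujan_k q)\<^sup>2) / (1 - 4 * ramanujan_k q - (ramanujan_k q)\<^sup>2)\<^sup>2) (at (ramanujan_k q))"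
      unfolding k_def nonzero_mult_div_cancel_left[OF zero_neq_numeral[symmetric]] .
    define a b c d where E: "a = euler_E q" "b = euler_E (q ^ 2)" "c = euler_E (q ^ 5)" "d = euler_E (q ^ 10)"
    have pos: "a > 0" "b > 0" "c > 0" "d > 0"
      unfolding E using q by (auto intro!: euler_E_pos simp: power_less_one_iff)
    have den: "1 - 4 * k - k\<^sup>2 = k * (a ^ 3 * c / (q * b * d ^ 3))" "1 + k - k\<^sup>2 = k * (b ^ 4 * c ^ 2 / (q * a ^ 2 * d ^ 4))"
      using hauptmodul_minus_4[OF q] hauptmodul_plus_1[OF q] hauptmodul_eq_ramanujan_k[OF q] k(1)
      unfolding E k_def[symmetric] by (simp_all add: field_simps power2_eq_square)
    show "(1 + ramanujan_k q - (ramanujan_k q)\<^sup>2) / (1 - 4 * ramanujan_k q - (ramanujan_k q)\<^sup>2)\<^sup>2 *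
        (ramanujan_k q * (euler_E q * (euler_E (q ^ 2))\<^sup>2 * euler_E (q ^ 5) ^ 3 / (euler_E (q ^ 10))\<^sup>2) / q)
      = euler_E (q ^ 2) ^ 8 * euler_E (q ^ 5) ^ 3 / euler_E q ^ 7"
      unfolding E[symmetric] k_def[symmetric] den using pos q k(1)
      by (simp add: divide_simps) (simp add: eval_nat_numeral)
  qed (auto intro!: continuous_intros)
  \<comment> \<open>The values of the primitives at \<open>k = 0\<close> supply the summands 1, -1/4
    and -1/4 of the results.\<close>
  have e: "- x / y - - (1 + 0\<^sup>2) / (1 + 0 - 0\<^sup>2) = 1 - x / y"
    "x / 4 - (1 + 0\<^sup>2) / (1 - 0\<^sup>2) / 4 = (x - 1) / 4"
    "x / 4 - (1 + 0\<^sup>2) / (1 - 4 * 0 - 0\<^sup>2) / 4 = (x - 1) / 4" for x y :: real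
    by (simp_all add: diff_divide_distrib)
  show ?thesis
    using I1 I2 I3 unfolding e Q_def[symmetric] r_def[symmetric] v1 v2 v3 G[symmetric] by blast
qed

end
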